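(* Let $\mathcal{K}$ and $\mathcal{M}$ be diffeological étale manifolds such that $\mathcal{K}$ is D-compact (i.e., compact with respect to the D-topology), and let $\mathrm{C}^{\infty}(\mathcal{K},\mathcal{M})$ be equipped with the functional diffeology. (a) The following subsets of $\mathrm{C}^{\infty}(\mathcal{K},\mathcal{M})$ are D-open in $\mathrm{C}^{\infty}(\mathcal{K},\mathcal{M})$: (a1) the set of diffeological submersions $\mathcal{K}\to\mathcal{M}$; (a2) the set of diffeological immersions $\mathcal{K}\to\mathcal{M}$; (a3) the set of diffeological étale maps $\mathcal{K}\to\mathcal{M}$; (a4) the set of local subductions $\mathcal{K}\to\mathcal{M}$, provided that $\mathcal{M}$ is D-Hausdorff. (b) If $\mathcal{M}$ is a usual manifold, then the following subsets of $\mathrm{C}^{\infty}(\mathcal{K},\mathcal{M})$ are D-open in $\mathrm{C}^{\infty}(\mathcal{K},\mathcal{M})$: (b1) the set of injective diffeological immersions $\mathcal{K}\to\mathcal{M}$; (b2) the set of diffeological embeddings $\mathcal{K}\to\mathcal{M}$; (b3) the set of diffeomorphisms $\mathcal{K}\to\mathcal{M}$. (c) Let $\mathsf{Inj}^{\infty}(\mathcal{K},\mathcal{M})\subseteq \mathrm{C}^{\infty}(\mathcal{K},\mathcal{M})$ be the diffeological subspace of injective smooth maps from $\mathcal{K}$ to $\mathcal{M}$. If $\mathcal{M}$ is D-Hausdorff, then the following subsets of $\mathsf{Inj}^{\infty}(\mathcal{K},\mathcal{M})$ are D-open in $\mathsf{Inj}^{\infty}(\mathcal{K},\mathcal{M})$: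 (c1) the set of diffeological embeddings $\mathcal{K}\to\mathcal{M}$; (c2) the set of diffeomorphisms $\mathcal{K}\to\mathcal{M}$.
   Context: Diffeological spaces, plots, smooth maps, diffeomorphisms, product and subspace diffeologies are the standard notions. Plots of $X$ are certain maps $P:U\to X$ with $U$ an open subset of some $\mathbb{R}^n$ ("$n$-domain" means open subset of $\mathbb{R}^n$). A "usual manifold" is a second-countable Hausdorff finite-dimensional smooth manifold, with its standard diffeology. Functional diffeology: for diffeological spaces $X,Y$, a map $P:U\to \mathrm{C}^{\infty}(X,Y)$ is a plot iff $(u,x)\mapsto P(u)(x)$ is a smooth map $U\times X\to Y$. D-topology: a subset $A$ of a diffeological space $X$ is D-open iff $P^{-1}(A)$ is open for every plot $P$ of $X$. The prefix "D-" before a topological property means that property with respect to the D-topology. D-open subsets of $\mathsf{Inj}^{\infty}(\mathcal{K},\mathcal{M})$ are taken with respect to the D-topology of its subspace diffeology. Pullbacks: for a smooth map $f:X\to Y$ and a plot $P:U\to Y$, let $P^*X=\{(r,x)\in U\times X : P(r)=f(x)\}$ with the subspace diffeology from $U\times X$, and let $P^*f:P^*X\to U$, $P^*f(r,x)=r$ (the pullback of $f$ by $P$). Submersion: a smooth map $f:X\to Y$ such that for each $x_0\in X$ there is a smooth map $\sigma:O\to X$ on a D-open subset $O\subseteq Y$, passing through $x_0$ (i.e. $x_0\in\sigma(O)$), with $f\circ\sigma(y)=y$ for all $y\in O$. Diffeological submersion: a smooth map $f:X\to Y$ such that $P^*f$ is a submersion for every plot $P$ in $Y$. Diffeological immersion: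 a smooth map $f:X\to Y$ such that for every plot $P:U\to Y$ and every $(r_0,x_0)\in P^*X$ there exist a D-open neighborhood $O$ of $(r_0,x_0)$ in $P^*X$, an open neighborhood $V\subseteq U$ of $P^*f(O)$, and a smooth map $\varrho:V\to U\times X$ such that $\varrho\circ P^*f(r,x)=(r,x)$ for all $(r,x)\in O$. Diffeological embedding: a map that is both a diffeological immersion and a D-embedding (a topological embedding for the D-topologies). Étale map: a map $f:X\to Y$ such that every $x\in X$ has a D-open neighborhood $O\subseteq X$ and $f(x)$ has a D-open neighborhood $V\subseteq Y$ such that $f|_O:O\to V$ is a diffeomorphism. Diffeological étale map: a smooth map $f:X\to Y$ such that $P^*f$ is étale for every plot $P$ in $Y$. Local subduction: a surjective smooth map $f:X\to Y$ such that for every plot $P:U\to Y$, every $r_0\in U$ and every $x\in X$ with $f(x)=P(r_0)$, there are an open neighborhood $V\subseteq U$ of $r_0$ and a plot $L:V\to X$ with $L(r_0)=x$ and $f\circ L=P|_V$. Diffeological étale $n$-manifold: a diffeological space $\mathcal{M}$ for which there is a family of diffeological étale maps from $n$-domains into $\mathcal{M}$ whose images cover $\mathcal{M}$. A diffeological étale manifold is a diffeological étale $n$-manifold for some $n$. *)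

theory Defs
  imports "HOL-Analysis.Analysis"
begin

section \<open>Smooth maps between open subsets of Euclidean spaces\<close>

text \<open>
  Plots have domains in all dimensions at once, so \<open>\<real>\<^sup>n\<close> is rendered by the library's
  \<^const>\<open>Euclidean_space\<close>, whose points are the sequences vanishing from index \<open>n\<close> on.
\<close>

text \<open>
  \<open>C_diff n k U f\<close>: \<open>f\<close> is of class \<open>C\<^sup>k\<close> on the open set \<open>U \<subseteq> \<real>\<^sup>n\<close>, i.e. all iterated
  partial derivatives of order at most \<open>k\<close> exist and are continuous on \<open>U\<close>.
  Values of \<open>f\<close> outside \<open>U\<close> are irrelevant.
\<close>

primrec C_diff :: "nat \<Rightarrow> nat \<Rightarrow> (nat \<Rightarrow> real) set \<Rightarrow> ((nat \<Rightarrow> real) \<Rightarrow> real) \<Rightarrow> bool" where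
  "C_diff n 0 U f \<longleftrightarrow> continuous_map (subtopology (Euclidean_space n) U) euclideanreal f"
| "C_diff n (Suc k) U f \<longleftrightarrow>
     continuous_map (subtopology (Euclidean_space n) U) euclideanreal f \<and>
     (\<forall>i<n. \<exists>g. (\<forall>x\<in>U. ((\<lambda>t. f (x(i := t))) has_real_derivative g x) (at (x i))) \<and>
                C_diff n k U g)"

definition smooth_euclid ::
    "nat \<Rightarrow> (nat \<Rightarrow> real) set \<Rightarrow> nat \<Rightarrow> ((nat \<Rightarrow> real) \<Rightarrow> (nat \<Rightarrow> real)) \<Rightarrow> bool" where
  "smooth_euclid n U m F \<longleftrightarrow>
     openin (Euclidean_space n) U \<and> F \<in> U \<rightarrow> topspace (Euclidean_space m) \<and>
     (\<forall>j<m. \<forall>k. C_diff n k U (\<lambda>x. F x j))"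

section \<open>Diffeological spaces\<close>

text \<open>
  \<open>plot X n U P\<close>: the restriction of \<open>P\<close> to the open set \<open>U \<subseteq> \<real>\<^sup>n\<close> is a plot of \<open>X\<close>.  HOL
  functions are total, so the axiom \<open>plot_cong\<close> says that only the restriction matters.
\<close>

record 'a diffeology =
  dspace :: "'a set"
  plot :: "nat \<Rightarrow> (nat \<Rightarrow> real) set \<Rightarrow> ((nat \<Rightarrow> real) \<Rightarrow> 'a) \<Rightarrow> bool"

locale diffeological_space =
  fixes X :: "'a diffeology"
  assumes plot_open: "plot X n U P \<Longrightarrow> openin (Euclidean_space n) U"
    and plot_into: "plot X n U P \<Longrightarrow> P \<in> U \<rightarrow> dspace X"
    and plot_cong: "\<lbrakk>plot X n U P; \<And>r. r \<in> U \<Longrightarrow> Q r = P r\<rbrakk> \<Longrightarrow> plot X n U Q"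
    and plot_const: "\<lbrakk>openin (Euclidean_space n) U; x \<in> dspace X\<rbrakk> \<Longrightarrow> plot X n U (\<lambda>_. x)"
    and plot_local: "\<lbrakk>openin (Euclidean_space n) U; P \<in> U \<rightarrow> dspace X;
        \<And>r. r \<in> U \<Longrightarrow> \<exists>V. V \<subseteq> U \<and> r \<in> V \<and> plot X n V P\<rbrakk> \<Longrightarrow> plot X n U P"
    and plot_comp: "\<lbrakk>plot X n U P; smooth_euclid m V n F; F \<in> V \<rightarrow> U\<rbrakk> \<Longrightarrow> plot X m V (P \<circ> F)"

definition smooth :: "'a diffeology \<Rightarrow> 'b diffeology \<Rightarrow> ('a \<Rightarrow> 'b) \<Rightarrow> bool" where
  "smooth X Y f \<longleftrightarrow> f \<in> dspace X \<rightarrow> dspace Y \<and>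
     (\<forall>n U P. plot X n U P \<longrightarrow> plot Y n U (f \<circ> P))"

definition diffeomorphism :: "'a diffeology \<Rightarrow> 'b diffeology \<Rightarrow> ('a \<Rightarrow> 'b) \<Rightarrow> bool" where
  "diffeomorphism X Y f \<longleftrightarrow> bij_betw f (dspace X) (dspace Y) \<and>
     smooth X Y f \<and> smooth Y X (inv_into (dspace X) f)"

definition euclid_dfl :: "nat \<Rightarrow> (nat \<Rightarrow> real) set \<Rightarrow> (nat \<Rightarrow> real) diffeology" where
  "euclid_dfl n U = \<lparr>dspace = U, plot = (\<lambda>m V F. smooth_euclid m V n F \<and> F \<in> V \<rightarrow> U)\<rparr>"

definition sub_dfl :: "'a diffeology \<Rightarrow> 'a set \<Rightarrow> 'a diffeology" where
  "sub_dfl X A = \<lparr>dspace = dspace X \<inter> A, plot = (\<lambda>n U P. plot X n U P \<and> P \<in> U \<rightarrow> A)\<rparr>"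

definition prod_dfl :: "'a diffeology \<Rightarrow> 'b diffeology \<Rightarrow> ('a \<times> 'b) diffeology" where
  "prod_dfl X Y = \<lparr>dspace = dspace X \<times> dspace Y,
     plot = (\<lambda>n U P. plot X n U (fst \<circ> P) \<and> plot Y n U (snd \<circ> P))\<rparr>"

text \<open>
  Elements of \<open>C\<^sup>\<infinity>(X,Y)\<close> are taken to be extensional (\<^const>\<open>undefined\<close> outside
  the space \<open>X\<close>), so that equality is equality of maps \<open>X \<rightarrow> Y\<close>.
\<close>

definition smooth_maps :: "'a diffeology \<Rightarrow> 'b diffeology \<Rightarrow> ('a \<Rightarrow> 'b) set" where
  "smooth_maps X Y = {f \<in> extensional (dspace X). smooth X Y f}"

definition functional_dfl :: "'a diffeology \<Rightarrow> 'b diffeology \<Rightarrow> ('a \<Rightarrow> 'b) diffeology" where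
  "functional_dfl X Y = \<lparr>dspace = smooth_maps X Y,
     plot = (\<lambda>n U P. openin (Euclidean_space n) U \<and> P \<in> U \<rightarrow> smooth_maps X Y \<and>
       smooth (prod_dfl (euclid_dfl n U) X) Y (\<lambda>(u, x). P u x))\<rparr>"

section \<open>The D-topology\<close>

definition D_topology :: "'a diffeology \<Rightarrow> 'a topology" where
  "D_topology X = topology (\<lambda>A. A \<subseteq> dspace X \<and>
     (\<forall>n U P. plot X n U P \<longrightarrow> openin (Euclidean_space n) {r \<in> U. P r \<in> A}))"

lemma openin_D_topology:
  "openin (D_topology X) A \<longleftrightarrow> A \<subseteq> dspace X \<and>
     (\<forall>n U P. plot X n U P \<longrightarrow> openin (Euclidean_space n) {r \<in> U. P r \<in> A})"
proof -
  define L where "L = (\<lambda>A. A \<subseteq> dspace X \<and>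
     (\<forall>n U P. plot X n U P \<longrightarrow> openin (Euclidean_space n) {r \<in> U. P r \<in> A}))"
  have LI: "L A" if "A \<subseteq> dspace X"
      "\<And>n U P. plot X n U P \<Longrightarrow> openin (Euclidean_space n) {r \<in> U. P r \<in> A}" for A
    unfolding L_def using that by blast
  have sub: "A \<subseteq> dspace X" if "L A" for A
    using that unfolding L_def by (rule conjunct1)
  have pre: "openin (Euclidean_space n) {r \<in> U. P r \<in> A}" if "L A" "plot X n U P" for A n U P
    using that unfolding L_def by blast
  have "istopology L"
    unfolding istopology_def
  proof (rule conjI; intro allI impI)
    fix S T
    assume S: "L S" and T: "L T"
    show "L (S \<inter> T)"
    proof (rule LI)
      show "S \<inter> T \<subseteq> dspace X"
        using sub[OF S] by (rule le_infI1)
    next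
      fix n U P
      assume "plot X n U P"
      then have "openin (Euclidean_space n) ({r \<in> U. P r \<in> S} \<inter> {r \<in> U. P r \<in> T})"
        by (intro openin_Int pre S T)
      moreover have "{r \<in> U. P r \<in> S} \<inter> {r \<in> U. P r \<in> T} = {r \<in> U. P r \<in> S \<inter> T}"
        by auto
      ultimately show "openin (Euclidean_space n) {r \<in> U. P r \<in> S \<inter> T}"
        by (simp only:)
    qed
  next
    fix \<K>
    assume \<K>: "\<forall>K\<in>\<K>. L K"
    show "L (\<Union>\<K>)"
    proof (rule LI)
      show "\<Union>\<K> \<subseteq> dspace X"
        using \<K> sub by (simp add: Sup_le_iff)
    next
      fix n U P
      assume P: "plot X n U P"
      have "openin (Euclidean_space n) (\<Union>K\<in>\<K>. {r \<in> U. P r \<in> K})"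
        by (intro openin_Union) (use \<K> pre[OF _ P] in auto)
      moreover have "(\<Union>K\<in>\<K>. {r \<in> U. P r \<in> K}) = {r \<in> U. P r \<in> \<Union>\<K>}"
        by auto
      ultimately show "openin (Euclidean_space n) {r \<in> U. P r \<in> \<Union>\<K>}"
        by (simp only:)
    qed
  qed
  then have "openin (topology L) = L"
    by (rule topology_inverse')
  moreover have "D_topology X = topology L"
    unfolding D_topology_def L_def ..
  ultimately show ?thesis
    by (simp only: L_def)
qed

lemma (in diffeological_space) topspace_D_topology: "topspace (D_topology X) = dspace X"
proof
  show "topspace (D_topology X) \<subseteq> dspace X"
    using openin_topspace[of "D_topology X"] unfolding openin_D_topology by (rule conjunct1)
  have "{r \<in> U. P r \<in> dspace X} = U" if "plot X n U P" for n U P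
    using plot_into[OF that] by auto
  then have "openin (D_topology X) (dspace X)"
    by (simp add: openin_D_topology plot_open)
  then show "dspace X \<subseteq> topspace (D_topology X)"
    by (rule openin_subset)
qed

section \<open>Pullbacks, submersions, immersions, etale maps\<close>

text \<open>\<open>pullback_dfl X f n U P\<close> is \<open>P\<^sup>*X\<close>; the map \<open>P\<^sup>*f\<close> is \<^const>\<open>fst\<close>.\<close>

definition pullback_dfl :: "'a diffeology \<Rightarrow> ('a \<Rightarrow> 'b) \<Rightarrow> nat \<Rightarrow> (nat \<Rightarrow> real) set \<Rightarrow>
    ((nat \<Rightarrow> real) \<Rightarrow> 'b) \<Rightarrow> ((nat \<Rightarrow> real) \<times> 'a) diffeology" where
  "pullback_dfl X f n U P =
     sub_dfl (prod_dfl (euclid_dfl n U) X) {(r, x). r \<in> U \<and> x \<in> dspace X \<and> P r = f x}"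

definition submersion :: "'a diffeology \<Rightarrow> 'b diffeology \<Rightarrow> ('a \<Rightarrow> 'b) \<Rightarrow> bool" where
  "submersion X Y f \<longleftrightarrow> smooth X Y f \<and>
     (\<forall>x0\<in>dspace X. \<exists>Q \<sigma>. openin (D_topology Y) Q \<and> smooth (sub_dfl Y Q) X \<sigma> \<and>
        x0 \<in> \<sigma> ` Q \<and> (\<forall>y\<in>Q. f (\<sigma> y) = y))"

definition diffeological_submersion ::
    "'a diffeology \<Rightarrow> 'b diffeology \<Rightarrow> ('a \<Rightarrow> 'b) \<Rightarrow> bool" where
  "diffeological_submersion X Y f \<longleftrightarrow> smooth X Y f \<and>
     (\<forall>n U P. plot Y n U P \<longrightarrow> submersion (pullback_dfl X f n U P) (euclid_dfl n U) fst)"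

definition diffeological_immersion ::
    "'a diffeology \<Rightarrow> 'b diffeology \<Rightarrow> ('a \<Rightarrow> 'b) \<Rightarrow> bool" where
  "diffeological_immersion X Y f \<longleftrightarrow> smooth X Y f \<and>
     (\<forall>n U P. plot Y n U P \<longrightarrow> (\<forall>p\<in>dspace (pullback_dfl X f n U P).
        \<exists>Q V \<rho>. openin (D_topology (pullback_dfl X f n U P)) Q \<and> p \<in> Q \<and>
          openin (Euclidean_space n) V \<and> V \<subseteq> U \<and> fst ` Q \<subseteq> V \<and>
          smooth (euclid_dfl n V) (prod_dfl (euclid_dfl n U) X) \<rho> \<and>
          (\<forall>q\<in>Q. \<rho> (fst q) = q)))"

definition diffeological_embedding ::
    "'a diffeology \<Rightarrow> 'b diffeology \<Rightarrow> ('a \<Rightarrow> 'b) \<Rightarrow> bool" where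
  "diffeological_embedding X Y f \<longleftrightarrow>
     diffeological_immersion X Y f \<and> embedding_map (D_topology X) (D_topology Y) f"

definition etale :: "'a diffeology \<Rightarrow> 'b diffeology \<Rightarrow> ('a \<Rightarrow> 'b) \<Rightarrow> bool" where
  "etale X Y f \<longleftrightarrow> f \<in> dspace X \<rightarrow> dspace Y \<and>
     (\<forall>x\<in>dspace X. \<exists>Q V. openin (D_topology X) Q \<and> x \<in> Q \<and>
        openin (D_topology Y) V \<and> f x \<in> V \<and> diffeomorphism (sub_dfl X Q) (sub_dfl Y V) f)"

definition diffeological_etale ::
    "'a diffeology \<Rightarrow> 'b diffeology \<Rightarrow> ('a \<Rightarrow> 'b) \<Rightarrow> bool" where
  "diffeological_etale X Y f \<longleftrightarrow> smooth X Y f \<and>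
     (\<forall>n U P. plot Y n U P \<longrightarrow> etale (pullback_dfl X f n U P) (euclid_dfl n U) fst)"

definition local_subduction :: "'a diffeology \<Rightarrow> 'b diffeology \<Rightarrow> ('a \<Rightarrow> 'b) \<Rightarrow> bool" where
  "local_subduction X Y f \<longleftrightarrow> smooth X Y f \<and> f ` dspace X = dspace Y \<and>
     (\<forall>n U P. plot Y n U P \<longrightarrow> (\<forall>r0\<in>U. \<forall>x\<in>dspace X. f x = P r0 \<longrightarrow>
        (\<exists>V L. openin (Euclidean_space n) V \<and> V \<subseteq> U \<and> r0 \<in> V \<and>
           plot X n V L \<and> L r0 = x \<and> (\<forall>r\<in>V. f (L r) = P r))))"

section \<open>Etale manifolds and usual manifolds\<close>

definition diffeological_etale_n_manifold :: "nat \<Rightarrow> 'a diffeology \<Rightarrow> bool" where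
  "diffeological_etale_n_manifold n M \<longleftrightarrow> diffeological_space M \<and>
     (\<exists>\<F> :: ((nat \<Rightarrow> real) set \<times> ((nat \<Rightarrow> real) \<Rightarrow> 'a)) set.
        (\<forall>(U, \<phi>)\<in>\<F>. openin (Euclidean_space n) U \<and> diffeological_etale (euclid_dfl n U) M \<phi>) \<and>
        (\<Union>(U, \<phi>)\<in>\<F>. \<phi> ` U) = dspace M)"

definition diffeological_etale_manifold :: "'a diffeology \<Rightarrow> bool" where
  "diffeological_etale_manifold M \<longleftrightarrow> (\<exists>n. diffeological_etale_n_manifold n M)"

text \<open>Charts are pairs of a chart domain and a coordinate map; atlases need not be maximal.\<close>

definition smooth_atlas ::
    "nat \<Rightarrow> 'a topology \<Rightarrow> ('a set \<times> ('a \<Rightarrow> (nat \<Rightarrow> real))) set \<Rightarrow> bool" where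
  "smooth_atlas n T \<A> \<longleftrightarrow>
     (\<forall>(W, \<phi>)\<in>\<A>. openin T W \<and> openin (Euclidean_space n) (\<phi> ` W) \<and>
        homeomorphic_map (subtopology T W) (subtopology (Euclidean_space n) (\<phi> ` W)) \<phi>) \<and>
     (\<Union>(W, \<phi>)\<in>\<A>. W) = topspace T \<and>
     (\<forall>(W, \<phi>)\<in>\<A>. \<forall>(W', \<phi>')\<in>\<A>.
        smooth_euclid n (\<phi> ` (W \<inter> W')) n (\<phi>' \<circ> inv_into W \<phi>))"

text \<open>
  The plots of the standard diffeology of a manifold are the maps from open subsets of
  Euclidean spaces that are smooth in the sense of manifolds.
\<close>

definition manifold_plot ::
    "nat \<Rightarrow> 'a topology \<Rightarrow> ('a set \<times> ('a \<Rightarrow> (nat \<Rightarrow> real))) set \<Rightarrow>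
     nat \<Rightarrow> (nat \<Rightarrow> real) set \<Rightarrow> ((nat \<Rightarrow> real) \<Rightarrow> 'a) \<Rightarrow> bool" where
  "manifold_plot n T \<A> m U P \<longleftrightarrow> openin (Euclidean_space m) U \<and>
     continuous_map (subtopology (Euclidean_space m) U) T P \<and>
     (\<forall>(W, \<phi>)\<in>\<A>. smooth_euclid m {r \<in> U. P r \<in> W} n (\<phi> \<circ> P))"

definition usual_manifold :: "'a diffeology \<Rightarrow> bool" where
  "usual_manifold M \<longleftrightarrow>
     (\<exists>n T \<A>. topspace T = dspace M \<and> Hausdorff_space T \<and> second_countable T \<and>
        smooth_atlas n T \<A> \<and> (\<forall>m U P. plot M m U P \<longleftrightarrow> manifold_plot n T \<A> m U P))"

end

theory Submission
  imports Defs
begin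

text \<open>
  Plots lift locally through an etale map, and the germ of a lift is determined by its value at a
  point.  Lifting to charts, a plot \<open>w \<mapsto> p w\<close> of smooth maps near a point of \<open>K\<close> becomes a smooth family
  \<open>F (w, u)\<close> of maps between Euclidean domains.  If \<open>p w\<^sub>0\<close> is a submersion, a section \<open>s\<close> of \<open>F (w\<^sub>0, _)\<close>
  makes \<open>(w, u, v) \<mapsto> (w, u, F (w, u - u\<^sub>0 + s v))\<close> a parametrised family which is the identity in
  \<open>v\<close> for \<open>(w, u) = (w\<^sub>0, u\<^sub>0)\<close>; if it is an immersion, a retraction \<open>r\<close> does the same for
  \<open>(w, u) \<mapsto> (w, r (F (w, u)))\<close>.  Such families are invertible nearby, which yields sections
  and retractions for all nearby \<open>w\<close> and \<open>u\<close>; compactness of \<open>K\<close> makes the neighbourhood of \<open>w\<^sub>0\<close> uniform.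
  The sections also cover a fixed neighbourhood of the image point, so surjectivity persists.
  All other classes reduce to these: etale maps are the immersive submersions, local subductions the surjective submersions, diffeomorphisms the injective local
  subductions, and embeddings (\<open>M\<close> Hausdorff) the injective immersions.  If \<open>M\<close> is a usual
  manifold its charts are injective, so the local retractions give local injectivity and compactness of
  \<open>K \<times> K\<close> gives injectivity.
\<close>

section \<open>Calculus in coordinates\<close>

text \<open>The obstacle is that an etale chart need not be injective, so a map need not have a
  coordinate expression on a whole chart: lifts exist only as germs, each fixed by one value. The
  sections and retractions of a submersion or immersion take values in \<open>K\<close>; they have
  to be lifted to charts, and an identity such as "map after section is the identity" holds in
  coordinates only after shrinking to where two lifts with a common value agree. The families are
  shaped so that neither ranks nor linear algebra enter. A section or retraction of the single map
  at w0, combined with the whole family, is exactly the identity on the slice over the base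
  parameter, so every partial derivative needed for inversion equals 1 at the base point. The
  summand u - u0 is there because the section passes through u0 but not through every nearby u: it
  shifts the section to pass through u and changes nothing at u = u0. Inverting in all variables
  together gives neighbourhoods that do not depend on w, as compactness requires.\<close>

abbreviation eopen :: "nat \<Rightarrow> (nat \<Rightarrow> real) set \<Rightarrow> bool" where
  "eopen n U \<equiv> openin (Euclidean_space n) U"

section \<open>Neighbourhoods, continuity and limits by coordinate cubes\<close>

definition cube :: "nat \<Rightarrow> (nat \<Rightarrow> real) \<Rightarrow> real \<Rightarrow> (nat \<Rightarrow> real) set" where
  "cube n a e = {x \<in> topspace (Euclidean_space n). \<forall>i<n. \<bar>x i - a i\<bar> < e}"

lemma Euclid_iff: "x \<in> topspace (Euclidean_space n) \<longleftrightarrow> (\<forall>i\<ge>n. x i = 0)"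
  by (simp add: topspace_Euclidean_space)

lemma eopen_subset: "eopen n U \<Longrightarrow> x \<in> U \<Longrightarrow> x \<in> topspace (Euclidean_space n)"
  using openin_subset by blast

lemma cube_mono: "d \<le> e \<Longrightarrow> cube n a d \<subseteq> cube n a e"
  unfolding cube_def by fastforce

lemma cube_center: "a \<in> topspace (Euclidean_space n) \<Longrightarrow> 0 < e \<Longrightarrow> a \<in> cube n a e"
  by (simp add: cube_def)

lemma continuous_map_proj:
  "continuous_map (Euclidean_space n) euclideanreal (\<lambda>x. x i)"
  unfolding Euclidean_space_def
  by (rule continuous_map_from_subtopology) (rule continuous_map_product_projection, simp)

lemma eopen_cube: "eopen n (cube n a e)"
proof -
  have "eopen n {x \<in> topspace (Euclidean_space n). x i \<in> {y. \<bar>y - a i\<bar> < e}}" for i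
  proof (rule openin_continuous_map_preimage[OF continuous_map_proj])
    have "{y. \<bar>y - a i\<bar> < e} = ball (a i) e"
      by (auto simp: dist_real_def)
    then show "openin euclideanreal {y. \<bar>y - a i\<bar> < e}"
      by simp
  qed
  then have "eopen n (topspace (Euclidean_space n) \<inter>
      (\<Inter>i\<in>{..<n}. {x \<in> topspace (Euclidean_space n). x i \<in> {y. \<bar>y - a i\<bar> < e}}))"
    by (cases "n = 0") (auto intro!: openin_Int_Inter)
  also have "topspace (Euclidean_space n) \<inter>
      (\<Inter>i\<in>{..<n}. {x \<in> topspace (Euclidean_space n). x i \<in> {y. \<bar>y - a i\<bar> < e}}) = cube n a e"
    by (auto simp: cube_def)
  finally show ?thesis .
qed

text \<open>A basic open set of the product topology restricts each coordinate by a radius of its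
  own. From index \<open>n\<close> on both points vanish, so the minimum of the first
  \<open>n\<close> radii suffices; the inserted 1 keeps that minimum defined for
  \<open>n = 0\<close>.\<close>

lemma eopen_contains_cube:
  assumes "eopen n U" "x \<in> U"
  obtains e where "e > 0" "cube n x e \<subseteq> U"
proof -
  obtain T where T: "openin (powertop_real UNIV) T" and U: "U = T \<inter> {x. \<forall>i\<ge>n. x i = 0}"
    using assms(1) unfolding Euclidean_space_def openin_subtopology by blast
  have "x \<in> T" using assms U by auto
  from product_topology_open_contains_basis[OF T this]
  obtain X where X: "x \<in> (\<Pi>\<^sub>E i\<in>UNIV. X i)" "\<And>i. open (X i :: real set)"
    "(\<Pi>\<^sub>E i\<in>UNIV. X i) \<subseteq> T" by auto
  have xX: "x i \<in> X i" for i using X(1) by auto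
  have "\<exists>e>0. ball (x i) e \<subseteq> X i" for i
    using X(2) xX open_contains_ball by blast
  then obtain e where e: "\<And>i. e i > 0" "\<And>i. ball (x i) (e i) \<subseteq> X i" by metis
  define d where "d = Min (insert 1 (e ` {..<n}))"
  have d: "d > 0" "\<And>i. i < n \<Longrightarrow> d \<le> e i"
    using e(1) by (auto simp: d_def)
  have x0: "\<forall>i\<ge>n. x i = 0" using assms U by auto
  have "cube n x d \<subseteq> U"
  proof
    fix y assume y: "y \<in> cube n x d"
    have "y i \<in> X i" for i
    proof (cases "i < n")
      case True
      then have "\<bar>y i - x i\<bar> < e i" using y d(2)[of i] by (force simp: cube_def)
      then have "y i \<in> ball (x i) (e i)" by (simp add: dist_real_def abs_minus_commute)
      then show ?thesis using e(2) by blast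
    next
      case False
      then have "y i = x i" using y x0 by (simp add: cube_def Euclid_iff)
      then show ?thesis using xX by simp
    qed
    then have "y \<in> T" using X(3) by auto
    then show "y \<in> U" using y U by (auto simp: cube_def Euclid_iff)
  qed
  then show ?thesis using that d by blast
qed

lemma eopen_iff_cube:
  "eopen n U \<longleftrightarrow> U \<subseteq> topspace (Euclidean_space n) \<and> (\<forall>x\<in>U. \<exists>e>0. cube n x e \<subseteq> U)"
proof (intro iffI conjI ballI)
  assume "eopen n U" then show "U \<subseteq> topspace (Euclidean_space n)" by (rule openin_subset)
next
  fix x assume "eopen n U" "x \<in> U"
  then show "\<exists>e>0. cube n x e \<subseteq> U" using eopen_contains_cube by metis
next
  assume *: "U \<subseteq> topspace (Euclidean_space n) \<and> (\<forall>x\<in>U. \<exists>e>0. cube n x e \<subseteq> U)"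
  show "eopen n U"
    unfolding openin_subopen[of _ U]
  proof
    fix x assume "x \<in> U"
    then obtain e where "e > 0" "cube n x e \<subseteq> U" using * by blast
    moreover have "x \<in> cube n x e"
      using * \<open>x \<in> U\<close> \<open>e > 0\<close> by (intro cube_center) auto
    ultimately show "\<exists>T. eopen n T \<and> x \<in> T \<and> T \<subseteq> U" using eopen_cube by blast
  qed
qed

abbreviation econt :: "nat \<Rightarrow> (nat \<Rightarrow> real) set \<Rightarrow> ((nat \<Rightarrow> real) \<Rightarrow> real) \<Rightarrow> bool" where
  "econt n U f \<equiv> continuous_map (subtopology (Euclidean_space n) U) euclideanreal f"

lemma econtD:
  assumes "econt n U f" "eopen n U" "x \<in> U" "e > 0"
  obtains d where "d > 0" "cube n x d \<subseteq> U" "\<And>y. y \<in> cube n x d \<Longrightarrow> \<bar>f y - f x\<bar> < e"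
proof -
  have "openin (subtopology (Euclidean_space n) U)
      {y \<in> topspace (subtopology (Euclidean_space n) U). f y \<in> ball (f x) e}"
    using assms(1) by (rule openin_continuous_map_preimage) simp
  then have "eopen n {y \<in> topspace (subtopology (Euclidean_space n) U). f y \<in> ball (f x) e}"
    using assms(2) by (rule openin_trans_full)
  moreover have "x \<in> {y \<in> topspace (subtopology (Euclidean_space n) U). f y \<in> ball (f x) e}"
    using assms eopen_subset by auto
  ultimately obtain d where "d > 0"
    "cube n x d \<subseteq> {y \<in> topspace (subtopology (Euclidean_space n) U). f y \<in> ball (f x) e}"
    by (rule eopen_contains_cube)
  then show ?thesis using that[of d] by (auto simp: dist_real_def abs_minus_commute subset_iff)
qed

lemma econtI:
  assumes "eopen n U"
    and *: "\<And>x e. x \<in> U \<Longrightarrow> e > 0 \<Longrightarrow> \<exists>d>0. \<forall>y\<in>U \<inter> cube n x d. \<bar>f y - f x\<bar> < e"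
  shows "econt n U f"
proof -
  have "openin (subtopology (Euclidean_space n) U) {x \<in> U. f x \<in> S}" if "open S" for S
  proof -
    have "eopen n {x \<in> U. f x \<in> S}"
      unfolding eopen_iff_cube
    proof (intro conjI ballI)
      show "{x \<in> U. f x \<in> S} \<subseteq> topspace (Euclidean_space n)"
        using assms(1) eopen_subset by blast
      fix x assume x: "x \<in> {x \<in> U. f x \<in> S}"
      then obtain e where e: "e > 0" "ball (f x) e \<subseteq> S" using \<open>open S\<close> open_contains_ball by blast
      obtain d where d: "d > 0" "\<forall>y\<in>U \<inter> cube n x d. \<bar>f y - f x\<bar> < e" using * x e by blast
      obtain d' where d': "d' > 0" "cube n x d' \<subseteq> U"
        using eopen_contains_cube[OF assms(1)] x by blast
      have "cube n x (min d d') \<subseteq> {x \<in> U. f x \<in> S}"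
      proof
        fix y assume y: "y \<in> cube n x (min d d')"
        have "y \<in> cube n x d" "y \<in> cube n x d'"
          using y cube_mono[of "min d d'" d n x] cube_mono[of "min d d'" d' n x] by auto
        then have "y \<in> U" "\<bar>f y - f x\<bar> < e" using d d' by auto
        then show "y \<in> {x \<in> U. f x \<in> S}" using e by (auto simp: dist_real_def abs_minus_commute)
      qed
      then show "\<exists>e>0. cube n x e \<subseteq> {x \<in> U. f x \<in> S}" using d d' by (meson min_less_iff_conj)
    qed
    then show ?thesis by (simp add: openin_open_subtopology assms(1)) 
  qed
  moreover have "topspace (subtopology (Euclidean_space n) U) = U"
    using assms(1) openin_subset by fastforce
  ultimately show ?thesis by (auto simp: continuous_map_def)
qed

lemma econt_cong: "(\<And>x. x \<in> U \<Longrightarrow> f x = g x) \<Longrightarrow> econt n U f \<Longrightarrow> econt n U g"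
  by (rule continuous_map_eq[of _ _ f]) auto

lemma econt_mono: "econt n U f \<Longrightarrow> V \<subseteq> U \<Longrightarrow> econt n V f"
  by (rule continuous_map_from_subtopology_mono)

lemma tendsto_cube:
  assumes "\<And>i. i < n \<Longrightarrow> ((\<lambda>t. y t i) \<longlongrightarrow> x i) F"
    and "eventually (\<lambda>t. y t \<in> topspace (Euclidean_space n)) F" "e > 0"
  shows "eventually (\<lambda>t. y t \<in> cube n x e) F"
proof -
  have "eventually (\<lambda>t. \<forall>i\<in>{..<n}. \<bar>y t i - x i\<bar> < e) F"
    using assms tendstoD[of "\<lambda>t. y t _"] by (intro eventually_ball_finite) (auto simp: dist_real_def)
  with assms(2) show ?thesis by eventually_elim (auto simp: cube_def)
qed

lemma tendsto_eopen:
  assumes "eopen n U" "x \<in> U" "\<And>i. i < n \<Longrightarrow> ((\<lambda>t. y t i) \<longlongrightarrow> x i) F"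
    and "eventually (\<lambda>t. y t \<in> topspace (Euclidean_space n)) F"
  shows "eventually (\<lambda>t. y t \<in> U) F"
  by (rule eopen_contains_cube[OF assms(1,2)], frule tendsto_cube[OF assms(3,4)])
    (auto elim: eventually_mono)

lemma tendsto_econt:
  assumes "econt n U f" "eopen n U" "x \<in> U" "\<And>i. i < n \<Longrightarrow> ((\<lambda>t. y t i) \<longlongrightarrow> x i) F"
    and "eventually (\<lambda>t. y t \<in> topspace (Euclidean_space n)) F"
  shows "((\<lambda>t. f (y t)) \<longlongrightarrow> f x) F"
proof (rule tendstoI)
  fix e :: real assume "e > 0"
  from econtD[OF assms(1-3) this] obtain d where
    "d > 0" "\<And>y. y \<in> cube n x d \<Longrightarrow> \<bar>f y - f x\<bar> < e" by metis
  with tendsto_cube[OF assms(4,5) \<open>d > 0\<close>]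
  show "eventually (\<lambda>t. dist (f (y t)) (f x) < e) F"
    by (auto simp: dist_real_def elim: eventually_mono)
qed

lemma upd_Euclid: "x \<in> topspace (Euclidean_space n) \<Longrightarrow> i < n \<Longrightarrow> x(i := t) \<in> topspace (Euclidean_space n)"
  by (simp add: Euclid_iff)

lemma eventually_upd:
  assumes "eopen n U" "x \<in> U" "i < n"
  shows "eventually (\<lambda>t. x(i := t) \<in> U) (nhds (x i))"
proof (rule tendsto_eopen[OF assms(1,2)])
  show "((\<lambda>t. (x(i := t)) j) \<longlongrightarrow> x j) (nhds (x i))" for j
    by (cases "j = i") (auto simp: filterlim_ident)
  show "\<forall>\<^sub>F t in nhds (x i). x(i := t) \<in> topspace (Euclidean_space n)"
    using upd_Euclid[OF eopen_subset[OF assms(1,2)] assms(3)] by simp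
qed

section \<open>Partial derivatives and the classes C^k\<close>

definition pd :: "nat \<Rightarrow> ((nat \<Rightarrow> real) \<Rightarrow> real) \<Rightarrow> (nat \<Rightarrow> real) \<Rightarrow> real" where
  "pd i f x = deriv (\<lambda>t. f (x(i := t))) (x i)"

abbreviation has_pd :: "nat \<Rightarrow> ((nat \<Rightarrow> real) \<Rightarrow> real) \<Rightarrow> real \<Rightarrow> (nat \<Rightarrow> real) \<Rightarrow> bool" where
  "has_pd i f d x \<equiv> ((\<lambda>t. f (x(i := t))) has_real_derivative d) (at (x i))"

lemma pd_eq: "has_pd i f d x \<Longrightarrow> pd i f x = d"
  unfolding pd_def by (rule DERIV_imp_deriv)

text \<open>\<open>U\<close> is open, so the coordinate line through \<open>x\<close> stays in
  \<open>U\<close> near \<open>x\<close>; values outside \<open>U\<close> cannot influence the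
  derivative.\<close>

lemma has_pd_cong:
  assumes "eopen n U" "x \<in> U" "i < n" "\<And>y. y \<in> U \<Longrightarrow> f y = g y" "has_pd i f d x"
  shows "has_pd i g d x"
proof -
  have "eventually (\<lambda>t. f (x(i := t)) = g (x(i := t))) (nhds (x i))"
    using eventually_upd[OF assms(1-3)] by eventually_elim (use assms(4) in auto)
  then have "has_pd i f d x = has_pd i g d x" by (intro DERIV_cong_ev) auto
  then show ?thesis using assms(5) by simp
qed

lemma C_diff_econt: "C_diff n k U f \<Longrightarrow> econt n U f"
  by (cases k) auto

lemma C_diff_cong:
  assumes "eopen n U" "\<And>x. x \<in> U \<Longrightarrow> f x = g x" "C_diff n k U f"
  shows "C_diff n k U g"
proof (cases k)
  case 0
  then show ?thesis using assms econt_cong[of U f g n] by simp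
next
  case (Suc k')
  have "econt n U g" using assms econt_cong[of U f g n] C_diff_econt by blast
  moreover have "\<exists>h. (\<forall>x\<in>U. has_pd i g (h x) x) \<and> C_diff n k' U h" if i: "i < n" for i
  proof -
    obtain h where h: "\<forall>x\<in>U. has_pd i f (h x) x" "C_diff n k' U h"
      using assms(3) i unfolding Suc C_diff.simps by blast
    have "\<forall>x\<in>U. has_pd i g (h x) x" using has_pd_cong[OF assms(1) _ i, of _ f g] assms(2) h(1) by simp
    then show ?thesis using h by blast
  qed
  ultimately show ?thesis using Suc by auto
qed

text \<open>Partial derivatives are unique, so every witness in \<open>C_diff\<close> agrees with
  \<open>pd i f\<close> on \<open>U\<close>. A named witness replaces the existential
  quantifier.\<close>

lemma C_diff_Suc_iff:
  assumes "eopen n U"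
  shows "C_diff n (Suc k) U f \<longleftrightarrow> econt n U f \<and>
    (\<forall>i<n. (\<forall>x\<in>U. has_pd i f (pd i f x) x) \<and> C_diff n k U (pd i f))"
proof -
  have "(\<exists>g. (\<forall>x\<in>U. has_pd i f (g x) x) \<and> C_diff n k U g) \<longleftrightarrow>
    (\<forall>x\<in>U. has_pd i f (pd i f x) x) \<and> C_diff n k U (pd i f)" for i
  proof
    assume "\<exists>g. (\<forall>x\<in>U. has_pd i f (g x) x) \<and> C_diff n k U g"
    then obtain g where g: "\<And>x. x \<in> U \<Longrightarrow> has_pd i f (g x) x" "C_diff n k U g" by blast
    have "g x = pd i f x" if "x \<in> U" for x
      using pd_eq[OF g(1)[OF that]] by (rule sym)
    then show "(\<forall>x\<in>U. has_pd i f (pd i f x) x) \<and> C_diff n k U (pd i f)"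
      using g C_diff_cong[OF assms, of g "pd i f"] by simp
  qed blast
  then show ?thesis by (simp only: C_diff.simps)
qed

lemma C_diff_SucI:
  assumes "eopen n U" "econt n U f" 
    "\<And>i x. i < n \<Longrightarrow> x \<in> U \<Longrightarrow> has_pd i f (g i x) x" "\<And>i. i < n \<Longrightarrow> C_diff n k U (g i)"
  shows "C_diff n (Suc k) U f"
  using assms by auto

lemma C_diff_SucD:
  assumes "eopen n U" "C_diff n (Suc k) U f"
  shows "econt n U f" "\<And>i x. i < n \<Longrightarrow> x \<in> U \<Longrightarrow> has_pd i f (pd i f x) x"
    "\<And>i. i < n \<Longrightarrow> C_diff n k U (pd i f)"
  using assms C_diff_Suc_iff by blast+

lemma C_diff_pred: "C_diff n (Suc k) U f \<Longrightarrow> C_diff n k U f"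
proof (induction k arbitrary: f)
  case (Suc k)
  have "\<exists>g. (\<forall>x\<in>U. has_pd i f (g x) x) \<and> C_diff n k U g" if "i < n" for i
  proof -
    obtain g where "\<forall>x\<in>U. has_pd i f (g x) x" "C_diff n (Suc k) U g"
      using Suc.prems \<open>i < n\<close> unfolding C_diff.simps by blast
    then show ?thesis using Suc.IH by blast
  qed
  then show ?case using C_diff_econt[OF Suc.prems] by simp
qed auto

lemma C_diff_mono:
  assumes "V \<subseteq> U" shows "C_diff n k U f \<Longrightarrow> C_diff n k V f"
proof (induction k arbitrary: f)
  case 0 then show ?case using assms econt_mono by auto
next
  case (Suc k)
  have "econt n V f" using C_diff_econt[OF Suc.prems] assms econt_mono by blast
  moreover have "\<exists>g. (\<forall>x\<in>V. has_pd i f (g x) x) \<and> C_diff n k V g" if "i < n" for i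
  proof -
    obtain g where "\<forall>x\<in>U. has_pd i f (g x) x" "C_diff n k U g"
      using Suc.prems \<open>i < n\<close> unfolding C_diff.simps by blast
    then show ?thesis using Suc.IH assms by blast
  qed
  ultimately show ?case by simp
qed

lemma C_diff_const: "C_diff n k U (\<lambda>_. c)"
  by (induction k arbitrary: c) (auto intro!: exI[of _ "\<lambda>_. 0"])

lemma C_diff_proj: "C_diff n k U (\<lambda>x. x j)"
proof (cases k)
  case 0
  then show ?thesis by (simp add: continuous_map_from_subtopology continuous_map_proj)
next
  case (Suc k')
  have "\<exists>g. (\<forall>x\<in>U. has_pd i (\<lambda>x. x j) (g x) x) \<and> C_diff n k' U g" for i
    by (rule exI[of _ "\<lambda>_. if i = j then 1 else 0"])
       (auto simp: C_diff_const intro: DERIV_ident)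
  then show ?thesis
    using Suc by (simp add: continuous_map_from_subtopology continuous_map_proj)
qed

lemma C_diff_add:
  assumes "eopen n U" shows "C_diff n k U f \<Longrightarrow> C_diff n k U g \<Longrightarrow> C_diff n k U (\<lambda>x. f x + g x)"
proof (induction k arbitrary: f g)
  case 0 then show ?case by (auto intro: continuous_map_add)
next
  case (Suc k)
  note f = C_diff_SucD[OF assms Suc.prems(1)] and g = C_diff_SucD[OF assms Suc.prems(2)]
  show ?case
  proof (rule C_diff_SucI[OF assms])
    show "econt n U (\<lambda>x. f x + g x)" using f(1) g(1) by (rule continuous_map_add)
    show "has_pd i (\<lambda>x. f x + g x) (pd i f x + pd i g x) x" if "i < n" "x \<in> U" for i x
      using DERIV_add[OF f(2)[OF that] g(2)[OF that]] .
    show "C_diff n k U (\<lambda>x. pd i f x + pd i g x)" if "i < n" for i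
      using Suc.IH f(3) g(3) that by blast
  qed
qed

lemma C_diff_mult:
  assumes "eopen n U" shows "C_diff n k U f \<Longrightarrow> C_diff n k U g \<Longrightarrow> C_diff n k U (\<lambda>x. f x * g x)"
proof (induction k arbitrary: f g)
  case 0 then show ?case by (auto intro: continuous_map_real_mult)
next
  case (Suc k)
  note f = C_diff_SucD[OF assms Suc.prems(1)] and g = C_diff_SucD[OF assms Suc.prems(2)]
  show ?case
  proof (rule C_diff_SucI[OF assms])
    show "econt n U (\<lambda>x. f x * g x)" using f(1) g(1) by (rule continuous_map_real_mult)
    show "has_pd i (\<lambda>x. f x * g x) (pd i f x * g x + pd i g x * f x) x" if "i < n" "x \<in> U" for i x
      by (rule DERIV_cong[OF DERIV_mult[OF f(2)[OF that] g(2)[OF that]]]) simp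
    show "C_diff n k U (\<lambda>x. pd i f x * g x + pd i g x * f x)" if "i < n" for i
      using f(3) g(3) Suc.IH C_diff_add[OF assms] C_diff_pred Suc.prems that by presburger
  qed
qed

lemma C_diff_sum:
  assumes "eopen n U" shows "finite I \<Longrightarrow> (\<And>i. i \<in> I \<Longrightarrow> C_diff n k U (f i)) \<Longrightarrow> C_diff n k U (\<lambda>x. \<Sum>i\<in>I. f i x)"
  by (induction I rule: finite_induct) (auto simp: C_diff_const C_diff_add[OF assms])

lemma C_diff_minus:
  assumes "eopen n U" "C_diff n k U f" shows "C_diff n k U (\<lambda>x. - f x)"
  using C_diff_mult[OF assms(1) C_diff_const[of n k U "-1"] assms(2)] by simp

lemma C_diff_diff:
  assumes "eopen n U" "C_diff n k U f" "C_diff n k U g" shows "C_diff n k U (\<lambda>x. f x - g x)"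
  using C_diff_add[OF assms(1,2) C_diff_minus[OF assms(1,3)]] by simp

text \<open>The derivative of the reciprocal contains the reciprocal itself, so class
  \<open>k\<close> of the latter is what yields class \<open>k + 1\<close>.\<close>

lemma C_diff_inverse:
  assumes "eopen n U" "\<And>x. x \<in> U \<Longrightarrow> f x \<noteq> 0"
  shows "C_diff n k U f \<Longrightarrow> C_diff n k U (\<lambda>x. inverse (f x))"
proof (induction k)
  case 0 then show ?case using assms by (auto intro: continuous_map_real_inverse)
next
  case (Suc k)
  note f = C_diff_SucD[OF assms(1) Suc.prems(1)]
  have inv: "C_diff n k U (\<lambda>x. inverse (f x))" using Suc C_diff_pred by blast
  show ?case
  proof (rule C_diff_SucI[OF assms(1)])
    show "econt n U (\<lambda>x. inverse (f x))"
      using f(1) assms(2) by (auto intro: continuous_map_real_inverse)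
    show "has_pd i (\<lambda>x. inverse (f x)) (- (inverse (f x) * pd i f x * inverse (f x))) x"
      if "i < n" "x \<in> U" for i x
      using DERIV_inverse'[OF f(2)[OF that]] assms(2)[OF that(2)] by (simp only: fun_upd_triv not_False_eq_True simp_thms)
    show "C_diff n k U (\<lambda>x. - (inverse (f x) * pd i f x * inverse (f x)))" if "i < n" for i
      using C_diff_minus C_diff_mult f(3) inv that assms(1) by presburger
  qed
qed

text \<open>The mean value theorem makes the difference quotients along one coordinate converge even
  when the base point moves with the filter.\<close>

lemma slope_tendsto:
  assumes U: "eopen n U" "x \<in> U" "j < n"
    and f: "\<And>y. y \<in> U \<Longrightarrow> has_pd j f (f' y) y" "econt n U f'"
    and y: "\<And>i. i < n \<Longrightarrow> i \<noteq> j \<Longrightarrow> ((\<lambda>t. y t i) \<longlongrightarrow> x i) F" 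
      "eventually (\<lambda>t. y t \<in> topspace (Euclidean_space n)) F"
    and s: "(s \<longlongrightarrow> x j) F" "(s' \<longlongrightarrow> x j) F"
  obtains q where "(q \<longlongrightarrow> f' x) F"
    "\<forall>\<^sub>F t in F. f ((y t)(j := s t)) - f ((y t)(j := s' t)) = q t * (s t - s' t)"
proof -
  \<comment> \<open>Where \<open>s t\<close> and \<open>s' t\<close> coincide there is no quotient;
    the default \<open>f' x\<close> keeps both the product identity and the limit valid
    there.\<close>
  define q where "q = (\<lambda>t. if s t = s' t then f' x else
    (f ((y t)(j := s t)) - f ((y t)(j := s' t))) / (s t - s' t))"
  have mvt: "\<exists>c. \<bar>c - x j\<bar> < d \<and> f (z(j := b)) - f (z(j := a)) = f' (z(j := c)) * (b - a)"
    if d: "\<And>c. \<bar>c - x j\<bar> < d \<Longrightarrow> z(j := c) \<in> U" and ab: "a < b" "\<bar>a - x j\<bar> < d" "\<bar>b - x j\<bar> < d"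
    for z a b d
  proof -
    have "((\<lambda>t. f (z(j := t))) has_real_derivative f' (z(j := c))) (at c)" if "a \<le> c" "c \<le> b" for c
      using f(1)[OF d[of c]] ab that by (auto simp: abs_less_iff)
    from MVT2[OF ab(1) this] obtain c where "a < c" "c < b"
      "f (z(j := b)) - f (z(j := a)) = (b - a) * f' (z(j := c))" by metis
    then show ?thesis using ab by (intro exI[of _ c]) auto
  qed
  have ev: "eventually (\<lambda>t. f ((y t)(j := s t)) - f ((y t)(j := s' t)) = q t * (s t - s' t) \<and> \<bar>q t - f' x\<bar> < e) F"
    if e: "e > 0" for e
  proof -
    obtain d where d: "d > 0" "cube n x d \<subseteq> U" "\<And>y. y \<in> cube n x d \<Longrightarrow> \<bar>f' y - f' x\<bar> < e"
      using econtD[OF f(2) U(1,2) e] by metis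
    have "eventually (\<lambda>t. (y t)(j := x j) \<in> cube n x d) F"
    proof (rule tendsto_cube[OF _ _ d(1)])
      show "((\<lambda>t. ((y t)(j := x j)) i) \<longlongrightarrow> x i) F" if "i < n" for i
        using y(1) that by (cases "i = j") auto
      show "\<forall>\<^sub>F t in F. (y t)(j := x j) \<in> topspace (Euclidean_space n)"
        using y(2) by eventually_elim (use U(3) upd_Euclid in auto)
    qed
    moreover have "eventually (\<lambda>t. \<bar>s t - x j\<bar> < d) F" "eventually (\<lambda>t. \<bar>s' t - x j\<bar> < d) F"
      using s d(1) by (auto dest!: tendstoD simp: dist_real_def)
    ultimately show ?thesis
    proof eventually_elim
      case (elim t)
      have z: "(y t)(j := c) \<in> cube n x d" if "\<bar>c - x j\<bar> < d" for c
        using elim that U(3) by (auto simp: cube_def Euclid_iff)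
      have z': "(y t)(j := c) \<in> U" if "\<bar>c - x j\<bar> < d" for c using z[OF that] d(2) by blast
      consider "s t = s' t" | "s t < s' t" | "s' t < s t" by linarith
      then show ?case
      proof cases
        case 1 then show ?thesis using e by (simp add: q_def)
      next
        case 2
        from mvt[OF z' 2 elim(2,3)] obtain c where c: "\<bar>c - x j\<bar> < d"
          "f ((y t)(j := s' t)) - f ((y t)(j := s t)) = f' ((y t)(j := c)) * (s' t - s t)" by blast
        then have "q t = f' ((y t)(j := c))" using 2 by (simp add: q_def field_simps)
        then show ?thesis using c d(3)[OF z] by (simp add: algebra_simps)
      next
        case 3
        from mvt[OF z' 3 elim(3,2)] obtain c where c: "\<bar>c - x j\<bar> < d"
          "f ((y t)(j := s t)) - f ((y t)(j := s' t)) = f' ((y t)(j := c)) * (s t - s' t)" by blast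
        then have "q t = f' ((y t)(j := c))" using 3 by (simp add: q_def field_simps)
        then show ?thesis using c d(3)[OF z] by simp
      qed
    qed
  qed
  have "(q \<longlongrightarrow> f' x) F"
  proof (rule tendstoI)
    fix e :: real assume "e > 0"
    from ev[OF this] show "\<forall>\<^sub>F t in F. dist (q t) (f' x) < e"
      by (auto simp: dist_real_def elim: eventually_mono)
  qed
  moreover have "\<forall>\<^sub>F t in F. f ((y t)(j := s t)) - f ((y t)(j := s' t)) = q t * (s t - s' t)"
    using ev[of 1] by (auto elim: eventually_mono)
  ultimately show ?thesis using that by blast
qed

text \<open>The increment of \<open>f\<close> along the curve telescopes through mixed points whose
  first \<open>j\<close> coordinates are taken at time \<open>s\<close> and the others at time
  \<open>t\<close>. Consecutive ones differ in a single coordinate while the base point moves with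
  \<open>s\<close>, which is the situation of \<open>slope_tendsto\<close>.\<close>

lemma chain_rule_curve:
  fixes \<gamma> :: "real \<Rightarrow> nat \<Rightarrow> real"
  assumes U: "eopen n U" "\<gamma> t \<in> U"
    and f: "\<And>i y. i < n \<Longrightarrow> y \<in> U \<Longrightarrow> has_pd i f (f' i y) y" "\<And>i. i < n \<Longrightarrow> econt n U (f' i)"
    and g: "\<And>i. i < n \<Longrightarrow> ((\<lambda>s. \<gamma> s i) has_real_derivative g' i) (at t)"
      "eventually (\<lambda>s. \<gamma> s \<in> topspace (Euclidean_space n)) (nhds t)"
  shows "((\<lambda>s. f (\<gamma> s)) has_real_derivative (\<Sum>i<n. f' i (\<gamma> t) * g' i)) (at t)"
proof -
  define mix where "mix = (\<lambda>j s i. if i < j then \<gamma> s i else \<gamma> t i)"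
  have \<gamma>t: "\<gamma> t \<in> topspace (Euclidean_space n)" using U eopen_subset by blast
  have lim: "((\<lambda>s. \<gamma> s i) \<longlongrightarrow> \<gamma> t i) (at t)" if "i < n" for i
    using DERIV_isCont[OF g(1)[OF that]] by (simp add: isCont_def)
  have gev: "eventually (\<lambda>s. \<gamma> s \<in> topspace (Euclidean_space n)) (at t)"
    using g(2) by (simp add: eventually_at_filter eventually_mono)
  have "((\<lambda>s. (f (mix j s) - f (\<gamma> t)) / (s - t)) \<longlongrightarrow> (\<Sum>i<j. f' i (\<gamma> t) * g' i)) (at t)" if "j \<le> n" for j
    using that
  proof (induction j)
    case 0
    show ?case by (simp add: mix_def)
  next
    case (Suc j)
    then have j: "j < n" by simp
    have mlim: "((\<lambda>s. mix j s i) \<longlongrightarrow> \<gamma> t i) (at t)" if "i < n" for i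
      unfolding mix_def using lim[OF that] by (cases "i < j") simp_all
    have mev: "eventually (\<lambda>s. mix j s \<in> topspace (Euclidean_space n)) (at t)"
      using gev by eventually_elim (use \<gamma>t in \<open>simp add: mix_def Euclid_iff\<close>)
    obtain q where q: "(q \<longlongrightarrow> f' j (\<gamma> t)) (at t)"
      "\<forall>\<^sub>F s in at t. f ((mix j s)(j := \<gamma> s j)) - f ((mix j s)(j := \<gamma> t j)) = q s * (\<gamma> s j - \<gamma> t j)"
    proof (rule slope_tendsto[where x = "\<gamma> t" and y = "mix j" and s = "\<lambda>s. \<gamma> s j" and
          s' = "\<lambda>s. \<gamma> t j" and f = f and f' = "f' j" and F = "at t" and n = n and j = j and U = U])
      show "eopen n U" "\<gamma> t \<in> U" "j < n" by fact+
      show "has_pd j f (f' j y) y" if "y \<in> U" for y using f(1)[OF j that] .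
      show "econt n U (f' j)" using f(2)[OF j] .
      show "((\<lambda>s. mix j s i) \<longlongrightarrow> \<gamma> t i) (at t)" if "i < n" for i using mlim[OF that] .
      show "eventually (\<lambda>s. mix j s \<in> topspace (Euclidean_space n)) (at t)" by fact
      show "((\<lambda>s. \<gamma> s j) \<longlongrightarrow> \<gamma> t j) (at t)" using lim[OF j] .
      show "((\<lambda>s. \<gamma> t j) \<longlongrightarrow> \<gamma> t j) (at t)" by (rule tendsto_const)
    qed
    have upd: "(mix j s)(j := \<gamma> s j) = mix (Suc j) s" "(mix j s)(j := \<gamma> t j) = mix j s" for s
      by (auto simp: mix_def fun_eq_iff less_Suc_eq)
    have "((\<lambda>s. (\<gamma> s j - \<gamma> t j) / (s - t)) \<longlongrightarrow> g' j) (at t)"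
      using g(1)[OF j] by (simp add: has_field_derivative_iff)
    then have "((\<lambda>s. (f (mix j s) - f (\<gamma> t)) / (s - t) + q s * ((\<gamma> s j - \<gamma> t j) / (s - t)))
      \<longlongrightarrow> (\<Sum>i<j. f' i (\<gamma> t) * g' i) + f' j (\<gamma> t) * g' j) (at t)"
      using Suc q(1) by (intro tendsto_intros) auto
    moreover have "\<forall>\<^sub>F s in at t. (f (mix j s) - f (\<gamma> t)) / (s - t) + q s * ((\<gamma> s j - \<gamma> t j) / (s - t))
        = (f (mix (Suc j) s) - f (\<gamma> t)) / (s - t)"
      using q(2) unfolding upd
    proof eventually_elim
      case (elim s)
      then have *: "f (mix (Suc j) s) = f (mix j s) + q s * (\<gamma> s j - \<gamma> t j)" by linarith
      show ?case unfolding * by (simp add: diff_divide_distrib add_divide_distrib right_diff_distrib)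
    qed
    ultimately show ?case unfolding sum.lessThan_Suc by (rule Lim_transform_eventually)
  qed
  from this[OF order_refl]
  have lim2: "((\<lambda>s. (f (mix n s) - f (\<gamma> t)) / (s - t)) \<longlongrightarrow> (\<Sum>i<n. f' i (\<gamma> t) * g' i)) (at t)" .
  have ev2: "\<forall>\<^sub>F s in at t. (f (mix n s) - f (\<gamma> t)) / (s - t) = (f (\<gamma> s) - f (\<gamma> t)) / (s - t)"
    using gev
  proof eventually_elim
    case (elim s)
    then have "mix n s = \<gamma> s" using \<gamma>t by (simp add: mix_def Euclid_iff fun_eq_iff)
    then show ?case by simp
  qed
  show ?thesis unfolding has_field_derivative_iff using Lim_transform_eventually[OF lim2 ev2] .
qed

text \<open>By the chain rule the partial derivatives are sums of products of \<open>pd j f\<close>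
  after \<open>F\<close> with partial derivatives of components of \<open>F\<close>. The induction
  varies \<open>f\<close>, so that it applies to \<open>pd j f\<close> with the components of
  \<open>F\<close> lowered by one class.\<close>

lemma C_diff_compose:
  assumes U: "eopen n U" and V: "eopen m V" and F: "F \<in> V \<rightarrow> U"
  shows "C_diff n k U f \<Longrightarrow> (\<And>j. j < n \<Longrightarrow> C_diff m k V (\<lambda>x. F x j)) \<Longrightarrow> C_diff m k V (\<lambda>x. f (F x))"
proof (induction k arbitrary: f)
  case 0
  \<comment> \<open>Truncating at index \<open>n\<close> gives the form for which continuity into
    Euclidean space is a componentwise condition; on \<open>V\<close> nothing changes, because
    \<open>F\<close> takes values in \<open>U\<close>.\<close>
  have "continuous_map (subtopology (Euclidean_space m) V) (Euclidean_space n)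
          (\<lambda>x i. if i < n then F x i else 0)"
    using 0 by (simp add: continuous_map_componentwise_Euclidean_space)
  moreover have "(\<lambda>i. if i < n then F x i else 0) = F x" if "x \<in> V" for x
    using F that U eopen_subset[of n U] by (auto simp: Euclid_iff fun_eq_iff Pi_iff)
  ultimately have "continuous_map (subtopology (Euclidean_space m) V) (Euclidean_space n) F"
    by (elim continuous_map_eq) auto
  then have "continuous_map (subtopology (Euclidean_space m) V) (subtopology (Euclidean_space n) U) F"
    using F by (auto simp: continuous_map_in_subtopology)
  then have "continuous_map (subtopology (Euclidean_space m) V) euclideanreal (f \<circ> F)"
    using 0 by (auto intro: continuous_map_compose)
  then show ?case by (simp add: o_def)
next
  case (Suc k)
  note f = C_diff_SucD[OF U Suc.prems(1)]
  note g = C_diff_SucD[OF V Suc.prems(2)]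
  have "C_diff m k V (\<lambda>x. f (F x))"
    using Suc.IH[OF C_diff_pred[OF Suc.prems(1)] C_diff_pred[OF Suc.prems(2)]] .
  then have cont: "econt m V (\<lambda>x. f (F x))" using C_diff_econt by blast
  show ?case
  proof (rule C_diff_SucI[OF V cont])
    fix i x assume i: "i < m" and x: "x \<in> V"
    have "((\<lambda>s. f (F (x(i := s)))) has_real_derivative
       (\<Sum>j<n. pd j f (F (x(i := x i))) * pd i (\<lambda>x. F x j) x)) (at (x i))"
    proof (rule chain_rule_curve[OF U])
      show "F (x(i := x i)) \<in> U" using F x by auto
      show "((\<lambda>s. F (x(i := s)) j) has_real_derivative pd i (\<lambda>x. F x j) x) (at (x i))" if "j < n" for j
        using g(2)[OF that i x] .
      show "\<forall>\<^sub>F s in nhds (x i). F (x(i := s)) \<in> topspace (Euclidean_space n)"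
        using eventually_upd[OF V x i]
        by eventually_elim (use F eopen_subset[OF U] in blast)
      show "econt n U (pd j f)" if "j < n" for j using f(3)[OF that] C_diff_econt by blast
    qed (use f in auto)
    then show "has_pd i (\<lambda>x. f (F x)) (\<Sum>j<n. pd j f (F x) * pd i (\<lambda>x. F x j) x) x" by simp
  next
    fix i assume i: "i < m"
    show "C_diff m k V (\<lambda>x. \<Sum>j<n. pd j f (F x) * pd i (\<lambda>x. F x j) x)"
    proof (intro C_diff_sum[OF V] C_diff_mult[OF V])
      fix j assume "j \<in> {..<n}"
      then have j: "j < n" by simp
      show "C_diff m k V (\<lambda>x. pd j f (F x))"
        using Suc.IH[OF f(3)[OF j] C_diff_pred[OF Suc.prems(2)]] .
      show "C_diff m k V (pd i (\<lambda>x. F x j))" using g(3)[OF j i] .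
    qed auto
  qed
qed

section \<open>Smooth maps between Euclidean domains\<close>

lemma smooth_euclidD:
  assumes "smooth_euclid n U m F"
  shows "eopen n U" "x \<in> U \<Longrightarrow> F x \<in> topspace (Euclidean_space m)" "C_diff n k U (\<lambda>x. F x j)"
proof -
  show U: "eopen n U" and into: "x \<in> U \<Longrightarrow> F x \<in> topspace (Euclidean_space m)" for x
    using assms by (auto simp: smooth_euclid_def)
  show "C_diff n k U (\<lambda>x. F x j)"
  proof (cases "j < m")
    case True then show ?thesis using assms by (simp add: smooth_euclid_def)
  next
    \<comment> \<open>Coordinates from \<open>m\<close> on vanish on \<open>U\<close>, so the
      conclusion holds for every index and later uses carry no bound on \<open>j\<close>.\<close>
    case False
    then have "F x j = 0" if "x \<in> U" for x using into[OF that] by (simp add: Euclid_iff)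
    then show ?thesis using C_diff_cong[OF U, of "\<lambda>_. 0" "\<lambda>x. F x j" k] C_diff_const by simp
  qed
qed

lemma smooth_euclidI:
  assumes "eopen n U" "\<And>x. x \<in> U \<Longrightarrow> F x \<in> topspace (Euclidean_space m)"
    "\<And>j k. j < m \<Longrightarrow> C_diff n k U (\<lambda>x. F x j)"
  shows "smooth_euclid n U m F"
  using assms by (auto simp: smooth_euclid_def)

lemma smooth_euclid_cong:
  assumes "smooth_euclid n U m F" "\<And>x. x \<in> U \<Longrightarrow> F x = G x"
  shows "smooth_euclid n U m G"
proof (rule smooth_euclidI)
  show "eopen n U" using smooth_euclidD(1)[OF assms(1)] .
  show "G x \<in> topspace (Euclidean_space m)" if "x \<in> U" for x
    using smooth_euclidD(2)[OF assms(1) that] assms(2)[OF that] by simp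
  show "C_diff n k U (\<lambda>x. G x j)" for j k
    by (rule C_diff_cong[OF smooth_euclidD(1)[OF assms(1)] _ smooth_euclidD(3)[OF assms(1)]])
      (simp add: assms(2))
qed

lemma smooth_euclid_compose:
  assumes "smooth_euclid n U m F" "smooth_euclid p V n G" "\<And>x. x \<in> V \<Longrightarrow> G x \<in> U"
  shows "smooth_euclid p V m (\<lambda>x. F (G x))"
proof (rule smooth_euclidI)
  show "eopen p V" using smooth_euclidD(1)[OF assms(2)] .
  show "F (G x) \<in> topspace (Euclidean_space m)" if "x \<in> V" for x
    using smooth_euclidD(2)[OF assms(1)] assms(3)[OF that] by simp
  show "C_diff p k V (\<lambda>x. F (G x) j)" for j k
    by (rule C_diff_compose[OF smooth_euclidD(1)[OF assms(1)] smooth_euclidD(1)[OF assms(2)] _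
          smooth_euclidD(3)[OF assms(1)] smooth_euclidD(3)[OF assms(2)]]) (use assms(3) in auto)
qed

lemma smooth_euclid_mono:
  assumes "smooth_euclid n U m F" "eopen n V" "V \<subseteq> U"
  shows "smooth_euclid n V m F"
  using assms C_diff_mono[OF assms(3)] by (auto simp: smooth_euclid_def)

lemma smooth_euclid_ident: "eopen n U \<Longrightarrow> smooth_euclid n U n (\<lambda>x. x)"
  using openin_subset by (fastforce intro!: smooth_euclidI C_diff_proj)

lemma smooth_euclid_const:
  "eopen n U \<Longrightarrow> c \<in> topspace (Euclidean_space m) \<Longrightarrow> smooth_euclid n U m (\<lambda>_. c)"
  by (auto intro!: smooth_euclidI C_diff_const)

lemma eopen_preimage:
  assumes "smooth_euclid n U m F" "eopen m Z"
  shows "eopen n {x \<in> U. F x \<in> Z}"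
  unfolding eopen_iff_cube
proof (intro conjI ballI)
  note U = smooth_euclidD(1)[OF assms(1)]
  show "{x \<in> U. F x \<in> Z} \<subseteq> topspace (Euclidean_space n)"
    using eopen_subset[OF U] by blast
  fix x assume x: "x \<in> {x \<in> U. F x \<in> Z}"
  then obtain e where e: "e > 0" "cube m (F x) e \<subseteq> Z"
    using eopen_contains_cube[OF assms(2)] by blast
  obtain e0 where e0: "e0 > 0" "cube n x e0 \<subseteq> U" using eopen_contains_cube[OF U] x by blast
  have "\<exists>d>0. \<forall>y\<in>cube n x d. \<bar>F y j - F x j\<bar> < e" for j
  proof (rule econtD[where f = "\<lambda>x. F x j" and n = n and U = U and x = x and e = e])
    show "econt n U (\<lambda>x. F x j)" using C_diff_econt[OF smooth_euclidD(3)[OF assms(1)]] .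
  qed (use U x e in auto)
  then obtain d where d: "\<And>j. d j > 0" "\<And>j y. y \<in> cube n x (d j) \<Longrightarrow> \<bar>F y j - F x j\<bar> < e"
    by metis
  define D where "D = Min (insert e0 (d ` {..<m}))"
  have D: "D > 0" "D \<le> e0" "\<And>j. j < m \<Longrightarrow> D \<le> d j" using d e0 by (auto simp: D_def)
  have "cube n x D \<subseteq> {x \<in> U. F x \<in> Z}"
  proof
    fix y assume y: "y \<in> cube n x D"
    have yU: "y \<in> U" using y e0 cube_mono[OF D(2), of n x] by blast
    have "\<bar>F y j - F x j\<bar> < e" if "j < m" for j
      using y cube_mono[OF D(3)[OF that], of n x] d(2)[of y j] by blast
    then have "F y \<in> cube m (F x) e"
      using smooth_euclidD(2)[OF assms(1) yU] by (simp add: cube_def)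
    then show "y \<in> {x \<in> U. F x \<in> Z}" using yU e by blast
  qed
  then show "\<exists>e>0. cube n x e \<subseteq> {x \<in> U. F x \<in> Z}" using D by blast
qed

lemma upd_smooth:
  assumes "eopen n U" "i < n" "\<And>k. C_diff n k U s"
  shows "smooth_euclid n U n (\<lambda>x. x(i := s x))"
proof (rule smooth_euclidI[OF assms(1)])
  show "x(i := s x) \<in> topspace (Euclidean_space n)" if "x \<in> U" for x
    using upd_Euclid[OF eopen_subset[OF assms(1) that] assms(2)] .
  show "C_diff n k U (\<lambda>x. (x(i := s x)) j)" for j k
    by (cases "j = i") (simp_all add: assms(3) C_diff_proj)
qed

text \<open>\<open>pd i f\<close> is one function, whatever the neighbourhood, so the local data
  need no gluing and the induction applies to it directly. The result gives the locality axiom for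
  the plots of a Euclidean domain.\<close>

lemma C_diff_local:
  assumes U: "eopen n U"
  shows "(\<And>x. x \<in> U \<Longrightarrow> \<exists>V. eopen n V \<and> x \<in> V \<and> V \<subseteq> U \<and> C_diff n k V f) \<Longrightarrow> C_diff n k U f"
proof (induction k arbitrary: f)
  case 0
  have "econt n U f"
  proof (rule econtI[OF U])
    fix x and e :: real assume "x \<in> U" "e > 0"
    obtain V where V: "eopen n V" "x \<in> V" "econt n V f"
      using 0[OF \<open>x \<in> U\<close>] unfolding C_diff.simps by blast
    obtain d where "d > 0" "\<And>y. y \<in> cube n x d \<Longrightarrow> \<bar>f y - f x\<bar> < e"
      by (rule econtD[OF V(3,1,2) \<open>e > 0\<close>]) blast
    then show "\<exists>d>0. \<forall>y\<in>U \<inter> cube n x d. \<bar>f y - f x\<bar> < e" by blast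
  qed
  then show ?case by simp
next
  case (Suc k)
  have V: "\<exists>V. eopen n V \<and> x \<in> V \<and> V \<subseteq> U \<and> econt n V f \<and>
      (\<forall>i<n. has_pd i f (pd i f x) x \<and> C_diff n k V (pd i f))" if x: "x \<in> U" for x
  proof -
    obtain V where V: "eopen n V" "x \<in> V" "V \<subseteq> U" "C_diff n (Suc k) V f" using Suc.prems[OF x] by blast
    note D = C_diff_SucD[OF V(1,4)]
    show ?thesis
      by (rule exI[of _ V]) (simp add: V(1-3) D(1) D(2)[OF _ V(2)] D(3))
  qed
  have "C_diff n k U f"
  proof (rule Suc.IH)
    fix x assume "x \<in> U"
    then obtain V where "eopen n V" "x \<in> V" "V \<subseteq> U" "C_diff n (Suc k) V f" using Suc.prems by blast
    then show "\<exists>V. eopen n V \<and> x \<in> V \<and> V \<subseteq> U \<and> C_diff n k V f"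
      using C_diff_pred by (intro exI[of _ V]) simp
  qed
  then have "econt n U f" by (rule C_diff_econt)
  then show ?case
  proof (rule C_diff_SucI[OF U])
    show "has_pd i f (pd i f x) x" if "i < n" "x \<in> U" for i x
      using V[OF that(2)] that(1) by blast
    show "C_diff n k U (pd i f)" if i: "i < n" for i
    proof (rule Suc.IH)
      fix x assume "x \<in> U"
      then show "\<exists>V. eopen n V \<and> x \<in> V \<and> V \<subseteq> U \<and> C_diff n k V (pd i f)"
        using V i by blast
    qed
  qed
qed

section \<open>Local diffeomorphisms\<close>

text \<open>One-dimensional implicit function theorem; the remaining coordinates are parameters.\<close>

lemma replace_coordinate_local_inverse:
  assumes A: "eopen d A" "a \<in> A" and i: "i < d" and h: "\<And>k. C_diff d k A h"
    and pos: "pd i h a > 0"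
  obtains A' B s where "eopen d A'" "a \<in> A'" "A' \<subseteq> A" "eopen d B" "\<And>k. C_diff d k B s"
    "\<And>x. x \<in> A' \<Longrightarrow> x(i := h x) \<in> B" "\<And>x. x \<in> A' \<Longrightarrow> s (x(i := h x)) = x i"
    "\<And>y. y \<in> B \<Longrightarrow> y(i := s y) \<in> A'" "\<And>y. y \<in> B \<Longrightarrow> h (y(i := s y)) = y i"
proof -
  note hpd = C_diff_SucD(2)[OF A(1) h] and pdC = C_diff_SucD(3)[OF A(1) h]
  \<comment> \<open>The tolerance \<open>pd i h a\<close> keeps this partial derivative positive on
    the whole cube, so \<open>h\<close> is strictly increasing along direction \<open>i\<close>
    there.\<close>
  obtain \<delta> where \<delta>: "\<delta> > 0" "cube d a \<delta> \<subseteq> A" "\<And>y. y \<in> cube d a \<delta> \<Longrightarrow> \<bar>pd i h y - pd i h a\<bar> < pd i h a"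
    using econtD[OF C_diff_econt[OF pdC[OF i]] A pos] by metis
  define A' where "A' = cube d a \<delta>"
  have A': "eopen d A'" "a \<in> A'" "A' \<subseteq> A"
    unfolding A'_def using eopen_cube cube_center[OF eopen_subset[OF A]] \<delta> by auto
  have ppos: "pd i h y > 0" if "y \<in> A'" for y using \<delta>(3)[of y] that unfolding A'_def by linarith
  define I where "I = {t. \<bar>t - a i\<bar> < \<delta>}"
  have I_between: "c \<in> I" if "s \<in> I" "t \<in> I" "s \<le> c" "c \<le> t" for s t c
    using that by (auto simp: I_def abs_less_iff)
  have upd_A': "x(i := t) \<in> A' \<longleftrightarrow> t \<in> I" if "x(i := t0) \<in> A'" for x t t0
    using that i by (auto simp: A'_def cube_def I_def Euclid_iff split: if_splits)
  have mono: "h (x(i := s)) < h (x(i := t))" if x: "x(i := t0) \<in> A'" and st: "s \<in> I" "t \<in> I" "s < t"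
    for x s t t0
  proof (rule DERIV_pos_imp_increasing[OF st(3)])
    fix c assume "s \<le> c" "c \<le> t"
    then have "x(i := c) \<in> A'" using upd_A'[OF x] I_between st by blast
    then show "\<exists>y. DERIV (\<lambda>t. h (x(i := t))) c :> y \<and> y > 0"
      using hpd[OF i, of "x(i := c)"] ppos A'(3) by (auto intro!: exI[of _ "pd i h (x(i := c))"])
  qed
  have hc: "isCont (\<lambda>t. h (x(i := t))) c" if "x(i := c) \<in> A'" for x c
    using hpd[OF i, of "x(i := c)"] that A'(3) DERIV_isCont by fastforce
  \<comment> \<open>Entry \<open>i\<close> of \<open>y\<close> is a target value for
    \<open>h\<close>, the other entries are parameters, and \<open>t\<close> is the coordinate
    sought. Monotonicity makes \<open>t\<close> unique, and \<open>B\<close> collects the solvable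
    targets.\<close>
  define sol where "sol = (\<lambda>y t. y(i := t) \<in> A' \<and> h (y(i := t)) = y i)"
  define s where "s = (\<lambda>y. SOME t. sol y t)"
  define B where "B = {y \<in> topspace (Euclidean_space d). \<exists>t. sol y t}"
  have uniq: "t = t'" if "sol y t" "sol y t'" for y t t'
    using mono[of y t t t'] mono[of y t t' t] that upd_A' unfolding sol_def by (metis less_irrefl linorder_neqE)
  have s_sol: "sol y (s y)" if "y \<in> B" for y
    using that unfolding B_def s_def by (auto intro: someI)
  have s_eq: "s y = t" if "sol y t" for y t
    using that uniq unfolding s_def by (metis someI)
  have B_E: "y \<in> topspace (Euclidean_space d)" if "y \<in> B" for y using that by (simp add: B_def)
  \<comment> \<open>One bracketing argument yields both openness of \<open>B\<close> and continuity
    of \<open>s\<close>: for nearby \<open>y'\<close> the values of \<open>h\<close> at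
    \<open>t - e'\<close> and \<open>t + e'\<close> still enclose the target, and the intermediate
    value theorem puts a solution between them.\<close>
  have near: "\<exists>\<eta>>0. \<forall>y'\<in>cube d y \<eta>. y' \<in> B \<and> \<bar>s y' - s y\<bar> < e" if y: "y \<in> B" and e: "e > 0" for y e
  proof -
    define t where "t = s y"
    have t: "y(i := t) \<in> A'" "h (y(i := t)) = y i" using s_sol[OF y] by (auto simp: sol_def t_def)
    then have tI: "t \<in> I" using upd_A' by blast
    \<comment> \<open>Half the distance from \<open>t\<close> to the edge of \<open>I\<close> keeps
      \<open>t - e'\<close> and \<open>t + e'\<close> inside; half of \<open>e\<close> makes the
      final estimate strict.\<close>
    define e' where "e' = min (e/2) ((\<delta> - \<bar>t - a i\<bar>)/2)"
    have e': "e' > 0" "e' < e" using e tI by (auto simp: e'_def I_def)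
    have e'': "e' \<le> (\<delta> - \<bar>t - a i\<bar>)/2" unfolding e'_def by (rule min.cobounded2)
    have "t - e' \<in> I" "t + e' \<in> I" using tI e'' e' unfolding I_def by auto
    note tt = this
    have lt: "h (y(i := t - e')) < y i" "y i < h (y(i := t + e'))"
      using mono[OF t(1) tt(1) tI] mono[OF t(1) tI tt(2)] e' t by auto
    \<comment> \<open>Half the smaller gap: the values of \<open>h\<close> at the bracket ends and
      the target may each move by less than \<open>g\<close> without breaking the bracket.\<close>
    define g where "g = min (y i - h (y(i := t - e'))) (h (y(i := t + e')) - y i) / 2"
    have g: "g > 0" using lt by (simp add: g_def)
    have A1: "y(i := t - e') \<in> A'" "y(i := t + e') \<in> A'" using upd_A'[OF t(1)] tt by auto
    have hE: "econt d A' h" using econt_mono[OF C_diff_econt[OF h] A'(3)] .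
    obtain \<eta>1 where \<eta>1: "\<eta>1 > 0" "\<And>z. z \<in> cube d (y(i := t - e')) \<eta>1 \<Longrightarrow> \<bar>h z - h (y(i := t - e'))\<bar> < g"
      using econtD[OF hE A'(1) A1(1) g] by metis
    obtain \<eta>2 where \<eta>2: "\<eta>2 > 0" "cube d (y(i := t + e')) \<eta>2 \<subseteq> A'" "\<And>z. z \<in> cube d (y(i := t + e')) \<eta>2 \<Longrightarrow> \<bar>h z - h (y(i := t + e'))\<bar> < g"
      using econtD[OF hE A'(1) A1(2) g] by metis
    define \<eta> where "\<eta> = min g (min \<eta>1 \<eta>2)"
    have \<eta>: "\<eta> > 0" "\<eta> \<le> g" "\<eta> \<le> \<eta>1" "\<eta> \<le> \<eta>2" using g \<eta>1 \<eta>2 by (auto simp: \<eta>_def)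
    show ?thesis
    proof (intro exI[of _ \<eta>] conjI ballI)
      show "\<eta> > 0" by (rule \<eta>(1))
      fix y' assume y': "y' \<in> cube d y \<eta>"
      have "y'(i := c) \<in> cube d (y(i := c)) \<eta>" for c
        using y' i \<eta>(1) by (auto simp: cube_def Euclid_iff)
      then have c1: "y'(i := t - e') \<in> cube d (y(i := t - e')) \<eta>1" and c2: "y'(i := t + e') \<in> cube d (y(i := t + e')) \<eta>2"
        using cube_mono \<eta> by blast+
      have y'i: "\<bar>y' i - y i\<bar> < g" using y' i \<eta> by (force simp: cube_def)
      have g2: "2 * g \<le> y i - h (y(i := t - e'))" "2 * g \<le> h (y(i := t + e')) - y i"
        by (simp_all add: g_def)
      have b: "h (y'(i := t - e')) \<le> y' i" "y' i \<le> h (y'(i := t + e'))"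
        using \<eta>1(2)[OF c1] \<eta>2(3)[OF c2] y'i g2 by linarith+
      have y'A: "y'(i := t + e') \<in> A'" using c2 \<eta>2(2) by blast
      have "\<forall>c. t - e' \<le> c \<and> c \<le> t + e' \<longrightarrow> isCont (\<lambda>t. h (y'(i := t))) c"
        using hc upd_A'[OF y'A] I_between[OF tt] by blast
      then obtain \<tau> where \<tau>: "t - e' \<le> \<tau>" "\<tau> \<le> t + e'" "h (y'(i := \<tau>)) = y' i"
        using IVT[of "\<lambda>t. h (y'(i := t))" "t - e'" "y' i" "t + e'"] b e' by force
      have "sol y' \<tau>" unfolding sol_def using \<tau> upd_A'[OF y'A] I_between[OF tt] by blast
      then show "y' \<in> B" "\<bar>s y' - s y\<bar> < e"
        using s_eq[of y' \<tau>] y' \<tau> e' by (auto simp: B_def cube_def t_def[symmetric])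
    qed
  qed
  have B: "eopen d B"
    unfolding eopen_iff_cube
  proof (intro conjI ballI)
    show "B \<subseteq> topspace (Euclidean_space d)" using B_E by blast
    show "\<exists>e>0. cube d x e \<subseteq> B" if "x \<in> B" for x using near[OF that zero_less_one] by blast
  qed
  have s_cont: "econt d B s"
    by (rule econtI[OF B]) (use near in blast)
  have s_in: "y(i := s y) \<in> A'" "h (y(i := s y)) = y i" if "y \<in> B" for y
    using s_sol[OF that] by (auto simp: sol_def)
  \<comment> \<open>Implicit differentiation of \<open>h (y(i := s y)) = y i\<close>: the target
    entry contributes 1 and a parameter entry contributes minus its partial derivative, both divided
    by the one in direction \<open>i\<close>.\<close>
  define D where "D = (\<lambda>j y. (if j = i then 1 else - pd j h (y(i := s y))) * inverse (pd i h (y(i := s y))))"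
  have deriv: "has_pd j s (D j y) y" if y: "y \<in> B" and j: "j < d" for j y
  proof -
    define x where "x = y(i := s y)"
    have x: "x \<in> A'" "h x = y i" using s_in[OF y] by (auto simp: x_def)
    define F where "F = at (y j)"
    have yB: "\<forall>\<^sub>F \<tau> in F. y(j := \<tau>) \<in> B"
      using eventually_upd[OF B y j] by (simp add: F_def eventually_at_filter eventually_mono)
    have id_lim: "((\<lambda>\<tau>. \<tau>) \<longlongrightarrow> y j) F" by (simp add: F_def)
    have upd_lim: "((\<lambda>\<tau>. (y(j := \<tau>)) l) \<longlongrightarrow> y l) F" for l
      using id_lim by (cases "l = j") simp_all
    have evE: "\<forall>\<^sub>F \<tau> in F. y(j := \<tau>) \<in> topspace (Euclidean_space d)"
      using yB by eventually_elim (rule B_E)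
    have slim: "((\<lambda>\<tau>. s (y(j := \<tau>))) \<longlongrightarrow> s y) F"
      by (rule tendsto_econt[OF s_cont B y]) (use upd_lim evE in auto)
    obtain q where q: "(q \<longlongrightarrow> pd i h x) F"
      "\<forall>\<^sub>F \<tau> in F. h ((y(j := \<tau>))(i := s (y(j := \<tau>)))) - h ((y(j := \<tau>))(i := s y)) = q \<tau> * (s (y(j := \<tau>)) - s y)"
    proof (rule slope_tendsto[where x = x and y = "\<lambda>\<tau>. y(j := \<tau>)" and s = "\<lambda>\<tau>. s (y(j := \<tau>))" and
          s' = "\<lambda>\<tau>. s y" and f = h and f' = "pd i h" and F = F and n = d and j = i and U = A])
      show "eopen d A" "x \<in> A" "i < d" using A x A' i by auto
      show "has_pd i h (pd i h y) y" if "y \<in> A" for y using hpd[OF i that] .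
      show "econt d A (pd i h)" using C_diff_econt[OF pdC[OF i]] .
      show "((\<lambda>\<tau>. (y(j := \<tau>)) l) \<longlongrightarrow> x l) F" if "l \<noteq> i" for l
        using upd_lim[of l] that by (simp add: x_def)
      show "((\<lambda>\<tau>. s (y(j := \<tau>))) \<longlongrightarrow> x i) F" "((\<lambda>\<tau>. s y) \<longlongrightarrow> x i) F"
        using slim by (simp_all add: x_def)
    qed (use evE in auto)
    \<comment> \<open>With \<open>s\<close> frozen at \<open>s y\<close>, \<open>R\<close> measures
      by how much the equation fails after entry \<open>j\<close> moves. The change of
      \<open>s\<close> has to make up for it, so \<open>R\<close> equals \<open>q\<close> times that
      change, and the limit of the quotient of \<open>R\<close> determines the derivative of
      \<open>s\<close>.\<close>
    define R where "R = (\<lambda>\<tau>. (y(j := \<tau>)) i - h ((y(j := \<tau>))(i := s y)))"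
    have R: "((\<lambda>\<tau>. R \<tau> / (\<tau> - y j)) \<longlongrightarrow> (if j = i then 1 else - pd j h x)) F"
    proof (cases "j = i")
      case True
      then have "R \<tau> = \<tau> - y j" for \<tau> using x by (simp add: R_def x_def)
      then have "\<forall>\<^sub>F \<tau> in F. 1 = R \<tau> / (\<tau> - y j)"
        by (auto simp: F_def eventually_at_filter)
      from Lim_transform_eventually[OF tendsto_const this] show ?thesis using True by simp
    next
      case False
      then have xj: "x j = y j" by (simp add: x_def)
      have Rx: "R \<tau> = - (h (x(j := \<tau>)) - h (x(j := x j)))" for \<tau>
      proof -
        have "(y(j := \<tau>))(i := s y) = x(j := \<tau>)" "x(j := x j) = x"
          using False by (auto simp: x_def)
        then show ?thesis using False x(2) by (simp add: R_def)
      qed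
      have "((\<lambda>\<tau>. (h (x(j := \<tau>)) - h (x(j := x j))) / (\<tau> - x j)) \<longlongrightarrow> pd j h x) (at (x j))"
        using hpd[OF j, of x] x A' unfolding has_field_derivative_iff by blast
      then have "((\<lambda>\<tau>. - ((h (x(j := \<tau>)) - h (x(j := x j))) / (\<tau> - x j))) \<longlongrightarrow> - pd j h x) F"
        unfolding F_def xj[symmetric] by (rule tendsto_minus)
      then show ?thesis unfolding Rx xj[symmetric] using False by (simp add: minus_divide_left)
    qed
    have "((\<lambda>\<tau>. R \<tau> / (\<tau> - y j) * inverse (q \<tau>)) \<longlongrightarrow> D j y) F"
      unfolding D_def x_def[symmetric]
      using ppos[OF x(1)] by (intro tendsto_mult R tendsto_inverse q(1)) auto
    moreover have "\<forall>\<^sub>F \<tau> in F. R \<tau> / (\<tau> - y j) * inverse (q \<tau>) = (s (y(j := \<tau>)) - s (y(j := y j))) / (\<tau> - y j)"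
    proof -
      have "\<forall>\<^sub>F \<tau> in F. q \<tau> > 0" using order_tendstoD(1)[OF q(1) ppos[OF x(1)]] .
      with q(2) yB show ?thesis
      proof eventually_elim
        case (elim \<tau>)
        have *: "R \<tau> = q \<tau> * (s (y(j := \<tau>)) - s y)"
          using elim(1) s_in(2)[OF elim(2)] by (simp add: R_def)
        show ?case unfolding * using elim(3) by simp
      qed
    qed
    ultimately show ?thesis
      unfolding has_field_derivative_iff F_def by (rule Lim_transform_eventually)
  qed
  \<comment> \<open>Bootstrapping: \<open>D\<close> is built from \<open>s\<close> and partial
    derivatives of \<open>h\<close>, so class \<open>k\<close> of \<open>s\<close> gives class
    \<open>k\<close> of its derivatives.\<close>
  have s_smooth: "C_diff d k B s" for k
  proof (induction k)
    case 0 show ?case using s_cont by simp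
  next
    case (Suc k)
    have comp: "C_diff d k B (\<lambda>y. pd j h (y(i := s y)))" if "j < d" for j
    proof (rule C_diff_compose[OF A(1) B _ pdC[OF that]])
      show "(\<lambda>y. y(i := s y)) \<in> B \<rightarrow> A" using s_in A' by auto
      show "C_diff d k B (\<lambda>y. (y(i := s y)) l)" for l
        using Suc by (cases "l = i") (simp_all add: C_diff_proj)
    qed
    show ?case
    proof (rule C_diff_SucI[OF B s_cont deriv])
      show "C_diff d k B (D j)" if "j < d" for j
        unfolding D_def
      proof (rule C_diff_mult[OF B])
        show "C_diff d k B (\<lambda>y. if j = i then 1 else - pd j h (y(i := s y)))"
          by (cases "j = i") (simp_all add: C_diff_const C_diff_minus[OF B comp[OF that]])
        show "C_diff d k B (\<lambda>y. inverse (pd i h (y(i := s y))))"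
        proof (rule C_diff_inverse[OF B _ comp[OF i]])
          show "pd i h (y(i := s y)) \<noteq> 0" if "y \<in> B" for y using ppos[OF s_in(1)[OF that]] by simp
        qed
      qed
    qed auto
  qed
  have solx: "sol (x(i := h x)) (x i)" if "x \<in> A'" for x using that by (simp add: sol_def)
  have inB: "x(i := h x) \<in> B" if "x \<in> A'" for x
    unfolding B_def using solx[OF that] upd_Euclid[OF eopen_subset[OF A'(1) that] i] by blast
  show ?thesis
    by (rule that[OF A' B s_smooth inB s_eq[OF solx] s_in])
qed

text \<open>A family of maps depending on the first \<open>N\<close> coordinates as parameters, which is the identity
  at the parameter of the point \<open>a\<close>, is invertible near \<open>a\<close>: switch on its components one at a
  time, so that only the one-dimensional implicit function theorem is needed.\<close>

lemma perturbed_identity_local_inverse: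
  assumes \<Phi>: "smooth_euclid d A d \<Phi>" and a: "a \<in> A" and N: "N \<le> d"
    and par: "\<And>x i. x \<in> A \<Longrightarrow> i < N \<Longrightarrow> \<Phi> x i = x i"
    and fix_a: "\<And>x. x \<in> A \<Longrightarrow> (\<And>i. i < N \<Longrightarrow> x i = a i) \<Longrightarrow> \<Phi> x = x"
  obtains A' B \<Psi> where "eopen d A'" "a \<in> A'" "A' \<subseteq> A" "eopen d B" "smooth_euclid d B d \<Psi>"
    "\<And>x. x \<in> A' \<Longrightarrow> \<Phi> x \<in> B" "\<And>y. y \<in> B \<Longrightarrow> \<Psi> y \<in> A'"
    "\<And>x. x \<in> A' \<Longrightarrow> \<Psi> (\<Phi> x) = x" "\<And>y. y \<in> B \<Longrightarrow> \<Phi> (\<Psi> y) = y"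
proof -
  note A = smooth_euclidD(1)[OF \<Phi>]
  \<comment> \<open>Only the first \<open>j\<close> components of \<Phi> are switched on. The
    induction starts at \<open>j = N\<close>, where this is the identity on \<open>A\<close>, and
    ends at \<open>j = d\<close>, where it is \<Phi>; at every stage the slice through
    \<open>a\<close> stays fixed.\<close>
  define \<Phi>' where "\<Phi>' = (\<lambda>j x i. if i < j then \<Phi> x i else x i :: real)"
  have \<Phi>'_smooth: "smooth_euclid d A d (\<Phi>' j)" if "j \<le> d" for j
  proof (rule smooth_euclidI[OF A])
    show "\<Phi>' j x \<in> topspace (Euclidean_space d)" if "x \<in> A" for x
      using \<open>j \<le> d\<close> eopen_subset[OF A that] by (simp add: \<Phi>'_def Euclid_iff)
    show "C_diff d k A (\<lambda>x. \<Phi>' j x i)" for i k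
      using smooth_euclidD(3)[OF \<Phi>] C_diff_proj by (cases "i < j") (simp_all add: \<Phi>'_def)
  qed
  have \<Phi>'_fix: "\<Phi>' j x = x" if "x \<in> A" "\<And>i. i < N \<Longrightarrow> x i = a i" for x j
    using fix_a[OF that] by (auto simp: \<Phi>'_def)
  have "\<exists>A' B \<Psi>. eopen d A' \<and> a \<in> A' \<and> A' \<subseteq> A \<and> eopen d B \<and> smooth_euclid d B d \<Psi> \<and>
    (\<forall>x\<in>A'. \<Phi>' j x \<in> B \<and> \<Psi> (\<Phi>' j x) = x) \<and> (\<forall>y\<in>B. \<Psi> y \<in> A' \<and> \<Phi>' j (\<Psi> y) = y)"
    if "N \<le> j" "j \<le> d" for j
    using that
  proof (induction j rule: dec_induct)
    case base
    have "\<Phi>' N x = x" if "x \<in> A" for x using par[OF that] by (auto simp: \<Phi>'_def)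
    then show ?case using A a smooth_euclid_ident[OF A]
      by (intro exI[of _ A] exI[of _ "\<lambda>x. x"]) auto
  next
    case (step j)
    then have j: "j < d" "j \<le> d" by auto
    obtain A' B \<Psi> where IH: "eopen d A'" "a \<in> A'" "A' \<subseteq> A" "eopen d B" "smooth_euclid d B d \<Psi>"
      "\<And>x. x \<in> A' \<Longrightarrow> \<Phi>' j x \<in> B" "\<And>x. x \<in> A' \<Longrightarrow> \<Psi> (\<Phi>' j x) = x"
      "\<And>y. y \<in> B \<Longrightarrow> \<Psi> y \<in> A'" "\<And>y. y \<in> B \<Longrightarrow> \<Phi>' j (\<Psi> y) = y"
      using step.IH[OF j(2)] by blast
    \<comment> \<open>Component \<open>j\<close> of \<Phi>, read in the coordinates in which
      \<open>\<Phi>' j\<close> becomes the identity; switching it on then only replaces entry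
      \<open>j\<close> by \<open>h\<close>.\<close>
    define h where "h = (\<lambda>y. \<Phi> (\<Psi> y) j)"
    have aB: "a \<in> B" using IH(6)[OF IH(2)] \<Phi>'_fix[OF a] by simp
    have h: "C_diff d k B h" for k
      unfolding h_def
      by (rule smooth_euclidD(3)[OF smooth_euclid_compose[OF \<Phi> IH(5)]]) (use IH in blast)
    have "\<forall>\<^sub>F t in nhds (a j). t = h (a(j := t))"
      using eventually_upd[OF IH(1,2) j(1)]
    proof eventually_elim
      case (elim t)
      have "a(j := t) \<in> A" using elim IH by blast
      moreover have "(a(j := t)) i = a i" if "i < N" for i using that step.hyps(1) by simp
      ultimately have "\<Phi>' j (a(j := t)) = a(j := t)" "\<Phi> (a(j := t)) = a(j := t)"
        using \<Phi>'_fix fix_a by blast+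
      then show ?case using IH(7)[OF elim] by (simp add: h_def)
    qed
    then have "((\<lambda>t. t) has_real_derivative 1) (at (a j)) = has_pd j h 1 a"
      by (intro DERIV_cong_ev) auto
    \<comment> \<open>Since \<open>j\<close> is at least \<open>N\<close>, moving entry
      \<open>j\<close> of \<open>a\<close> alone stays in the slice where \<Phi> is the identity.
      There \<open>h\<close> returns the entry itself, so the derivative is 1.\<close>
    then have "pd j h a > 0" using pd_eq[where f = h and i = j and x = a and d = 1] by simp
    from replace_coordinate_local_inverse[OF IH(4) aB j(1) h this]
    obtain A1 B1 s where 1: "eopen d A1" "a \<in> A1" "A1 \<subseteq> B" "eopen d B1" "\<And>k. C_diff d k B1 s"
      "\<And>x. x \<in> A1 \<Longrightarrow> x(j := h x) \<in> B1" "\<And>x. x \<in> A1 \<Longrightarrow> s (x(j := h x)) = x j"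
      "\<And>y. y \<in> B1 \<Longrightarrow> y(j := s y) \<in> A1" "\<And>y. y \<in> B1 \<Longrightarrow> h (y(j := s y)) = y j" by metis
    define A2 where "A2 = {x \<in> A'. \<Phi>' j x \<in> A1}"
    have A2: "eopen d A2"
      unfolding A2_def
      by (rule eopen_preimage[OF smooth_euclid_mono[OF \<Phi>'_smooth[OF j(2)] IH(1,3)] 1(1)])
    have key: "\<Phi>' (Suc j) x = (\<Phi>' j x)(j := h (\<Phi>' j x))" if "x \<in> A'" for x
    proof -
      have *: "h (\<Phi>' j x) = \<Phi> x j" using IH(7)[OF that] by (simp add: h_def)
      show ?thesis unfolding * by (auto simp: \<Phi>'_def fun_eq_iff less_Suc_eq)
    qed
    have sm: "smooth_euclid d B1 d (\<lambda>y. \<Psi> (y(j := s y)))"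
      by (rule smooth_euclid_compose[OF IH(5) upd_smooth[OF 1(4) j(1) 1(5)]]) (use 1 in blast)
    show ?case
    proof (rule exI[of _ A2], rule exI[of _ B1], rule exI[of _ "\<lambda>y. \<Psi> (y(j := s y))"],
        intro conjI ballI)
      show "a \<in> A2" using IH 1 \<Phi>'_fix[OF a] by (simp add: A2_def)
      show "A2 \<subseteq> A" using IH by (auto simp: A2_def)
      fix x assume "x \<in> A2"
      then have x: "x \<in> A'" "\<Phi>' j x \<in> A1" by (auto simp: A2_def)
      show "\<Phi>' (Suc j) x \<in> B1" using 1(6)[OF x(2)] key[OF x(1)] by simp
      show "\<Psi> ((\<Phi>' (Suc j) x)(j := s (\<Phi>' (Suc j) x))) = x"
        using 1(7)[OF x(2)] IH(7)[OF x(1)] by (simp add: key[OF x(1)])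
    next
      fix y assume y: "y \<in> B1"
      define z where "z = y(j := s y)"
      have z: "z \<in> A1" "z \<in> B" "h z = y j" using 1 y by (auto simp: z_def)
      then show "\<Psi> (y(j := s y)) \<in> A2"
        using IH(8)[OF z(2)] IH(9)[OF z(2)] by (simp add: A2_def z_def[symmetric])
      show "\<Phi>' (Suc j) (\<Psi> (y(j := s y))) = y"
        using key[OF IH(8)[OF z(2)]] IH(9)[OF z(2)] z(3) by (simp add: z_def)
    qed (use A2 1 sm in auto)
  qed
  from this[OF N order_refl]
  obtain A' B \<Psi> where *: "eopen d A'" "a \<in> A'" "A' \<subseteq> A" "eopen d B" "smooth_euclid d B d \<Psi>"
      "\<And>x. x \<in> A' \<Longrightarrow> \<Phi>' d x \<in> B" "\<And>x. x \<in> A' \<Longrightarrow> \<Psi> (\<Phi>' d x) = x"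
      "\<And>y. y \<in> B \<Longrightarrow> \<Psi> y \<in> A'" "\<And>y. y \<in> B \<Longrightarrow> \<Phi>' d (\<Psi> y) = y" by blast
  have eq: "\<Phi>' d x = \<Phi> x" if "x \<in> A'" for x
    using smooth_euclidD(2)[OF \<Phi>] eopen_subset[OF *(1) that] that *(3)
    by (force simp: \<Phi>'_def Euclid_iff fun_eq_iff subset_iff)
  show ?thesis
    by (rule that[OF *(1-5)]) (use * eq in \<open>simp_all\<close>)
qed

section \<open>Plots and the D-topology\<close>

lemma euclid_dfl_simps [simp]:
  "dspace (euclid_dfl n U) = U"
  "plot (euclid_dfl n U) m V F \<longleftrightarrow> smooth_euclid m V n F \<and> F \<in> V \<rightarrow> U"
  by (simp_all add: euclid_dfl_def)

lemma sub_dfl_simps [simp]: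
  "dspace (sub_dfl X A) = dspace X \<inter> A"
  "plot (sub_dfl X A) n U P \<longleftrightarrow> plot X n U P \<and> P \<in> U \<rightarrow> A"
  by (simp_all add: sub_dfl_def)

lemma prod_dfl_simps [simp]:
  "dspace (prod_dfl X Y) = dspace X \<times> dspace Y"
  "plot (prod_dfl X Y) n U P \<longleftrightarrow> plot X n U (fst \<circ> P) \<and> plot Y n U (snd \<circ> P)"
  by (simp_all add: prod_dfl_def)

lemma dspace_pullback [simp]:
  "q \<in> dspace (pullback_dfl X f n U P) \<longleftrightarrow> fst q \<in> U \<and> snd q \<in> dspace X \<and> P (fst q) = f (snd q)"
  by (cases q) (auto simp: pullback_dfl_def)

lemma (in diffeological_space) plot_pullback:
  "plot (pullback_dfl X f n U P) m V p \<longleftrightarrow> smooth_euclid m V n (fst \<circ> p) \<and> plot X m V (snd \<circ> p) \<and>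
     (\<forall>r\<in>V. fst (p r) \<in> U \<and> P (fst (p r)) = f (snd (p r)))"
  using plot_into[of m V "snd \<circ> p"]
  by (auto simp: pullback_dfl_def Pi_iff case_prod_beta)

lemma openin_D_preimage:
  assumes "openin (D_topology X) A" "plot X n U P"
  shows "eopen n {r \<in> U. P r \<in> A}"
  using assms by (simp add: openin_D_topology)

lemma openin_DI:
  assumes "A \<subseteq> dspace X"
    "\<And>n U P r. plot X n U P \<Longrightarrow> r \<in> U \<Longrightarrow> P r \<in> A \<Longrightarrow>
      \<exists>V. eopen n V \<and> r \<in> V \<and> V \<subseteq> U \<and> (\<forall>s\<in>V. P s \<in> A)"
  shows "openin (D_topology X) A"
  unfolding openin_D_topology
proof (intro conjI allI impI assms(1))
  fix n U P assume P: "plot X n U P"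
  show "eopen n {r \<in> U. P r \<in> A}"
    unfolding openin_subopen[of _ "{r \<in> U. P r \<in> A}"]
  proof
    fix r assume "r \<in> {r \<in> U. P r \<in> A}"
    then obtain V where "eopen n V" "r \<in> V" "V \<subseteq> U" "\<forall>s\<in>V. P s \<in> A" using assms(2)[OF P, of r] by blast
    then show "\<exists>T. eopen n T \<and> r \<in> T \<and> T \<subseteq> {r \<in> U. P r \<in> A}" by (intro exI[of _ V]) auto
  qed
qed

lemma (in diffeological_space) openin_D_preimage_smooth:
  assumes "smooth X Y f" "openin (D_topology Y) A"
  shows "openin (D_topology X) {x \<in> dspace X. f x \<in> A}"
  unfolding openin_D_topology
proof (intro conjI allI impI)
  fix n U P assume P: "plot X n U P"
  then have "plot Y n U (f \<circ> P)" using assms(1) by (simp add: smooth_def)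
  from openin_D_preimage[OF assms(2) this]
  have *: "eopen n {r \<in> U. f (P r) \<in> A}" by simp
  have "{r \<in> U. P r \<in> {x \<in> dspace X. f x \<in> A}} = {r \<in> U. f (P r) \<in> A}"
    using plot_into[OF P] by auto
  then show "eopen n {r \<in> U. P r \<in> {x \<in> dspace X. f x \<in> A}}" using * by simp
qed auto

lemma openin_D_euclid:
  assumes "eopen n U"
  shows "openin (D_topology (euclid_dfl n U)) A \<longleftrightarrow> eopen n A \<and> A \<subseteq> U"
proof
  assume *: "openin (D_topology (euclid_dfl n U)) A"
  have "eopen n {r \<in> U. r \<in> A}"
    by (rule openin_D_preimage[OF *]) (simp add: smooth_euclid_ident[OF assms])
  moreover have "A \<subseteq> U" using * by (simp add: openin_D_topology)
  moreover from this have "{r \<in> U. r \<in> A} = A" by blast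
  ultimately show "eopen n A \<and> A \<subseteq> U" by simp
next
  assume A: "eopen n A \<and> A \<subseteq> U"
  then show "openin (D_topology (euclid_dfl n U)) A"
    unfolding openin_D_topology
  proof (intro conjI allI impI)
    fix m V F assume "plot (euclid_dfl n U) m V F"
    then show "eopen m {r \<in> V. F r \<in> A}"
      using A eopen_preimage[where F = F and Z = A and m = n] by simp
  qed simp
qed

context diffeological_space
begin

lemma plot_mono: "plot X n U P \<Longrightarrow> eopen n V \<Longrightarrow> V \<subseteq> U \<Longrightarrow> plot X n V P"
  using plot_comp[of n U P n V "\<lambda>x. x"] smooth_euclid_ident[of n V] by (simp add: o_def Pi_iff subset_iff)

lemma plot_compose:
  assumes "plot X n U P" "smooth_euclid m V n F" "\<And>r. r \<in> V \<Longrightarrow> F r \<in> U"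
  shows "plot X m V (\<lambda>r. P (F r))"
  using plot_comp[OF assms(1,2)] assms(3) by (simp add: o_def Pi_iff)

end

lemma smooth_plot: "smooth X Y f \<Longrightarrow> plot X n U P \<Longrightarrow> plot Y n U (\<lambda>r. f (P r))"
  by (simp add: smooth_def o_def)

section \<open>Pointwise lifting and retraction properties\<close>

text \<open>The lifting clause of a local subduction at a single point, separated from surjectivity
  so that its persistence for nearby maps and points can be stated.\<close>

definition lifts_at :: "'a diffeology \<Rightarrow> 'b diffeology \<Rightarrow> ('a \<Rightarrow> 'b) \<Rightarrow> 'a \<Rightarrow> bool" where
  "lifts_at X Y f x \<longleftrightarrow> (\<forall>n U P r0. plot Y n U P \<longrightarrow> r0 \<in> U \<longrightarrow> P r0 = f x \<longrightarrow>
     (\<exists>V L. eopen n V \<and> V \<subseteq> U \<and> r0 \<in> V \<and> plot X n V L \<and> L r0 = x \<and> (\<forall>r\<in>V. f (L r) = P r)))"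

lemma lifts_atD:
  assumes "lifts_at X Y f x" "plot Y n U P" "r0 \<in> U" "P r0 = f x"
  obtains V L where "eopen n V" "V \<subseteq> U" "r0 \<in> V" "plot X n V L" "L r0 = x" "\<And>r. r \<in> V \<Longrightarrow> f (L r) = P r"
proof -
  note * = assms(1)[unfolded lifts_at_def, THEN spec[of _ n], THEN spec[of _ U], THEN spec[of _ P],
      THEN spec[of _ r0], THEN mp, THEN mp, THEN mp, OF assms(2-4)]
  show ?thesis using * that by (elim exE conjE) simp
qed

text \<open>The immersion clause at the pullback points with second entry \<open>x\<close>. Sorting
  those points by \<open>x\<close> turns an immersion into a condition at each point of
  \<open>X\<close>, the form to which compactness applies.\<close>

definition retracts_at :: "'a diffeology \<Rightarrow> 'b diffeology \<Rightarrow> ('a \<Rightarrow> 'b) \<Rightarrow> 'a \<Rightarrow> bool" where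
  "retracts_at X Y f x \<longleftrightarrow> (\<forall>n U P r0. plot Y n U P \<longrightarrow> r0 \<in> U \<longrightarrow> P r0 = f x \<longrightarrow>
     (\<exists>Q V \<rho>. openin (D_topology (pullback_dfl X f n U P)) Q \<and> (r0, x) \<in> Q \<and>
        eopen n V \<and> V \<subseteq> U \<and> fst ` Q \<subseteq> V \<and>
        smooth (euclid_dfl n V) (prod_dfl (euclid_dfl n U) X) \<rho> \<and> (\<forall>q\<in>Q. \<rho> (fst q) = q)))"

lemma retracts_atD:
  assumes "retracts_at X Y f x" "plot Y n U P" "r0 \<in> U" "P r0 = f x"
  obtains Q V \<rho> where "openin (D_topology (pullback_dfl X f n U P)) Q" "(r0, x) \<in> Q" 
    "eopen n V" "V \<subseteq> U" "fst ` Q \<subseteq> V" "smooth (euclid_dfl n V) (prod_dfl (euclid_dfl n U) X) \<rho>"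
    "\<And>q. q \<in> Q \<Longrightarrow> \<rho> (fst q) = q"
proof -
  note * = assms(1)[unfolded retracts_at_def, THEN spec[of _ n], THEN spec[of _ U], THEN spec[of _ P],
      THEN spec[of _ r0], THEN mp, THEN mp, THEN mp, OF assms(2-4)]
  show ?thesis using * that by (elim exE conjE) simp
qed

lemma diffeological_immersion_iff:
  "diffeological_immersion X Y f \<longleftrightarrow> smooth X Y f \<and> (\<forall>x\<in>dspace X. retracts_at X Y f x)"
proof -
  have "(\<forall>n U P. plot Y n U P \<longrightarrow> (\<forall>p\<in>dspace (pullback_dfl X f n U P). R n U P p)) \<longleftrightarrow>
    (\<forall>x\<in>dspace X. \<forall>n U P r0. plot Y n U P \<longrightarrow> r0 \<in> U \<longrightarrow> P r0 = f x \<longrightarrow> R n U P (r0, x))"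
    (is "?l \<longleftrightarrow> ?r") for R
  proof
    assume l: ?l
    show ?r
    proof (intro ballI allI impI)
      fix x n U P r0 assume "x \<in> dspace X" "plot Y n U P" "r0 \<in> U" "P r0 = f x"
      then show "R n U P (r0, x)"
        by (intro l[THEN spec[of _ n], THEN spec[of _ U], THEN spec[of _ P], THEN mp, THEN bspec])
          simp_all
    qed
  next
    assume r: ?r
    show ?l
    proof (intro ballI allI impI)
      fix n U P p assume "plot Y n U P" "p \<in> dspace (pullback_dfl X f n U P)"
      then have "plot Y n U P" "fst p \<in> U" "snd p \<in> dspace X" "P (fst p) = f (snd p)" by simp_all
      then have "R n U P (fst p, snd p)" using r by blast
      then show "R n U P p" by simp
    qed
  qed
  then show ?thesis unfolding diffeological_immersion_def retracts_at_def by (rule arg_cong)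
qed

lemma local_subduction_iff:
  "local_subduction X Y f \<longleftrightarrow> smooth X Y f \<and> f ` dspace X = dspace Y \<and> (\<forall>x\<in>dspace X. lifts_at X Y f x)"
proof (intro iffI conjI ballI)
  assume f: "local_subduction X Y f"
  then show "smooth X Y f" "f ` dspace X = dspace Y" by (simp_all only: local_subduction_def)
  fix x assume x: "x \<in> dspace X"
  show "lifts_at X Y f x"
    unfolding lifts_at_def
  proof (intro allI impI)
    fix n U P r0 assume P: "plot Y n U P" "r0 \<in> U" "P r0 = f x"
    show "\<exists>V L. eopen n V \<and> V \<subseteq> U \<and> r0 \<in> V \<and> plot X n V L \<and> L r0 = x \<and> (\<forall>r\<in>V. f (L r) = P r)"
      by (rule f[unfolded local_subduction_def, THEN conjunct2, THEN conjunct2, THEN spec, THEN spec,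
            THEN spec, THEN mp, THEN bspec, THEN bspec, THEN mp, OF P(1,2) x P(3)[symmetric]])
  qed
next
  assume f: "smooth X Y f \<and> f ` dspace X = dspace Y \<and> (\<forall>x\<in>dspace X. lifts_at X Y f x)"
  show "local_subduction X Y f"
    unfolding local_subduction_def
  proof (intro conjI allI impI ballI)
    fix n U P r0 x assume P: "plot Y n U P" "r0 \<in> U" "x \<in> dspace X" "f x = P r0"
    have "lifts_at X Y f x" using f P(3) by blast
    then show "\<exists>V L. eopen n V \<and> V \<subseteq> U \<and> r0 \<in> V \<and> plot X n V L \<and> L r0 = x \<and> (\<forall>r\<in>V. f (L r) = P r)"
      by (rule lifts_atD[of X Y f x n U P r0]) (use P in \<open>simp_all, blast\<close>)
  next
    show "smooth X Y f" "f ` dspace X = dspace Y" using f by simp_all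
  qed
qed

section \<open>The classes of maps in terms of pointwise lifting and retraction\<close>

context diffeological_space
begin

lemma plot_graph:
  assumes "plot X n V L" "V \<subseteq> U" "\<And>r. r \<in> V \<Longrightarrow> f (L r) = P r"
  shows "plot (pullback_dfl X f n U P) n V (\<lambda>r. (r, L r))"
  unfolding plot_pullback o_def fst_conv snd_conv
proof (intro conjI ballI)
  show "smooth_euclid n V n (\<lambda>r. r)" by (rule smooth_euclid_ident[OF plot_open[OF assms(1)]])
  show "plot X n V (\<lambda>r. L r)" by (rule assms(1))
  fix r assume "r \<in> V"
  then show "r \<in> U" "P r = f (L r)" using assms(2) assms(3)[of r] by auto
qed

lemma plot_pullback_compose:
  assumes "plot (pullback_dfl X f n U P) m V p" "smooth_euclid l W m F" "\<And>r. r \<in> W \<Longrightarrow> F r \<in> V"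
    "\<And>r. r \<in> W \<Longrightarrow> q r = p (F r)"
  shows "plot (pullback_dfl X f n U P) l W q"
proof -
  have p: "smooth_euclid m V n (\<lambda>r. fst (p r))" "plot X m V (\<lambda>r. snd (p r))"
    "\<And>r. r \<in> V \<Longrightarrow> fst (p r) \<in> U \<and> P (fst (p r)) = f (snd (p r))"
    using assms(1) by (auto simp: plot_pullback o_def)
  have "smooth_euclid l W n (\<lambda>r. fst (q r))"
    by (rule smooth_euclid_cong[OF smooth_euclid_compose[OF p(1) assms(2,3)]]) (simp_all add: assms(4))
  moreover have "plot X l W (\<lambda>r. snd (q r))"
    by (rule plot_cong[OF plot_compose[OF p(2) assms(2,3)]]) (simp_all add: assms(4))
  ultimately show ?thesis using p(3) assms(3,4) by (simp add: plot_pullback o_def)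
qed

text \<open>A local section of the pullback projection through (r0, x) is the graph of a local lift
  of \<open>P\<close> with value \<open>x\<close> at \<open>r0\<close>, and its second component
  recovers the lift.\<close>

lemma diffeological_submersion_iff:
  "diffeological_submersion X Y f \<longleftrightarrow> smooth X Y f \<and> (\<forall>x\<in>dspace X. lifts_at X Y f x)"
  if Y: "diffeological_space Y"
proof (intro iffI conjI ballI)
  assume f: "diffeological_submersion X Y f"
  show "smooth X Y f" using f by (simp add: diffeological_submersion_def)
  fix x assume x: "x \<in> dspace X"
  show "lifts_at X Y f x"
    unfolding lifts_at_def
  proof (intro allI impI)
    fix n U P r0 assume P: "plot Y n U P" and r0: "r0 \<in> U" "P r0 = f x"
    have "submersion (pullback_dfl X f n U P) (euclid_dfl n U) fst"
      using f P by (simp add: diffeological_submersion_def)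
    moreover have "(r0, x) \<in> dspace (pullback_dfl X f n U P)" using r0 x by simp
    ultimately obtain Q \<sigma> where Q: "openin (D_topology (euclid_dfl n U)) Q"
      "smooth (sub_dfl (euclid_dfl n U) Q) (pullback_dfl X f n U P) \<sigma>"
      "(r0, x) \<in> \<sigma> ` Q" "\<And>y. y \<in> Q \<Longrightarrow> fst (\<sigma> y) = y" unfolding submersion_def by blast
    have Q': "eopen n Q" "Q \<subseteq> U"
      using Q(1) openin_D_euclid[OF diffeological_space.plot_open[OF Y P]] by auto
    have "plot (pullback_dfl X f n U P) n Q (\<lambda>r. \<sigma> r)"
      by (rule smooth_plot[OF Q(2)]) (use Q' smooth_euclid_ident[OF Q'(1)] in auto)
    then have "plot X n Q (snd \<circ> \<sigma>)" "\<forall>r\<in>Q. P (fst (\<sigma> r)) = f (snd (\<sigma> r))"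
      by (auto simp: plot_pullback o_def)
    moreover have "r0 \<in> Q" "snd (\<sigma> r0) = x"
    proof -
      obtain r where r: "r \<in> Q" "\<sigma> r = (r0, x)" using Q(3) by (metis imageE)
      then have "r = r0" using Q(4)[OF r(1)] by simp
      then show "r0 \<in> Q" "snd (\<sigma> r0) = x" using r by simp_all
    qed
    ultimately show "\<exists>V L. eopen n V \<and> V \<subseteq> U \<and> r0 \<in> V \<and> plot X n V L \<and> L r0 = x \<and> (\<forall>r\<in>V. f (L r) = P r)"
      using Q' Q(4) by (intro exI[of _ Q] exI[of _ "snd \<circ> \<sigma>"]) auto
  qed
next
  assume f: "smooth X Y f \<and> (\<forall>x\<in>dspace X. lifts_at X Y f x)"
  show "diffeological_submersion X Y f"
    unfolding diffeological_submersion_def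
  proof (intro conjI allI impI)
    fix n U P assume P: "plot Y n U P"
    note U = diffeological_space.plot_open[OF Y P]
    show "submersion (pullback_dfl X f n U P) (euclid_dfl n U) fst"
      unfolding submersion_def
    proof (intro conjI ballI)
      show "smooth (pullback_dfl X f n U P) (euclid_dfl n U) fst"
        unfolding smooth_def by (auto simp: plot_pullback)
      fix p assume "p \<in> dspace (pullback_dfl X f n U P)"
      then have p: "fst p \<in> U" "snd p \<in> dspace X" "P (fst p) = f (snd p)" by auto
      then have "lifts_at X Y f (snd p)" using f by blast
      from lifts_atD[OF this P p(1,3)]
      obtain V L where V: "eopen n V" "V \<subseteq> U" "fst p \<in> V" "plot X n V L" "L (fst p) = snd p"
        "\<And>r. r \<in> V \<Longrightarrow> f (L r) = P r" by metis
      have gr: "plot (pullback_dfl X f n U P) n V (\<lambda>r. (r, L r))"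
        by (rule plot_graph[OF V(4,2)]) (rule V(6))
      show "\<exists>Q \<sigma>. openin (D_topology (euclid_dfl n U)) Q \<and> smooth (sub_dfl (euclid_dfl n U) Q) (pullback_dfl X f n U P) \<sigma>
          \<and> p \<in> \<sigma> ` Q \<and> (\<forall>y\<in>Q. fst (\<sigma> y) = y)"
      proof (rule exI[of _ V], rule exI[of _ "\<lambda>r. (r, L r)"], intro conjI)
        show "openin (D_topology (euclid_dfl n U)) V" using V openin_D_euclid[OF U] by blast
        show "smooth (sub_dfl (euclid_dfl n U) V) (pullback_dfl X f n U P) (\<lambda>r. (r, L r))"
          unfolding smooth_def
        proof (intro conjI allI impI)
          show "(\<lambda>r. (r, L r)) \<in> dspace (sub_dfl (euclid_dfl n U) V) \<rightarrow> dspace (pullback_dfl X f n U P)"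
            using V plot_into[OF V(4)] by auto
          fix m W F assume "plot (sub_dfl (euclid_dfl n U) V) m W F"
          then show "plot (pullback_dfl X f n U P) m W ((\<lambda>r. (r, L r)) \<circ> F)"
            by (intro plot_pullback_compose[OF gr, of m W F]) auto
        qed
        show "p \<in> (\<lambda>r. (r, L r)) ` V" using V by (intro image_eqI[of _ _ "fst p"]) auto
      qed auto
    qed
  qed (use f in blast)
qed

text \<open>A smooth map defined on a Euclidean domain amounts to a plot, so the local inverse of
  the projection becomes an explicit plot \<open>g\<close> with two inverse identities. Later
  arguments are thereby freed from \<open>inv_into\<close> and subspace diffeologies.\<close>

lemma etale_pullback_iff:
  assumes U: "eopen n U"
  shows "etale (pullback_dfl X f n U P) (euclid_dfl n U) fst \<longleftrightarrow>
    (\<forall>p\<in>dspace (pullback_dfl X f n U P). \<exists>Q V g. openin (D_topology (pullback_dfl X f n U P)) Q \<and> p \<in> Q \<and>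
       eopen n V \<and> V \<subseteq> U \<and> fst ` Q \<subseteq> V \<and> plot (pullback_dfl X f n U P) n V g \<and> g \<in> V \<rightarrow> Q \<and>
       (\<forall>r\<in>V. fst (g r) = r) \<and> (\<forall>q\<in>Q. g (fst q) = q))" (is "_ \<longleftrightarrow> (\<forall>p\<in>dspace ?X. \<exists>Q V g. ?R p Q V g)")
proof (intro iffI ballI)
  fix p assume et: "etale ?X (euclid_dfl n U) fst" and p: "p \<in> dspace ?X"
  then obtain Q V where Q: "openin (D_topology ?X) Q" "p \<in> Q" "openin (D_topology (euclid_dfl n U)) V"
    "fst p \<in> V" "diffeomorphism (sub_dfl ?X Q) (sub_dfl (euclid_dfl n U) V) fst"
    unfolding etale_def by blast
  have Qs: "Q \<subseteq> dspace ?X" using Q(1) by (simp add: openin_D_topology)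
  have V: "eopen n V" "V \<subseteq> U" using Q(3) openin_D_euclid[OF U] by auto
  define g where "g = inv_into Q (fst :: _ \<Rightarrow> nat \<Rightarrow> real)"
  have bij: "bij_betw fst Q V" and g: "smooth (sub_dfl (euclid_dfl n U) V) (sub_dfl ?X Q) g"
    using Q(5) Qs V(2) by (simp_all add: diffeomorphism_def g_def Int_absorb1 Int_absorb2)
  have "plot (sub_dfl ?X Q) n V (\<lambda>r. g r)"
    by (rule smooth_plot[OF g]) (use V smooth_euclid_ident[OF V(1)] in auto)
  then have "plot ?X n V g" "g \<in> V \<rightarrow> Q" by simp_all
  moreover have "\<forall>r\<in>V. fst (g r) = r" "\<forall>q\<in>Q. g (fst q) = q" "fst ` Q \<subseteq> V"
    using bij by (auto simp: g_def bij_betw_def f_inv_into_f)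
  ultimately show "\<exists>Q V g. ?R p Q V g" using Q V by blast
next
  assume R: "\<forall>p\<in>dspace ?X. \<exists>Q V g. ?R p Q V g"
  show "etale ?X (euclid_dfl n U) fst"
    unfolding etale_def
  proof (intro conjI ballI)
    show "fst \<in> dspace ?X \<rightarrow> dspace (euclid_dfl n U)" by auto
    fix p assume p: "p \<in> dspace ?X"
    from R[rule_format, OF p] obtain Q V g where Q: "openin (D_topology ?X) Q" "p \<in> Q" "eopen n V" "V \<subseteq> U"
      "fst ` Q \<subseteq> V" "plot ?X n V g" and gQ: "\<And>r. r \<in> V \<Longrightarrow> g r \<in> Q"
      and fg: "\<And>r. r \<in> V \<Longrightarrow> fst (g r) = r" and gf: "\<And>q. q \<in> Q \<Longrightarrow> g (fst q) = q"
      unfolding Pi_iff by blast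
    have Qs: "Q \<subseteq> dspace ?X" using Q(1) by (simp add: openin_D_topology)
    have inj: "inj_on fst Q" by (rule inj_on_inverseI) (rule gf)
    have im: "fst ` Q = V"
    proof
      show "V \<subseteq> fst ` Q"
      proof
        fix r assume "r \<in> V"
        from image_eqI[of r fst "g r", OF fg[OF this, symmetric] gQ[OF this]] show "r \<in> fst ` Q" .
      qed
    qed (rule Q(5))
    have ginv: "inv_into Q fst r = g r" if "r \<in> V" for r
      using inv_into_f_f[OF inj gQ[OF that]] fg[OF that] by simp
    have "diffeomorphism (sub_dfl ?X Q) (sub_dfl (euclid_dfl n U) V) fst"
      unfolding diffeomorphism_def
    proof (intro conjI)
      show "bij_betw fst (dspace (sub_dfl ?X Q)) (dspace (sub_dfl (euclid_dfl n U) V))"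
        using inj im Qs Q(4) by (simp add: bij_betw_def Int_absorb1 Int_absorb2)
      show "smooth (sub_dfl ?X Q) (sub_dfl (euclid_dfl n U) V) fst"
        unfolding smooth_def using im by (auto simp: plot_pullback Pi_iff)
      show "smooth (sub_dfl (euclid_dfl n U) V) (sub_dfl ?X Q) (inv_into (dspace (sub_dfl ?X Q)) fst)"
        unfolding smooth_def
      proof (intro conjI allI impI)
        show "inv_into (dspace (sub_dfl ?X Q)) fst \<in> dspace (sub_dfl (euclid_dfl n U) V) \<rightarrow> dspace (sub_dfl ?X Q)"
          using Qs Q(4) ginv gQ by (simp add: Int_absorb1 Int_absorb2 Pi_iff)
        fix m W F assume F: "plot (sub_dfl (euclid_dfl n U) V) m W F"
        have "plot ?X m W (inv_into Q fst \<circ> F)"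
          by (rule plot_pullback_compose[of f n U P n V g m W F]) (use F Q(6) ginv in auto)
        moreover have "inv_into Q fst \<circ> F \<in> W \<rightarrow> Q" using F ginv gQ by (simp add: Pi_iff)
        ultimately show "plot (sub_dfl ?X Q) m W (inv_into (dspace (sub_dfl ?X Q)) fst \<circ> F)"
          using Qs by (simp add: Int_absorb1 Int_absorb2)
      qed
    qed
    moreover have "openin (D_topology (euclid_dfl n U)) V" using Q(3,4) openin_D_euclid[OF U] by blast
    ultimately show "\<exists>Q V. openin (D_topology ?X) Q \<and> p \<in> Q \<and> openin (D_topology (euclid_dfl n U)) V \<and>
        fst p \<in> V \<and> diffeomorphism (sub_dfl ?X Q) (sub_dfl (euclid_dfl n U) V) fst"
      using Q(1,2) im by blast
  qed
qed

lemma openin_pullback_fst: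
  assumes "openin (D_topology (pullback_dfl X f n U P)) Q" "eopen n V"
  shows "openin (D_topology (pullback_dfl X f n U P)) {q \<in> Q. fst q \<in> V}"
  unfolding openin_D_topology
proof (intro conjI allI impI)
  show "{q \<in> Q. fst q \<in> V} \<subseteq> dspace (pullback_dfl X f n U P)"
    using assms(1) by (auto simp: openin_D_topology)
  fix m W p assume p: "plot (pullback_dfl X f n U P) m W p"
  have "eopen m ({r \<in> W. p r \<in> Q} \<inter> {r \<in> W. (fst \<circ> p) r \<in> V})"
  proof (rule openin_Int)
    show "eopen m {r \<in> W. p r \<in> Q}" by (rule openin_D_preimage[OF assms(1) p])
    have "smooth_euclid m W n (fst \<circ> p)" using p by (simp only: plot_pullback)
    then show "eopen m {r \<in> W. (fst \<circ> p) r \<in> V}" by (rule eopen_preimage[OF _ assms(2)])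
  qed
  also have "{r \<in> W. p r \<in> Q} \<inter> {r \<in> W. (fst \<circ> p) r \<in> V} = {r \<in> W. p r \<in> {q \<in> Q. fst q \<in> V}}"
    by auto
  finally show "eopen m {r \<in> W. p r \<in> {q \<in> Q. fst q \<in> V}}" .
qed

text \<open>Lifting provides a local section of the pullback projection. Retraction makes the
  projection injective on a D-open set, since there \<rho> reconstructs a point from its first
  entry. Together they invert the projection locally; conversely a local inverse supplies
  both.\<close>

lemma diffeological_etale_iff:
  assumes Y: "diffeological_space Y"
  shows "diffeological_etale X Y f \<longleftrightarrow> diffeological_submersion X Y f \<and> diffeological_immersion X Y f"
  unfolding diffeological_submersion_iff[OF Y] diffeological_immersion_iff
proof (intro iffI conjI ballI)
  assume f: "diffeological_etale X Y f"
  then show "smooth X Y f" "smooth X Y f" by (simp_all add: diffeological_etale_def)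
  fix x assume x: "x \<in> dspace X"
  have key: "\<exists>Q V g. openin (D_topology (pullback_dfl X f n U P)) Q \<and> (r0, x) \<in> Q \<and>
       eopen n V \<and> V \<subseteq> U \<and> fst ` Q \<subseteq> V \<and> plot (pullback_dfl X f n U P) n V g \<and> g \<in> V \<rightarrow> Q \<and>
       (\<forall>r\<in>V. fst (g r) = r) \<and> (\<forall>q\<in>Q. g (fst q) = q)"
    if P: "plot Y n U P" "r0 \<in> U" "P r0 = f x" for n U P r0
  proof -
    have "etale (pullback_dfl X f n U P) (euclid_dfl n U) fst"
      using f P by (simp add: diffeological_etale_def)
    moreover have "(r0, x) \<in> dspace (pullback_dfl X f n U P)" using P x by simp
    ultimately show ?thesis
      unfolding etale_pullback_iff[OF diffeological_space.plot_open[OF Y P(1)]] by blast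
  qed
  show "lifts_at X Y f x"
    unfolding lifts_at_def
  proof (intro allI impI)
    fix n U P r0 assume P: "plot Y n U P" "r0 \<in> U" "P r0 = f x"
    obtain Q V g where Q: "(r0, x) \<in> Q" "eopen n V" "V \<subseteq> U" "fst ` Q \<subseteq> V"
      "plot (pullback_dfl X f n U P) n V g" "\<And>r. r \<in> V \<Longrightarrow> fst (g r) = r" "\<And>q. q \<in> Q \<Longrightarrow> g (fst q) = q"
      using key[OF P] by blast
    have "plot X n V (snd \<circ> g)" "\<forall>r\<in>V. f (snd (g r)) = P r"
      using Q(5,6) by (auto simp: plot_pullback)
    moreover have "r0 \<in> V" using Q(1,4) by force
    moreover have "snd (g r0) = x" using Q(7)[OF Q(1)] by simp
    ultimately show "\<exists>V L. eopen n V \<and> V \<subseteq> U \<and> r0 \<in> V \<and> plot X n V L \<and> L r0 = x \<and> (\<forall>r\<in>V. f (L r) = P r)"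
      using Q(2,3) by (intro exI[of _ V] exI[of _ "snd \<circ> g"]) auto
  qed
  show "retracts_at X Y f x"
    unfolding retracts_at_def
  proof (intro allI impI)
    fix n U P r0 assume P: "plot Y n U P" "r0 \<in> U" "P r0 = f x"
    obtain Q V g where Q: "openin (D_topology (pullback_dfl X f n U P)) Q" "(r0, x) \<in> Q" "eopen n V" "V \<subseteq> U" "fst ` Q \<subseteq> V"
      "plot (pullback_dfl X f n U P) n V g" "\<forall>q\<in>Q. g (fst q) = q"
      using key[OF P] by blast
    have "smooth (euclid_dfl n V) (prod_dfl (euclid_dfl n U) X) g"
      unfolding smooth_def
    proof (intro conjI allI impI)
      show "g \<in> dspace (euclid_dfl n V) \<rightarrow> dspace (prod_dfl (euclid_dfl n U) X)"
        using Q(6) plot_into[of n V "snd \<circ> g"] by (auto simp: plot_pullback Pi_iff mem_Times_iff)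
      fix m W F assume "plot (euclid_dfl n V) m W F"
      then have "plot (pullback_dfl X f n U P) m W (g \<circ> F)"
        by (intro plot_pullback_compose[OF Q(6), of m W F]) auto
      then show "plot (prod_dfl (euclid_dfl n U) X) m W (g \<circ> F)" by (auto simp: plot_pullback)
    qed
    then show "\<exists>Q V \<rho>. openin (D_topology (pullback_dfl X f n U P)) Q \<and> (r0, x) \<in> Q \<and>
        eopen n V \<and> V \<subseteq> U \<and> fst ` Q \<subseteq> V \<and>
        smooth (euclid_dfl n V) (prod_dfl (euclid_dfl n U) X) \<rho> \<and> (\<forall>q\<in>Q. \<rho> (fst q) = q)"
      using Q by blast
  qed
next
  assume f: "(smooth X Y f \<and> (\<forall>x\<in>dspace X. lifts_at X Y f x)) \<and> smooth X Y f \<and> (\<forall>x\<in>dspace X. retracts_at X Y f x)"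
  show "diffeological_etale X Y f"
    unfolding diffeological_etale_def
  proof (intro conjI allI impI)
    fix n U P assume P: "plot Y n U P"
    show "etale (pullback_dfl X f n U P) (euclid_dfl n U) fst"
      unfolding etale_pullback_iff[OF diffeological_space.plot_open[OF Y P]]
    proof
      fix p assume "p \<in> dspace (pullback_dfl X f n U P)"
      then have p: "fst p \<in> U" "snd p \<in> dspace X" "P (fst p) = f (snd p)" by auto
      from f p have l: "lifts_at X Y f (snd p)" and r: "retracts_at X Y f (snd p)" by auto
      obtain V L where V: "eopen n V" "V \<subseteq> U" "fst p \<in> V" "plot X n V L" "L (fst p) = snd p"
        "\<And>r. r \<in> V \<Longrightarrow> f (L r) = P r" using lifts_atD[OF l P p(1,3)] by metis
      obtain Q V' \<rho> where Q: "openin (D_topology (pullback_dfl X f n U P)) Q" "(fst p, snd p) \<in> Q"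
        "\<And>q. q \<in> Q \<Longrightarrow> \<rho> (fst q) = q" using retracts_atD[OF r P p(1,3)] by metis
      define g where "g = (\<lambda>r. (r, L r))"
      have g: "plot (pullback_dfl X f n U P) n V g" unfolding g_def by (rule plot_graph[OF V(4,2)]) (rule V(6))
      \<comment> \<open>The graph of the lift is restricted to the part inside \<open>Q\<close>, and
        \<open>Q\<close> to the part above \<open>V1\<close>. Then \<open>q\<close> and
        \<open>g (fst q)\<close> lie in \<open>Q\<close> over the same parameter and must
        coincide.\<close>
      define V1 where "V1 = {r \<in> V. g r \<in> Q}"
      define Q1 where "Q1 = {q \<in> Q. fst q \<in> V1}"
      have V1: "eopen n V1" unfolding V1_def by (rule openin_D_preimage[OF Q(1) g])
      have "openin (D_topology (pullback_dfl X f n U P)) Q1"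
        unfolding Q1_def by (rule openin_pullback_fst[OF Q(1) V1])
      moreover have "p \<in> Q1" using Q(2) V by (simp add: Q1_def V1_def g_def)
      moreover have "V1 \<subseteq> U" "fst ` Q1 \<subseteq> V1" using V by (auto simp: V1_def Q1_def)
      moreover have "plot (pullback_dfl X f n U P) n V1 g"
        by (rule plot_pullback_compose[OF g smooth_euclid_ident[OF V1]]) (auto simp: V1_def)
      moreover have "g \<in> V1 \<rightarrow> Q1" "\<forall>r\<in>V1. fst (g r) = r" by (auto simp: Q1_def V1_def g_def)
      moreover have "\<forall>q\<in>Q1. g (fst q) = q"
      proof
        fix q assume "q \<in> Q1"
        then have "q \<in> Q" "g (fst q) \<in> Q" by (auto simp: Q1_def V1_def)
        then show "g (fst q) = q" using Q(3)[of q] Q(3)[of "g (fst q)"] by (simp add: g_def)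
      qed
      ultimately show "\<exists>Q V g. openin (D_topology (pullback_dfl X f n U P)) Q \<and> p \<in> Q \<and>
         eopen n V \<and> V \<subseteq> U \<and> fst ` Q \<subseteq> V \<and> plot (pullback_dfl X f n U P) n V g \<and> g \<in> V \<rightarrow> Q \<and>
         (\<forall>r\<in>V. fst (g r) = r) \<and> (\<forall>q\<in>Q. g (fst q) = q)"
        using V1 by blast
    qed
  qed (use f in blast)
qed

text \<open>Injectivity forces every local lift of a plot \<open>P\<close> to be the inverse map
  after \<open>P\<close>, so that composite is locally a plot and hence a plot. Conversely the
  inverse map lifts a plot on its whole domain.\<close>

lemma diffeomorphism_iff:
  assumes Y: "diffeological_space Y"
  shows "diffeomorphism X Y f \<longleftrightarrow> inj_on f (dspace X) \<and> local_subduction X Y f"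
  unfolding local_subduction_iff
proof (intro iffI conjI ballI)
  assume f: "diffeomorphism X Y f"
  then show inj: "inj_on f (dspace X)" and "smooth X Y f" and im: "f ` dspace X = dspace Y"
    by (auto simp: diffeomorphism_def bij_betw_def)
  have g: "smooth Y X (inv_into (dspace X) f)" using f by (simp add: diffeomorphism_def)
  fix x assume x: "x \<in> dspace X"
  show "lifts_at X Y f x"
    unfolding lifts_at_def
  proof (intro allI impI)
    fix n U P r0 assume P: "plot Y n U P" "r0 \<in> U" "P r0 = f x"
    have "\<forall>r\<in>U. f (inv_into (dspace X) f (P r)) = P r"
      using diffeological_space.plot_into[OF Y P(1)] im by (intro ballI f_inv_into_f) (simp add: Pi_iff)
    then show "\<exists>V L. eopen n V \<and> V \<subseteq> U \<and> r0 \<in> V \<and> plot X n V L \<and> L r0 = x \<and> (\<forall>r\<in>V. f (L r) = P r)"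
      using P smooth_plot[OF g P(1)] diffeological_space.plot_open[OF Y P(1)] inj x
      by (intro exI[of _ U] exI[of _ "\<lambda>r. inv_into (dspace X) f (P r)"]) simp
  qed
next
  assume f: "inj_on f (dspace X) \<and> smooth X Y f \<and> f ` dspace X = dspace Y \<and> (\<forall>x\<in>dspace X. lifts_at X Y f x)"
  define g where "g = inv_into (dspace X) f"
  have gX: "g y \<in> dspace X" "f (g y) = y" if "y \<in> dspace Y" for y
    using f that by (auto simp: g_def inv_into_into f_inv_into_f)
  have gf: "g (f x) = x" if "x \<in> dspace X" for x using f that by (simp add: g_def)
  have "smooth Y X g"
    unfolding smooth_def
  proof (intro conjI allI impI)
    show "g \<in> dspace Y \<rightarrow> dspace X" using gX by auto
    fix n U P assume P: "plot Y n U P"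
    note PY = diffeological_space.plot_into[OF Y P]
    show "plot X n U (g \<circ> P)"
    proof (rule plot_local[OF diffeological_space.plot_open[OF Y P]])
      show "g \<circ> P \<in> U \<rightarrow> dspace X" using PY gX(1) by (simp add: Pi_iff)
      fix r assume r: "r \<in> U"
      then have Pr: "P r \<in> dspace Y" using PY by auto
      then have l: "lifts_at X Y f (g (P r))" using f gX by blast
      obtain V L where V: "V \<subseteq> U" "r \<in> V" "plot X n V L" "\<And>r. r \<in> V \<Longrightarrow> f (L r) = P r"
        using lifts_atD[OF l P r] gX(2)[OF Pr] by metis
      have "plot X n V (g \<circ> P)"
      proof (rule plot_cong[OF V(3)])
        fix s assume "s \<in> V"
        then show "(g \<circ> P) s = L s" using gf[of "L s"] V(4) plot_into[OF V(3)] by auto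
      qed
      then show "\<exists>V. V \<subseteq> U \<and> r \<in> V \<and> plot X n V (g \<circ> P)" using V by blast
    qed
  qed
  then show "diffeomorphism X Y f" using f by (simp add: diffeomorphism_def bij_betw_def g_def)
qed

text \<open>The inverse \<open>g\<close> gives the retraction r |-> (r, g (P r)) on all of
  \<open>U\<close>, so no shrinking occurs. The purpose is to place diffeomorphisms among the
  injective immersions.\<close>

lemma diffeomorphism_imp_immersion:
  assumes Y: "diffeological_space Y" and f: "diffeomorphism X Y f"
  shows "diffeological_immersion X Y f"
  unfolding diffeological_immersion_iff retracts_at_def
proof (intro conjI ballI allI impI)
  show "smooth X Y f" using f by (simp add: diffeomorphism_def)
  define g where "g = inv_into (dspace X) f"
  have g: "smooth Y X g" using f by (simp add: diffeomorphism_def g_def)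
  have gf: "g (f x) = x" if "x \<in> dspace X" for x
    using f that by (simp add: g_def diffeomorphism_def bij_betw_def)
  fix x n U P r0 assume x: "x \<in> dspace X" and P: "plot Y n U P" "r0 \<in> U" "P r0 = f x"
  note U = diffeological_space.plot_open[OF Y P(1)]
  have gP: "plot X n U (\<lambda>r. g (P r))" by (rule smooth_plot[OF g P(1)])
  have "smooth (euclid_dfl n U) (prod_dfl (euclid_dfl n U) X) (\<lambda>r. (r, g (P r)))"
    unfolding smooth_def
  proof (intro conjI allI impI)
    show "(\<lambda>r. (r, g (P r))) \<in> dspace (euclid_dfl n U) \<rightarrow> dspace (prod_dfl (euclid_dfl n U) X)"
      using plot_into[OF gP] by auto
    fix m W F assume "plot (euclid_dfl n U) m W F"
    then show "plot (prod_dfl (euclid_dfl n U) X) m W ((\<lambda>r. (r, g (P r))) \<circ> F)"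
      using plot_compose[OF gP, of m W F] by (auto simp: o_def Pi_iff)
  qed
  moreover have "openin (D_topology (pullback_dfl X f n U P)) (dspace (pullback_dfl X f n U P))"
    unfolding openin_D_topology
  proof (intro conjI allI impI)
    fix m W p assume p: "plot (pullback_dfl X f n U P) m W p"
    then have "{r \<in> W. p r \<in> dspace (pullback_dfl X f n U P)} = W"
      using plot_into[of m W "snd \<circ> p"] by (auto simp: plot_pullback Pi_iff)
    then show "eopen m {r \<in> W. p r \<in> dspace (pullback_dfl X f n U P)}"
      using p smooth_euclidD(1) by (auto simp: plot_pullback)
  qed auto
  ultimately show "\<exists>Q V \<rho>. openin (D_topology (pullback_dfl X f n U P)) Q \<and> (r0, x) \<in> Q \<and>
      eopen n V \<and> V \<subseteq> U \<and> fst ` Q \<subseteq> V \<and>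
      smooth (euclid_dfl n V) (prod_dfl (euclid_dfl n U) X) \<rho> \<and> (\<forall>q\<in>Q. \<rho> (fst q) = q)"
    using P x U gf
    by - (rule exI[of _ "dspace (pullback_dfl X f n U P)"], rule exI[of _ U],
        rule exI[of _ "\<lambda>r. (r, g (P r))"], auto)
qed

end

section \<open>Etale charts\<close>

text \<open>All that is used of a diffeological etale map from a Euclidean domain is that plots lift
  through it locally and that the germ of a lift is determined by its value at one point.\<close>

definition etale_chart :: "'a diffeology \<Rightarrow> nat \<Rightarrow> (nat \<Rightarrow> real) set \<Rightarrow> ((nat \<Rightarrow> real) \<Rightarrow> 'a) \<Rightarrow> bool" where
  "etale_chart X n U \<phi> \<longleftrightarrow> plot X n U \<phi> \<and>
     (\<forall>m V P r0 u0. plot X m V P \<longrightarrow> r0 \<in> V \<longrightarrow> u0 \<in> U \<longrightarrow> P r0 = \<phi> u0 \<longrightarrow>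
        (\<exists>V' L. r0 \<in> V' \<and> V' \<subseteq> V \<and> smooth_euclid m V' n L \<and> L \<in> V' \<rightarrow> U \<and> L r0 = u0 \<and>
           (\<forall>r\<in>V'. \<phi> (L r) = P r))) \<and>
     (\<forall>m V L L' r0. smooth_euclid m V n L \<longrightarrow> smooth_euclid m V n L' \<longrightarrow> L \<in> V \<rightarrow> U \<longrightarrow> L' \<in> V \<rightarrow> U \<longrightarrow>
        (\<forall>r\<in>V. \<phi> (L r) = \<phi> (L' r)) \<longrightarrow> r0 \<in> V \<longrightarrow> L r0 = L' r0 \<longrightarrow>
        (\<exists>V'. eopen m V' \<and> r0 \<in> V' \<and> V' \<subseteq> V \<and> (\<forall>r\<in>V'. L r = L' r)))"

lemma etale_chart_plot: "etale_chart X n U \<phi> \<Longrightarrow> plot X n U \<phi>"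
  by (simp add: etale_chart_def)

lemma etale_chart_lift:
  assumes "etale_chart X n U \<phi>" "plot X m V P" "r0 \<in> V" "u0 \<in> U" "P r0 = \<phi> u0"
  obtains V' L where "r0 \<in> V'" "V' \<subseteq> V" "smooth_euclid m V' n L" "\<And>r. r \<in> V' \<Longrightarrow> L r \<in> U" "L r0 = u0"
    "\<And>r. r \<in> V' \<Longrightarrow> \<phi> (L r) = P r"
proof -
  note * = assms(1)[unfolded etale_chart_def, THEN conjunct2, THEN conjunct1, rule_format, OF assms(2-5)]
  show ?thesis using * that by (elim exE conjE) (simp add: Pi_iff)
qed

lemma etale_chart_unique:
  assumes "etale_chart X n U \<phi>" "smooth_euclid m V n L" "smooth_euclid m V n L'"
    "\<And>r. r \<in> V \<Longrightarrow> L r \<in> U" "\<And>r. r \<in> V \<Longrightarrow> L' r \<in> U" "\<And>r. r \<in> V \<Longrightarrow> \<phi> (L r) = \<phi> (L' r)"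
    "r0 \<in> V" "L r0 = L' r0"
  obtains V' where "eopen m V'" "r0 \<in> V'" "V' \<subseteq> V" "\<And>r. r \<in> V' \<Longrightarrow> L r = L' r"
proof -
  have "L \<in> V \<rightarrow> U" "L' \<in> V \<rightarrow> U" using assms(4,5) by auto
  note * = assms(1)[unfolded etale_chart_def, THEN conjunct2, THEN conjunct2, rule_format,
      OF assms(2,3) this assms(6) assms(7,8)]
  show ?thesis using * that by blast
qed

lemma diffeological_space_euclid:
  assumes U: "eopen n U"
  shows "diffeological_space (euclid_dfl n U)"
proof
  fix m V P
  assume "plot (euclid_dfl n U) m V P"
  then show "eopen m V" "P \<in> V \<rightarrow> dspace (euclid_dfl n U)" by (auto dest: smooth_euclidD(1))
next
  fix m V P Q
  assume "plot (euclid_dfl n U) m V P" "\<And>r. r \<in> V \<Longrightarrow> Q r = P r"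
  then show "plot (euclid_dfl n U) m V Q" using smooth_euclid_cong[of m V n P Q] by (simp add: Pi_iff)
next
  fix m V x
  assume "eopen m V" "x \<in> dspace (euclid_dfl n U)"
  then show "plot (euclid_dfl n U) m V (\<lambda>_. x)" using eopen_subset[OF U] by (simp add: smooth_euclid_const)
next
  fix m V P
  assume V: "eopen m V" and P: "P \<in> V \<rightarrow> dspace (euclid_dfl n U)"
    and loc: "\<And>r. r \<in> V \<Longrightarrow> \<exists>W. W \<subseteq> V \<and> r \<in> W \<and> plot (euclid_dfl n U) m W P"
  have "smooth_euclid m V n P"
  proof (rule smooth_euclidI[OF V])
    show "P r \<in> topspace (Euclidean_space n)" if "r \<in> V" for r
      using P that eopen_subset[OF U] by (simp add: Pi_iff)
    fix j k
    show "C_diff m k V (\<lambda>r. P r j)"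
    proof (rule C_diff_local[OF V])
      fix r assume "r \<in> V"
      then obtain W where W: "W \<subseteq> V" "r \<in> W" "plot (euclid_dfl n U) m W P" using loc by blast
      then have sm: "smooth_euclid m W n P" by simp
      show "\<exists>W. eopen m W \<and> r \<in> W \<and> W \<subseteq> V \<and> C_diff m k W (\<lambda>r. P r j)"
        by (rule exI[of _ W]) (simp add: W(1,2) smooth_euclidD(1)[OF sm] smooth_euclidD(3)[OF sm])
    qed
  qed
  then show "plot (euclid_dfl n U) m V P" using P by simp
next
  fix m V P l W F
  assume "plot (euclid_dfl n U) m V P" "smooth_euclid l W m F" "F \<in> W \<rightarrow> V"
  then show "plot (euclid_dfl n U) l W (P \<circ> F)"
    using smooth_euclid_compose[of m V n P l W F] by (simp add: o_def Pi_iff)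
qed

text \<open>The second component of a local inverse of the pullback projection is the lift. For
  uniqueness, the graphs of \<open>L\<close> and \<open>L'\<close> are plots of one pullback that
  meet at \<open>r0\<close>; both stay, near \<open>r0\<close>, in a D-open set whose points are
  determined by their first entry.\<close>

lemma diffeological_etale_imp_etale_chart:
  assumes X: "diffeological_space X" and U: "eopen n U" and \<phi>: "diffeological_etale (euclid_dfl n U) X \<phi>"
  shows "etale_chart X n U \<phi>"
proof -
  interpret E: diffeological_space "euclid_dfl n U" by (rule diffeological_space_euclid[OF U])
  have sm: "smooth (euclid_dfl n U) X \<phi>" using \<phi> by (simp add: diffeological_etale_def)
  have key: "\<exists>Q W g. openin (D_topology (pullback_dfl (euclid_dfl n U) \<phi> m V P)) Q \<and> (r0, u0) \<in> Q \<and>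
       eopen m W \<and> W \<subseteq> V \<and> fst ` Q \<subseteq> W \<and> plot (pullback_dfl (euclid_dfl n U) \<phi> m V P) m W g \<and> g \<in> W \<rightarrow> Q \<and>
       (\<forall>r\<in>W. fst (g r) = r) \<and> (\<forall>q\<in>Q. g (fst q) = q)"
    if P: "plot X m V P" "r0 \<in> V" "u0 \<in> U" "P r0 = \<phi> u0" for m V P r0 u0
  proof -
    have et: "etale (pullback_dfl (euclid_dfl n U) \<phi> m V P) (euclid_dfl m V) fst"
      using \<phi> P(1) by (simp add: diffeological_etale_def)
    have V: "eopen m V" using diffeological_space.plot_open[OF X P(1)] .
    have "(r0, u0) \<in> dspace (pullback_dfl (euclid_dfl n U) \<phi> m V P)" using P by simp
    with et[unfolded E.etale_pullback_iff[OF V]] show ?thesis by (rule bspec)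
  qed
  show ?thesis
    unfolding etale_chart_def
  proof (intro conjI allI impI)
    show "plot X n U \<phi>"
      using smooth_plot[OF sm, of n U "\<lambda>r. r"] smooth_euclid_ident[OF U] by simp
  next
    fix m V P r0 u0
    assume P: "plot X m V P" "r0 \<in> V" "u0 \<in> U" "P r0 = \<phi> u0"
    obtain Q W g where Q: "(r0, u0) \<in> Q" "W \<subseteq> V" "fst ` Q \<subseteq> W"
      "plot (pullback_dfl (euclid_dfl n U) \<phi> m V P) m W g" "\<forall>r\<in>W. fst (g r) = r" "\<forall>q\<in>Q. g (fst q) = q"
      using key[OF P] by (elim exE conjE) (rule that; assumption)
    have g: "smooth_euclid m W n (snd \<circ> g)" "snd \<circ> g \<in> W \<rightarrow> U" "\<forall>r\<in>W. P (fst (g r)) = \<phi> (snd (g r))"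
      using Q(4) by (simp_all add: E.plot_pullback)
    have "r0 \<in> W" "snd (g r0) = u0" using Q(1,3) Q(6)[rule_format, OF Q(1)] by auto
    then show "\<exists>V' L. r0 \<in> V' \<and> V' \<subseteq> V \<and> smooth_euclid m V' n L \<and> L \<in> V' \<rightarrow> U \<and> L r0 = u0 \<and>
           (\<forall>r\<in>V'. \<phi> (L r) = P r)"
      using Q(2,5) g by - (rule exI[of _ W], rule exI[of _ "snd \<circ> g"], simp)
  next
    fix m V L L' r0
    assume L: "smooth_euclid m V n L" "smooth_euclid m V n L'" "L \<in> V \<rightarrow> U" "L' \<in> V \<rightarrow> U"
      "\<forall>r\<in>V. \<phi> (L r) = \<phi> (L' r)" "r0 \<in> V" "L r0 = L' r0"
    define P where "P = (\<lambda>r. \<phi> (L r))"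
    have P: "plot X m V P" unfolding P_def by (rule smooth_plot[OF sm]) (use L in simp)
    have gr: "plot (pullback_dfl (euclid_dfl n U) \<phi> m V P) m V (\<lambda>r. (r, L r))"
      by (rule E.plot_graph) (use L in \<open>simp_all add: P_def\<close>)
    have gr': "plot (pullback_dfl (euclid_dfl n U) \<phi> m V P) m V (\<lambda>r. (r, L' r))"
      by (rule E.plot_graph) (use L in \<open>simp_all add: P_def\<close>)
    have "L r0 \<in> U" using L by auto
    obtain Q W g where Q: "openin (D_topology (pullback_dfl (euclid_dfl n U) \<phi> m V P)) Q"
      "(r0, L r0) \<in> Q" "\<forall>q\<in>Q. g (fst q) = q"
    proof -
      have "P r0 = \<phi> (L r0)" by (simp add: P_def)
      from key[OF P L(6) \<open>L r0 \<in> U\<close> this] show ?thesis by (elim exE conjE) (rule that; assumption)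
    qed
    define W where "W = {r \<in> V. (r, L r) \<in> Q} \<inter> {r \<in> V. (r, L' r) \<in> Q}"
    have "eopen m W"
      unfolding W_def by (intro openin_Int openin_D_preimage[OF Q(1) gr] openin_D_preimage[OF Q(1) gr'])
    moreover have "r0 \<in> W" unfolding W_def using L(6,7) Q(2) by simp
    moreover have "W \<subseteq> V" unfolding W_def by (rule le_infI1) (rule Collect_subset)
    moreover have "\<forall>r\<in>W. L r = L' r"
    proof
      fix r assume r: "r \<in> W"
      have "(r, L r) \<in> Q" "(r, L' r) \<in> Q" using r unfolding W_def by blast+
      from Q(3)[rule_format, OF this(1)] Q(3)[rule_format, OF this(2)]
      show "L r = L' r" by (simp only: fst_conv prod.inject)
    qed
    ultimately show "\<exists>V'. eopen m V' \<and> r0 \<in> V' \<and> V' \<subseteq> V \<and> (\<forall>r\<in>V'. L r = L' r)"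
      by (iprover intro: exI conjI)
  qed
qed

lemma etale_manifold_chart:
  assumes "diffeological_etale_n_manifold n M" "x \<in> dspace M"
  obtains U \<phi> u where "etale_chart M n U \<phi>" "u \<in> U" "\<phi> u = x"
proof -
  obtain \<F> :: "((nat \<Rightarrow> real) set \<times> ((nat \<Rightarrow> real) \<Rightarrow> 'a)) set" where M: "diffeological_space M"
    and F: "\<forall>(U, \<phi>)\<in>\<F>. eopen n U \<and> diffeological_etale (euclid_dfl n U) M \<phi>"
    and cov: "(\<Union>(U, \<phi>)\<in>\<F>. \<phi> ` U) = dspace M"
    using assms(1) unfolding diffeological_etale_n_manifold_def by (elim exE conjE) (rule that; assumption)
  from assms(2) obtain U \<phi> u where U: "(U, \<phi>) \<in> \<F>" "u \<in> U" "\<phi> u = x"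
    unfolding cov[symmetric] by auto
  have "eopen n U \<and> diffeological_etale (euclid_dfl n U) M \<phi>"
    using bspec[OF F U(1)] by simp
  then have "etale_chart M n U \<phi>"
    using diffeological_etale_imp_etale_chart[OF M] by simp
  then show ?thesis using that U(2,3) by simp
qed

context diffeological_space
begin

lemma etale_chart_open: "etale_chart X n U \<phi> \<Longrightarrow> eopen n U"
  using plot_open etale_chart_plot by blast

lemma etale_chart_into: "etale_chart X n U \<phi> \<Longrightarrow> u \<in> U \<Longrightarrow> \<phi> u \<in> dspace X"
  using plot_into[OF etale_chart_plot] by auto

text \<open>A plot that meets the image lifts near that parameter into \<open>U\<close>, and
  continuity of the lift keeps it in \<open>A\<close>. Chart neighbourhoods can therefore serve as
  D-open covers of the compact space.\<close>

lemma openin_etale_chart_image: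
  assumes \<phi>: "etale_chart X n U \<phi>" and A: "eopen n A" "A \<subseteq> U"
  shows "openin (D_topology X) (\<phi> ` A)"
proof (rule openin_DI)
  show "\<phi> ` A \<subseteq> dspace X" using etale_chart_into[OF \<phi>] A by auto
  fix m V P r assume P: "plot X m V P" "r \<in> V" "P r \<in> \<phi> ` A"
  then obtain u where u: "u \<in> A" "P r = \<phi> u" by blast
  then have uU: "u \<in> U" using A by auto
  obtain V' L where L: "r \<in> V'" "V' \<subseteq> V" "smooth_euclid m V' n L" "L r = u" "\<And>r. r \<in> V' \<Longrightarrow> \<phi> (L r) = P r"
    using etale_chart_lift[OF \<phi> P(1,2) uU u(2)] by metis
  show "\<exists>V'. eopen m V' \<and> r \<in> V' \<and> V' \<subseteq> V \<and> (\<forall>s\<in>V'. P s \<in> \<phi> ` A)"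
  proof (intro exI[of _ "{s \<in> V'. L s \<in> A}"] conjI ballI)
    show "eopen m {s \<in> V'. L s \<in> A}" by (rule eopen_preimage[OF L(3) A(1)])
    fix s assume "s \<in> {s \<in> V'. L s \<in> A}"
    then have "P s = \<phi> (L s)" "L s \<in> A" using L(5) by auto
    then show "P s \<in> \<phi> ` A" by (rule image_eqI)
  qed (use L u in auto)
qed

end

section \<open>Product coordinates\<close>

definition etake :: "nat \<Rightarrow> (nat \<Rightarrow> real) \<Rightarrow> nat \<Rightarrow> real" where
  "etake m z = (\<lambda>i. if i < m then z i else 0)"

definition edrop :: "nat \<Rightarrow> (nat \<Rightarrow> real) \<Rightarrow> nat \<Rightarrow> real" where
  "edrop m z = (\<lambda>i. z (i + m))"

text \<open>The point (w, u) of R^(m+k). Entries of \<open>u\<close> are shifted by \<open>m\<close>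
  and entries of \<open>w\<close> from \<open>m\<close> on are discarded, which is why
  \<open>etake_ejoin\<close> asks that \<open>w\<close> vanish there.\<close>

definition ejoin :: "nat \<Rightarrow> (nat \<Rightarrow> real) \<Rightarrow> (nat \<Rightarrow> real) \<Rightarrow> nat \<Rightarrow> real" where
  "ejoin m w u = (\<lambda>i. if i < m then w i else u (i - m))"

lemma etake_ejoin: "w \<in> topspace (Euclidean_space m) \<Longrightarrow> etake m (ejoin m w u) = w"
  by (auto simp: etake_def ejoin_def Euclid_iff fun_eq_iff)

lemma edrop_ejoin [simp]: "edrop m (ejoin m w u) = u"
  by (simp add: edrop_def ejoin_def)

lemma ejoin_etake_edrop [simp]: "ejoin m (etake m z) (edrop m z) = z"
  by (auto simp: etake_def edrop_def ejoin_def)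

lemma etake_ejoin_etake [simp]: "etake m (ejoin m (etake m z) u) = etake m z"
  by (auto simp: etake_def ejoin_def fun_eq_iff)

lemma ejoin_Euclid:
  "w \<in> topspace (Euclidean_space m) \<Longrightarrow> u \<in> topspace (Euclidean_space k) \<Longrightarrow>
    ejoin m w u \<in> topspace (Euclidean_space (m + k))"
  by (auto simp: Euclid_iff ejoin_def)

lemma etake_smooth: "eopen d U \<Longrightarrow> smooth_euclid d U m (etake m)"
  by (rule smooth_euclidI) (auto simp: etake_def Euclid_iff C_diff_proj)

lemma edrop_smooth: "eopen (m + k) U \<Longrightarrow> smooth_euclid (m + k) U k (edrop m)"
  using eopen_subset[of "m + k" U]
  by (intro smooth_euclidI) (auto simp: edrop_def Euclid_iff C_diff_proj)

lemma ejoin_smooth: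
  assumes "smooth_euclid p V m F" "smooth_euclid p V k G"
  shows "smooth_euclid p V (m + k) (\<lambda>x. ejoin m (F x) (G x))"
proof (rule smooth_euclidI[OF smooth_euclidD(1)[OF assms(1)]])
  show "ejoin m (F x) (G x) \<in> topspace (Euclidean_space (m + k))" if "x \<in> V" for x
    using smooth_euclidD(2)[OF assms(1) that] smooth_euclidD(2)[OF assms(2) that] by (rule ejoin_Euclid)
  show "C_diff p l V (\<lambda>x. ejoin m (F x) (G x) j)" for j l
    using smooth_euclidD(3)[OF assms(1)] smooth_euclidD(3)[OF assms(2)]
    by (cases "j < m") (simp_all add: ejoin_def)
qed

text \<open>Serves to form u - u0 + s v; all three points vanish from \<open>k\<close> on, so the
  result does too.\<close>

lemma smooth_euclid_translate:
  assumes "smooth_euclid p V k F" "smooth_euclid p V k G" "c \<in> topspace (Euclidean_space k)"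
  shows "smooth_euclid p V k (\<lambda>x i. F x i - c i + G x i)"
proof (rule smooth_euclidI[OF smooth_euclidD(1)[OF assms(1)]])
  show "(\<lambda>i. F x i - c i + G x i) \<in> topspace (Euclidean_space k)" if "x \<in> V" for x
    using smooth_euclidD(2)[OF assms(1) that] smooth_euclidD(2)[OF assms(2) that] assms(3)
    by (simp add: Euclid_iff)
  show "C_diff p l V (\<lambda>x. F x j - c j + G x j)" for j l
    using smooth_euclidD(1)[OF assms(1)]
    by (intro C_diff_add C_diff_diff C_diff_const smooth_euclidD(3)[OF assms(1)] smooth_euclidD(3)[OF assms(2)])
qed

lemma eopen_ejoin_nbhd:
  assumes A: "eopen (m + k) A" "ejoin m w0 u0 \<in> A"
    and E: "w0 \<in> topspace (Euclidean_space m)" "u0 \<in> topspace (Euclidean_space k)"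
  obtains W U where "eopen m W" "w0 \<in> W" "eopen k U" "u0 \<in> U" "\<And>w u. w \<in> W \<Longrightarrow> u \<in> U \<Longrightarrow> ejoin m w u \<in> A"
proof -
  obtain e where e: "e > 0" "cube (m + k) (ejoin m w0 u0) e \<subseteq> A" by (rule eopen_contains_cube[OF A]) (assumption | rule that)+
  have "ejoin m w u \<in> A" if "w \<in> cube m w0 e" "u \<in> cube k u0 e" for w u
  proof -
    have "ejoin m w u \<in> cube (m + k) (ejoin m w0 u0) e"
      using that ejoin_Euclid[of w m u k] by (auto simp: cube_def ejoin_def)
    then show ?thesis using e(2) by blast
  qed
  then show ?thesis
    by (intro that[of "cube m w0 e" "cube k u0 e"] eopen_cube cube_center E e(1))
qed

section \<open>Stability of lifting and retraction\<close>

text \<open>A plot is lifted through \<psi> with value \<open>v\<close> at \<open>r0\<close> and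
  then carried along \<sigma> and \<phi>. A section near \<open>v\<close> is enough, because the
  lift can be restricted to the preimage of \<open>Z\<close>.\<close>

lemma lifts_at_of_chart_section:
  assumes K: "diffeological_space K" and M: "diffeological_space M"
    and \<phi>: "etale_chart K k U \<phi>" and \<psi>: "etale_chart M n V \<psi>"
    and \<sigma>: "smooth_euclid n Z k \<sigma>" "v \<in> Z" "\<sigma> v = u"
      "\<And>z. z \<in> Z \<Longrightarrow> z \<in> V \<and> \<sigma> z \<in> U \<and> f (\<phi> (\<sigma> z)) = \<psi> z"
  shows "lifts_at K M f (\<phi> u)"
  unfolding lifts_at_def
proof (intro allI impI)
  fix l R P r0 assume P: "plot M l R P" "r0 \<in> R" "P r0 = f (\<phi> u)"
  have v: "v \<in> V" "P r0 = \<psi> v" using \<sigma>(4)[OF \<sigma>(2)] \<sigma>(3) P(3) by simp_all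
  obtain R1 L where L: "r0 \<in> R1" "R1 \<subseteq> R" "smooth_euclid l R1 n L" "\<And>r. r \<in> R1 \<Longrightarrow> L r \<in> V" "L r0 = v"
    "\<And>r. r \<in> R1 \<Longrightarrow> \<psi> (L r) = P r"
    by (rule etale_chart_lift[OF \<psi> P(1), OF P(2) v]) (assumption | rule that)+
  define R2 where "R2 = {r \<in> R1. L r \<in> Z}"
  have R2: "eopen l R2" "R2 \<subseteq> R1" "r0 \<in> R2"
    using eopen_preimage[OF L(3) smooth_euclidD(1)[OF \<sigma>(1)]] L(1,5) \<sigma>(2) by (auto simp: R2_def)
  have sL: "smooth_euclid l R2 k (\<lambda>r. \<sigma> (L r))"
    by (rule smooth_euclid_compose[OF \<sigma>(1) smooth_euclid_mono[OF L(3) R2(1,2)]]) (simp add: R2_def)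
  have "plot K l R2 (\<lambda>r. \<phi> (\<sigma> (L r)))"
    by (rule diffeological_space.plot_compose[OF K etale_chart_plot[OF \<phi>] sL])
      (use \<sigma>(4) in \<open>simp add: R2_def\<close>)
  moreover have "\<forall>r\<in>R2. f (\<phi> (\<sigma> (L r))) = P r"
    using \<sigma>(4) L(6) by (simp add: R2_def)
  moreover have "\<phi> (\<sigma> (L r0)) = \<phi> u" using L(5) \<sigma>(3) by simp
  ultimately show "\<exists>V L. eopen l V \<and> V \<subseteq> R \<and> r0 \<in> V \<and> plot K l V L \<and> L r0 = \<phi> u \<and> (\<forall>r\<in>V. f (L r) = P r)"
    using R2 L(2) by - (rule exI[of _ R2], rule exI[of _ "\<lambda>r. \<phi> (\<sigma> (L r))"], simp)
qed

text \<open>A pullback point near (r0, \<phi> u) is recovered from its parameter by lifting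
  \<open>P\<close> to \<open>L\<close> and applying \<open>g\<close> and then \<phi>. Since \<phi>
  and \<psi> need not be injective, the D-open set has to record which branches of the lifts are
  meant.\<close>

lemma retracts_at_of_chart_retraction:
  assumes K: "diffeological_space K" and M: "diffeological_space M"
    and \<phi>: "etale_chart K k U \<phi>" and \<psi>: "etale_chart M n V \<psi>"
    and U': "U' \<subseteq> U" and F: "smooth_euclid k U' n F" and g: "smooth_euclid n V' k g"
    and FV: "\<And>u. u \<in> U' \<Longrightarrow> F u \<in> V" "\<And>u. u \<in> U' \<Longrightarrow> F u \<in> V'" 
    and fF: "\<And>u. u \<in> U' \<Longrightarrow> \<psi> (F u) = f (\<phi> u)" and gF: "\<And>u. u \<in> U' \<Longrightarrow> g (F u) = u"
    and gU: "\<And>v. v \<in> V' \<Longrightarrow> g v \<in> U'" and u: "u \<in> U'"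
  shows "retracts_at K M f (\<phi> u)"
  unfolding retracts_at_def
proof (intro allI impI)
  fix l R P r0 assume P: "plot M l R P" "r0 \<in> R" "P r0 = f (\<phi> u)"
  interpret K: diffeological_space K by (rule K)
  interpret M: diffeological_space M by (rule M)
  let ?X = "pullback_dfl K f l R P"
  obtain R1 L where L: "r0 \<in> R1" "R1 \<subseteq> R" "smooth_euclid l R1 n L" "\<And>r. r \<in> R1 \<Longrightarrow> L r \<in> V" "L r0 = F u"
    "\<And>r. r \<in> R1 \<Longrightarrow> \<psi> (L r) = P r"
    by (rule etale_chart_lift[OF \<psi> P(1), OF P(2) FV(1)[OF u] P(3)[folded fF[OF u]]]) (assumption | rule that)+
  define R2 where "R2 = {r \<in> R1. L r \<in> V'}"
  have R2: "eopen l R2" "R2 \<subseteq> R1" "R2 \<subseteq> R" "r0 \<in> R2"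
    using eopen_preimage[OF L(3) smooth_euclidD(1)[OF g]] L(1,2,5) FV(2)[OF u] by (auto simp: R2_def)
  have L2: "smooth_euclid l R2 n L" by (rule smooth_euclid_mono[OF L(3) R2(1,2)])
  have gL: "smooth_euclid l R2 k (\<lambda>r. g (L r))"
    by (rule smooth_euclid_compose[OF g L2]) (simp add: R2_def)
  have gLU: "g (L r) \<in> U" if "r \<in> R2" for r using gU[of "L r"] that U' by (auto simp: R2_def)
  have pl: "plot K l R2 (\<lambda>r. \<phi> (g (L r)))"
    by (rule K.plot_compose[OF etale_chart_plot[OF \<phi>] gL gLU])
  \<comment> \<open>For a chart point \<open>u\<close> in \<open>U'\<close> over \<open>x\<close>,
    equality of \<open>F u\<close> and \<open>L r\<close> after applying \<psi> is automatic.
    Equality before applying it is the real condition, and it lets \<open>g\<close> recover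
    \<open>u\<close> from \<open>L r\<close>.\<close>
  define Q where "Q = {q \<in> dspace ?X. fst q \<in> R2 \<and> (\<exists>u\<in>U'. \<phi> u = snd q \<and> F u = L (fst q))}"
  have "openin (D_topology ?X) Q"
  proof (rule openin_DI)
    show "Q \<subseteq> dspace ?X" unfolding Q_def by (rule Collect_subset[of "dspace ?X", folded Collect_conj_eq])
    fix j Z q z0 assume q: "plot ?X j Z q" "z0 \<in> Z" "q z0 \<in> Q"
    have q': "smooth_euclid j Z l (\<lambda>z. fst (q z))" "plot K j Z (\<lambda>z. snd (q z))"
      "\<And>z. z \<in> Z \<Longrightarrow> fst (q z) \<in> R \<and> P (fst (q z)) = f (snd (q z))"
      using q(1) by (simp_all add: K.plot_pullback o_def)
    obtain u' where u': "u' \<in> U'" "snd (q z0) = \<phi> u'" "F u' = L (fst (q z0))" and z0R: "fst (q z0) \<in> R2"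
      using q(3) unfolding Q_def by auto
    have u'U: "u' \<in> U" using u'(1) U' by blast
    obtain Z1 b where b: "z0 \<in> Z1" "Z1 \<subseteq> Z" "smooth_euclid j Z1 k b" "\<And>z. z \<in> Z1 \<Longrightarrow> b z \<in> U" "b z0 = u'"
      "\<And>z. z \<in> Z1 \<Longrightarrow> \<phi> (b z) = snd (q z)"
      by (rule etale_chart_lift[OF \<phi> q'(2), OF q(2) u'U u'(2)]) (assumption | rule that)+
    define Z2 where "Z2 = {z \<in> Z1. b z \<in> U'} \<inter> {z \<in> Z. fst (q z) \<in> R2}"
    have Z2: "eopen j Z2"
      unfolding Z2_def
      by (intro openin_Int eopen_preimage[OF b(3)] eopen_preimage[OF q'(1)] R2(1) smooth_euclidD(1)[OF F])
    have Z2D: "z \<in> Z1" "z \<in> Z" "b z \<in> U'" "fst (q z) \<in> R2" if "z \<in> Z2" for z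
      using that by (simp_all add: Z2_def)
    have Z2s: "Z2 \<subseteq> Z1" "Z2 \<subseteq> Z" using Z2D by blast+
    have z0: "z0 \<in> Z2" using b(1,5) q(2) u'(1) z0R by (simp add: Z2_def)
    have s1: "smooth_euclid j Z2 n (\<lambda>z. F (b z))"
      by (rule smooth_euclid_compose[OF F smooth_euclid_mono[OF b(3) Z2 Z2s(1)], OF Z2D(3)])
    have s2: "smooth_euclid j Z2 n (\<lambda>z. L (fst (q z)))"
      by (rule smooth_euclid_compose[OF L2 smooth_euclid_mono[OF q'(1) Z2 Z2s(2)], OF Z2D(4)])
    have e: "\<psi> (F (b z)) = \<psi> (L (fst (q z)))" if "z \<in> Z2" for z
      using fF[OF Z2D(3)[OF that]] b(6)[OF Z2D(1)[OF that]] q'(3)[OF Z2D(2)[OF that]] L(6)[of "fst (q z)"]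
        Z2D(4)[OF that] R2(2) by auto
    have LV: "L (fst (q z)) \<in> V" if "z \<in> Z2" for z using L(4) Z2D(4)[OF that] R2(2) by blast
    have e0: "F (b z0) = L (fst (q z0))" using b(5) u'(3) by simp
    \<comment> \<open>Along \<open>q\<close>, the maps built from \<open>F\<close> and from
      \<open>L\<close> lift the same plot of \<open>M\<close> through \<psi> and agree at
      \<open>z0\<close>; uniqueness of germs makes them agree nearby, which is the openness of
      \<open>Q\<close>.\<close>
    obtain Z3 where Z3: "eopen j Z3" "z0 \<in> Z3" "Z3 \<subseteq> Z2" "\<And>z. z \<in> Z3 \<Longrightarrow> F (b z) = L (fst (q z))"
      by (rule etale_chart_unique[OF \<psi> s1 s2, OF FV(1)[OF Z2D(3)] LV e z0 e0]) (assumption | rule that)+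
    have "q z \<in> Q" if z3: "z \<in> Z3" for z
    proof -
      have z: "z \<in> Z2" using z3 Z3(3) by blast
      have "snd (q z) \<in> dspace K" using K.plot_into[OF q'(2)] Z2D(2)[OF z] by auto
      then show ?thesis
        using Z2D[OF z] q'(3)[OF Z2D(2)[OF z]] b(6)[OF Z2D(1)[OF z]] Z3(4)[OF z3]
        by (auto simp: Q_def)
    qed
    then show "\<exists>V. eopen j V \<and> z0 \<in> V \<and> V \<subseteq> Z \<and> (\<forall>s\<in>V. q s \<in> Q)"
      using Z3(1-3) Z2s(2) by (intro exI[of _ Z3]) blast
  qed
  moreover have "(r0, \<phi> u) \<in> Q"
    using P u U' R2(4) L(5) etale_chart_plot[OF \<phi>] K.plot_into[of k U \<phi>] by (auto simp: Q_def)
  moreover have "smooth (euclid_dfl l R2) (prod_dfl (euclid_dfl l R) K) (\<lambda>r. (r, \<phi> (g (L r))))"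
    unfolding smooth_def
  proof (intro conjI allI impI)
    show "(\<lambda>r. (r, \<phi> (g (L r)))) \<in> dspace (euclid_dfl l R2) \<rightarrow> dspace (prod_dfl (euclid_dfl l R) K)"
      using K.plot_into[OF pl] R2(3) by auto
    fix j Z G assume "plot (euclid_dfl l R2) j Z G"
    then show "plot (prod_dfl (euclid_dfl l R) K) j Z ((\<lambda>r. (r, \<phi> (g (L r)))) \<circ> G)"
      using K.plot_compose[OF pl, of j Z G] R2(3) by (auto simp: o_def Pi_iff)
  qed
  moreover have "\<forall>q\<in>Q. (fst q, \<phi> (g (L (fst q)))) = q"
  proof
    fix q assume "q \<in> Q"
    then obtain u where "u \<in> U'" "\<phi> u = snd q" "F u = L (fst q)" unfolding Q_def by auto
    then have "\<phi> (g (L (fst q))) = snd q" using gF[of u] by metis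
    then show "(fst q, \<phi> (g (L (fst q)))) = q" by (simp add: prod_eq_iff)
  qed
  moreover have "fst ` Q \<subseteq> R2" by (auto simp: Q_def)
  ultimately show "\<exists>Q V \<rho>. openin (D_topology ?X) Q \<and> (r0, \<phi> u) \<in> Q \<and> eopen l V \<and> V \<subseteq> R \<and> fst ` Q \<subseteq> V \<and>
        smooth (euclid_dfl l V) (prod_dfl (euclid_dfl l R) K) \<rho> \<and> (\<forall>q\<in>Q. \<rho> (fst q) = q)"
    using R2(1,3) by - (rule exI[of _ Q], rule exI[of _ R2], rule exI[of _ "\<lambda>r. (r, \<phi> (g (L r)))"], simp)
qed

section \<open>Smooth families of maps read in charts\<close>

locale chart_family = K: diffeological_space K + M: diffeological_space M
  for K :: "'a diffeology" and M :: "'b diffeology" +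
  fixes m W p k U \<phi> n V \<psi> w0 u0 v0
  assumes p: "plot (functional_dfl K M) m W p"
    and \<phi>: "etale_chart K k U \<phi>" and \<psi>: "etale_chart M n V \<psi>"
    and w0: "w0 \<in> W" and u0: "u0 \<in> U" and v0: "v0 \<in> V" and base: "p w0 (\<phi> u0) = \<psi> v0"
begin

lemma W: "eopen m W" and p_smooth: "smooth (prod_dfl (euclid_dfl m W) K) M (\<lambda>(w, x). p w x)"
  using p by (simp_all add: functional_dfl_def)

lemmas U = K.etale_chart_open[OF \<phi>] and V = M.etale_chart_open[OF \<psi>]

lemma w0_E: "w0 \<in> topspace (Euclidean_space m)" and u0_E: "u0 \<in> topspace (Euclidean_space k)"
  and v0_E: "v0 \<in> topspace (Euclidean_space n)"
  using eopen_subset[OF W w0] eopen_subset[OF U u0] eopen_subset[OF V v0] .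

text \<open>By the definition of the functional diffeology, (w, u) |-> p w (\<phi> u) is a plot of
  \<open>M\<close> in \<open>m + k\<close> joint coordinates; \<open>F\<close> is its lift through
  \<psi> with prescribed value \<open>v0\<close>.\<close>

lemma family_lift:
  obtains A F where "eopen (m + k) A" "ejoin m w0 u0 \<in> A" "smooth_euclid (m + k) A n F"
    "\<And>z. z \<in> A \<Longrightarrow> F z \<in> V" "F (ejoin m w0 u0) = v0"
    "\<And>z. z \<in> A \<Longrightarrow> etake m z \<in> W" "\<And>z. z \<in> A \<Longrightarrow> edrop m z \<in> U"
    "\<And>z. z \<in> A \<Longrightarrow> \<psi> (F z) = p (etake m z) (\<phi> (edrop m z))"
proof -
  let ?E = "topspace (Euclidean_space (m + k))"
  have E: "eopen (m + k) ?E" by simp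
  define A0 where "A0 = {z \<in> ?E. etake m z \<in> W} \<inter> {z \<in> ?E. edrop m z \<in> U}"
  have A0: "eopen (m + k) A0" unfolding A0_def
    by (intro openin_Int eopen_preimage[OF etake_smooth[OF E] W] eopen_preimage[OF edrop_smooth[OF E] U])
  have A0D: "etake m z \<in> W" "edrop m z \<in> U" if "z \<in> A0" for z using that by (simp_all add: A0_def)
  have a: "ejoin m w0 u0 \<in> A0" 
    using ejoin_Euclid[OF w0_E u0_E] w0 u0 by (simp add: A0_def etake_ejoin[OF w0_E])
  have "plot K (m + k) A0 (\<lambda>z. \<phi> (edrop m z))"
    by (rule K.plot_compose[OF etale_chart_plot[OF \<phi>] edrop_smooth[OF A0] A0D(2)])
  then have "plot (prod_dfl (euclid_dfl m W) K) (m + k) A0 (\<lambda>z. (etake m z, \<phi> (edrop m z)))"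
    using etake_smooth[OF A0] A0D(1) by (simp add: o_def Pi_iff)
  from smooth_plot[OF p_smooth this]
  have pl: "plot M (m + k) A0 (\<lambda>z. p (etake m z) (\<phi> (edrop m z)))" by simp
  have b: "p (etake m (ejoin m w0 u0)) (\<phi> (edrop m (ejoin m w0 u0))) = \<psi> v0"
    by (simp add: etake_ejoin[OF w0_E] base)
  obtain A F where A: "ejoin m w0 u0 \<in> A" "A \<subseteq> A0" "smooth_euclid (m + k) A n F"
    "\<And>z. z \<in> A \<Longrightarrow> F z \<in> V" "F (ejoin m w0 u0) = v0"
    "\<And>z. z \<in> A \<Longrightarrow> \<psi> (F z) = p (etake m z) (\<phi> (edrop m z))"
    by (rule etale_chart_lift[OF \<psi> pl, OF a v0 b]) (assumption | rule that)+
  show ?thesis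
    by (rule that[OF smooth_euclidD(1)[OF A(3)] A(1,3,4,5) A0D(1)[OF subsetD[OF A(2)]]
          A0D(2)[OF subsetD[OF A(2)]] A(6)])
qed

text \<open>The same \<open>r\<close> is used for every \<open>w\<close>: it retracts only the map
  at \<open>w0\<close>, and \<Psi> corrects the error for the others, so the retraction at
  \<open>w\<close> is the second part of \<Psi> at (w, r v).\<close>

lemma chart_retraction_stable:
  assumes ret: "retracts_at K M (p w0) (\<phi> u0)"
  obtains W' U' where "eopen m W'" "w0 \<in> W'" "W' \<subseteq> W" "eopen k U'" "u0 \<in> U'" "U' \<subseteq> U"
    "\<And>w. w \<in> W' \<Longrightarrow> \<exists>F g V'. smooth_euclid k U' n F \<and> smooth_euclid n V' k g \<and>
       (\<forall>u\<in>U'. F u \<in> V \<and> F u \<in> V' \<and> \<psi> (F u) = p w (\<phi> u) \<and> g (F u) = u) \<and> (\<forall>v\<in>V'. g v \<in> U')"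
proof -
  obtain Q V1 \<rho> where Q: "openin (D_topology (pullback_dfl K (p w0) n V \<psi>)) Q" "(v0, \<phi> u0) \<in> Q"
    "eopen n V1" "V1 \<subseteq> V" "fst ` Q \<subseteq> V1" "smooth (euclid_dfl n V1) (prod_dfl (euclid_dfl n V) K) \<rho>"
    "\<And>q. q \<in> Q \<Longrightarrow> \<rho> (fst q) = q"
    by (rule retracts_atD[OF ret etale_chart_plot[OF \<psi>], OF v0 base[symmetric]]) (assumption | rule that)+
  have "plot (prod_dfl (euclid_dfl n V) K) n V1 (\<lambda>v. \<rho> v)"
    by (rule smooth_plot[OF Q(6)]) (simp add: smooth_euclid_ident[OF Q(3)])
  then have \<rho>2: "plot K n V1 (\<lambda>v. snd (\<rho> v))" by (simp add: o_def)
  have v0V1: "v0 \<in> V1" using Q(2,5) by force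
  have \<rho>v0: "snd (\<rho> v0) = \<phi> u0" using Q(7)[OF Q(2)] by simp
  obtain V2 r where V2: "v0 \<in> V2" "V2 \<subseteq> V1" "smooth_euclid n V2 k r" "\<And>v. v \<in> V2 \<Longrightarrow> r v \<in> U" "r v0 = u0"
    "\<And>v. v \<in> V2 \<Longrightarrow> \<phi> (r v) = snd (\<rho> v)"
    by (rule etale_chart_lift[OF \<phi> \<rho>2, OF v0V1 u0 \<rho>v0]) (assumption | rule that)+
  note V2o = smooth_euclidD(1)[OF V2(3)]
  obtain A F where A: "eopen (m + k) A" "ejoin m w0 u0 \<in> A" "smooth_euclid (m + k) A n F"
    "\<And>z. z \<in> A \<Longrightarrow> F z \<in> V" "F (ejoin m w0 u0) = v0"
    "\<And>z. z \<in> A \<Longrightarrow> etake m z \<in> W" "\<And>z. z \<in> A \<Longrightarrow> edrop m z \<in> U"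
    "\<And>z. z \<in> A \<Longrightarrow> \<psi> (F z) = p (etake m z) (\<phi> (edrop m z))"
    by (rule family_lift) (assumption | rule that)+
  define G where "G = (\<lambda>u. F (ejoin m w0 u))"
  define U1 where "U1 = {u \<in> U. ejoin m w0 u \<in> A}"
  have js: "smooth_euclid k X (m + k) (\<lambda>u. ejoin m w u)" if "eopen k X" "w \<in> topspace (Euclidean_space m)" for X w
    by (rule ejoin_smooth[OF smooth_euclid_const[OF that] smooth_euclid_ident[OF that(1)]])
  have U1: "eopen k U1" unfolding U1_def by (rule eopen_preimage[OF js[OF U w0_E] A(1)])
  have U1D: "u \<in> U" "ejoin m w0 u \<in> A" if "u \<in> U1" for u using that by (simp_all add: U1_def)
  have G: "smooth_euclid k U1 n G"
    unfolding G_def by (rule smooth_euclid_compose[OF A(3) js[OF U1 w0_E], OF U1D(2)])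
  have GV: "G u \<in> V" "\<psi> (G u) = p w0 (\<phi> u)" if "u \<in> U1" for u
    using A(4)[OF U1D(2)[OF that]] A(8)[OF U1D(2)[OF that]] by (simp_all add: G_def etake_ejoin[OF w0_E])
  have G0: "G u0 = v0" by (simp add: G_def A(5))
  have u0U1: "u0 \<in> U1" by (simp add: U1_def u0 A(2))
  have \<phi>U1: "plot K k U1 \<phi>" by (rule K.plot_mono[OF etale_chart_plot[OF \<phi>] U1]) (simp add: U1_def)
  have gr: "plot (pullback_dfl K (p w0) n V \<psi>) k U1 (\<lambda>u. (G u, \<phi> u))"
    using G \<phi>U1 GV by (simp add: K.plot_pullback o_def)
  define U3 where "U3 = {u \<in> U1. (G u, \<phi> u) \<in> Q} \<inter> {u \<in> U1. G u \<in> V2}"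
  have U3: "eopen k U3" unfolding U3_def
    by (intro openin_Int openin_D_preimage[OF Q(1) gr] eopen_preimage[OF G V2o])
  have U3D: "u \<in> U1" "(G u, \<phi> u) \<in> Q" "G u \<in> V2" if "u \<in> U3" for u using that by (simp_all add: U3_def)
  have u0U3: "u0 \<in> U3" using u0U1 Q(2) V2(1) by (simp add: U3_def G0)
  have U3s: "U3 \<subseteq> U1" using U3D(1) by blast
  have rG: "smooth_euclid k U3 k (\<lambda>u. r (G u))"
    by (rule smooth_euclid_compose[OF V2(3) smooth_euclid_mono[OF G U3 U3s], OF U3D(3)])
  have e: "\<phi> (r (G u)) = \<phi> u" if "u \<in> U3" for u
    using V2(6)[OF U3D(3)[OF that]] Q(7)[OF U3D(2)[OF that]] by simp
  have e0: "r (G u0) = u0" by (simp add: G0 V2(5))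
  \<comment> \<open>As long as (G u, \<phi> u) stays in \<open>Q\<close>, \<rho> recovers \<phi> u
    from \<open>G u\<close>; thus \<open>r (G u)\<close> and \<open>u\<close> lift the same plot
    through \<phi>. They agree at \<open>u0\<close>, hence near it.\<close>
  obtain U4 where U4: "eopen k U4" "u0 \<in> U4" "U4 \<subseteq> U3" "\<And>u. u \<in> U4 \<Longrightarrow> r (G u) = u"
    by (rule etale_chart_unique[OF \<phi> rG smooth_euclid_ident[OF U3], OF V2(4)[OF U3D(3)] U1D(1)[OF U3D(1)] e u0U3 e0]) (assumption | rule that)+
  define A1 where "A1 = {z \<in> A. F z \<in> V2} \<inter> {z \<in> A. edrop m z \<in> U4}"
  have A1: "eopen (m + k) A1" unfolding A1_def
    by (intro openin_Int eopen_preimage[OF A(3) V2o] eopen_preimage[OF edrop_smooth[OF A(1)] U4(1)])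
  have A1D: "z \<in> A" "F z \<in> V2" "edrop m z \<in> U4" if "z \<in> A1" for z using that by (simp_all add: A1_def)
  have A1s: "A1 \<subseteq> A" using A1D(1) by blast
  define \<Phi> where "\<Phi> = (\<lambda>z. ejoin m (etake m z) (r (F z)))"
  have \<Phi>: "smooth_euclid (m + k) A1 (m + k) \<Phi>" unfolding \<Phi>_def
    by (rule ejoin_smooth[OF etake_smooth[OF A1] smooth_euclid_compose[OF V2(3) smooth_euclid_mono[OF A(3) A1 A1s], OF A1D(2)]])
  have aA1: "ejoin m w0 u0 \<in> A1" using A(2,5) V2(1) U4(2) by (simp add: A1_def)
  have par: "\<Phi> z i = z i" if "i < m" for z i using that by (simp add: \<Phi>_def ejoin_def etake_def)
  have fixa: "\<Phi> z = z" if z: "z \<in> A1" and za: "\<And>i. i < m \<Longrightarrow> z i = ejoin m w0 u0 i" for z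
  proof -
    have t: "etake m z = w0"
      using za w0_E by (auto simp: etake_def ejoin_def Euclid_iff fun_eq_iff)
    then have z': "z = ejoin m w0 (edrop m z)" using ejoin_etake_edrop[of m z] by simp
    then have "r (F z) = edrop m z" using U4(4)[OF A1D(3)[OF z]] by (simp add: G_def)
    then show ?thesis using z' by (simp add: \<Phi>_def t)
  qed
  obtain A' B \<Psi> where I: "eopen (m + k) A'" "ejoin m w0 u0 \<in> A'" "A' \<subseteq> A1" "eopen (m + k) B"
    "smooth_euclid (m + k) B (m + k) \<Psi>" "\<And>x. x \<in> A' \<Longrightarrow> \<Phi> x \<in> B" "\<And>y. y \<in> B \<Longrightarrow> \<Psi> y \<in> A'"
    "\<And>x. x \<in> A' \<Longrightarrow> \<Psi> (\<Phi> x) = x" "\<And>y. y \<in> B \<Longrightarrow> \<Phi> (\<Psi> y) = y"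
    by (rule perturbed_identity_local_inverse[OF \<Phi>, OF aA1 le_add1 par fixa]) (assumption | rule that)+
  obtain W' U' where N: "eopen m W'" "w0 \<in> W'" "eopen k U'" "u0 \<in> U'"
    "\<And>w u. w \<in> W' \<Longrightarrow> u \<in> U' \<Longrightarrow> ejoin m w u \<in> A'"
    by (rule eopen_ejoin_nbhd[OF I(1,2) w0_E u0_E]) (assumption | rule that)+
  have wE: "w \<in> topspace (Euclidean_space m)" if "w \<in> W'" for w using eopen_subset[OF N(1) that] .
  have NA: "ejoin m w u \<in> A1" "ejoin m w u \<in> A" if "w \<in> W'" "u \<in> U'" for w u
    using N(5)[OF that] I(3) A1s by blast+
  show ?thesis
  proof (rule that[OF N(1,2) _ N(3,4)])
    show "W' \<subseteq> W" using A(6)[OF NA(2)[OF _ N(4)]] etake_ejoin[OF wE] by auto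
    show "U' \<subseteq> U" using A(7)[OF NA(2)[OF N(2)]] by auto
    fix w assume w: "w \<in> W'"
    define Fw where "Fw = (\<lambda>u. F (ejoin m w u))"
    define g where "g = (\<lambda>v. edrop m (\<Psi> (ejoin m w (r v))))"
    define V3 where "V3 = {v \<in> V2. ejoin m w (r v) \<in> B}"
    have jr: "smooth_euclid n V2 (m + k) (\<lambda>v. ejoin m w (r v))"
      by (rule ejoin_smooth[OF smooth_euclid_const[OF V2o wE[OF w]] V2(3)])
    have V3: "eopen n V3" unfolding V3_def by (rule eopen_preimage[OF jr I(4)])
    have V3s: "V3 \<subseteq> V2" by (auto simp: V3_def)
    have "smooth_euclid n V3 (m + k) (\<lambda>v. \<Psi> (ejoin m w (r v)))"
      by (rule smooth_euclid_compose[OF I(5) smooth_euclid_mono[OF jr V3 V3s]]) (simp add: V3_def)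
    then have g: "smooth_euclid n V3 k g" unfolding g_def
      by (rule smooth_euclid_compose[OF edrop_smooth[OF I(1)]]) (simp add: V3_def I(7))
    \<comment> \<open>Cut down so that \<open>g\<close> lands in \<open>U'\<close>; the image of
      \<open>U'\<close> survives, because \<open>g\<close> undoes the map at
      \<open>w\<close>.\<close>
    define V' where "V' = {v \<in> V3. g v \<in> U'}"
    have V': "eopen n V'" unfolding V'_def by (rule eopen_preimage[OF g N(3)])
    have g': "smooth_euclid n V' k g" by (rule smooth_euclid_mono[OF g V']) (auto simp: V'_def)
    have Fw: "smooth_euclid k U' n Fw" unfolding Fw_def
      by (rule smooth_euclid_compose[OF A(3) js[OF N(3) wE[OF w]], OF NA(2)[OF w]])
    have "Fw u \<in> V \<and> Fw u \<in> V' \<and> \<psi> (Fw u) = p w (\<phi> u) \<and> g (Fw u) = u" if u: "u \<in> U'" for u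
    proof -
      have eq: "\<Phi> (ejoin m w u) = ejoin m w (r (Fw u))"
        by (simp add: \<Phi>_def Fw_def etake_ejoin[OF wE[OF w]])
      have gu: "g (Fw u) = u" using I(8)[OF N(5)[OF w u]] by (simp add: g_def eq)
      have "ejoin m w (r (Fw u)) \<in> B" using I(6)[OF N(5)[OF w u]] by (simp add: eq)
      moreover have "Fw u \<in> V2" using A1D(2)[OF NA(1)[OF w u]] by (simp add: Fw_def)
      ultimately have "Fw u \<in> V'" using gu u by (simp add: V'_def V3_def)
      then show ?thesis using gu A(4)[OF NA(2)[OF w u]] A(8)[OF NA(2)[OF w u]]
        by (simp add: Fw_def etake_ejoin[OF wE[OF w]])
    qed
    moreover have "\<forall>v\<in>V'. g v \<in> U'" by (simp add: V'_def)
    ultimately show "\<exists>F g V'. smooth_euclid k U' n F \<and> smooth_euclid n V' k g \<and>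
       (\<forall>u\<in>U'. F u \<in> V \<and> F u \<in> V' \<and> \<psi> (F u) = p w (\<phi> u) \<and> g (F u) = u) \<and> (\<forall>v\<in>V'. g v \<in> U')"
      using Fw g' by - (rule exI[of _ Fw], rule exI[of _ g], rule exI[of _ V'], simp)
  qed
qed

text \<open>For every nearby pair (w, u) the section passes through \<open>u\<close> itself, which
  is what lifting at \<phi> u requires. The target neighbourhood \<open>N\<close> depends on neither
  \<open>w\<close> nor \<open>u\<close> and is kept for surjectivity.\<close>

lemma chart_section_stable:
  assumes lif: "lifts_at K M (p w0) (\<phi> u0)"
  obtains W' U' N where "eopen m W'" "w0 \<in> W'" "W' \<subseteq> W" "eopen k U'" "u0 \<in> U'" "U' \<subseteq> U"
    "eopen n N" "v0 \<in> N"
    "\<And>w u. w \<in> W' \<Longrightarrow> u \<in> U' \<Longrightarrow> \<exists>Z \<sigma> v. smooth_euclid n Z k \<sigma> \<and> v \<in> Z \<and> \<sigma> v = u \<and>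
       (\<forall>z\<in>Z. z \<in> V \<and> \<sigma> z \<in> U \<and> p w (\<phi> (\<sigma> z)) = \<psi> z)"
    "\<And>w z. w \<in> W' \<Longrightarrow> z \<in> N \<Longrightarrow> z \<in> V \<and> (\<exists>u\<in>U. p w (\<phi> u) = \<psi> z)"
proof -
  obtain V1 L where L: "eopen n V1" "V1 \<subseteq> V" "v0 \<in> V1" "plot K n V1 L" "L v0 = \<phi> u0"
    "\<And>v. v \<in> V1 \<Longrightarrow> p w0 (L v) = \<psi> v"
    by (rule lifts_atD[OF lif etale_chart_plot[OF \<psi>], OF v0 base[symmetric]]) (assumption | rule that)+
  obtain V2 s where s: "v0 \<in> V2" "V2 \<subseteq> V1" "smooth_euclid n V2 k s" "\<And>v. v \<in> V2 \<Longrightarrow> s v \<in> U" "s v0 = u0"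
    "\<And>v. v \<in> V2 \<Longrightarrow> \<phi> (s v) = L v"
    by (rule etale_chart_lift[OF \<phi> L(4), OF L(3) u0 L(5)]) (assumption | rule that)+
  note V2o = smooth_euclidD(1)[OF s(3)]
  obtain A F where A: "eopen (m + k) A" "ejoin m w0 u0 \<in> A" "smooth_euclid (m + k) A n F"
    "\<And>z. z \<in> A \<Longrightarrow> F z \<in> V" "F (ejoin m w0 u0) = v0"
    "\<And>z. z \<in> A \<Longrightarrow> etake m z \<in> W" "\<And>z. z \<in> A \<Longrightarrow> edrop m z \<in> U"
    "\<And>z. z \<in> A \<Longrightarrow> \<psi> (F z) = p (etake m z) (\<phi> (edrop m z))"
    by (rule family_lift) (assumption | rule that)+
  have js: "smooth_euclid n V2 (m + k) (\<lambda>v. ejoin m w0 (s v))"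
    by (rule ejoin_smooth[OF smooth_euclid_const[OF V2o w0_E] s(3)])
  define V3 where "V3 = {v \<in> V2. ejoin m w0 (s v) \<in> A}"
  have V3: "eopen n V3" unfolding V3_def by (rule eopen_preimage[OF js A(1)])
  have V3D: "v \<in> V2" "ejoin m w0 (s v) \<in> A" if "v \<in> V3" for v using that by (simp_all add: V3_def)
  have V3s: "V3 \<subseteq> V2" using V3D(1) by blast
  \<comment> \<open>The map at \<open>w0\<close> after its section, in coordinates. It equals the
    identity only after applying \<psi>, so the germs must be compared at \<open>v0\<close> before
    the identity holds on \<open>V4\<close>.\<close>
  define H where "H = (\<lambda>v. F (ejoin m w0 (s v)))"
  have H: "smooth_euclid n V3 n H" unfolding H_def
    by (rule smooth_euclid_compose[OF A(3) smooth_euclid_mono[OF js V3 V3s], OF V3D(2)])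
  have HV: "H v \<in> V" if "v \<in> V3" for v unfolding H_def by (rule A(4)[OF V3D(2)[OF that]])
  have vV: "v \<in> V" if "v \<in> V3" for v using V3D(1)[OF that] s(2) L(2) by blast
  have e: "\<psi> (H v) = \<psi> v" if v: "v \<in> V3" for v
    using A(8)[OF V3D(2)[OF v]] s(6)[OF V3D(1)[OF v]] L(6)[of v] s(2) V3D(1)[OF v]
    by (auto simp: H_def etake_ejoin[OF w0_E])
  have v0V3: "v0 \<in> V3" using s(1,5) A(2) by (simp add: V3_def)
  have e0: "H v0 = v0" by (simp add: H_def s(5) A(5))
  obtain V4 where V4: "eopen n V4" "v0 \<in> V4" "V4 \<subseteq> V3" "\<And>v. v \<in> V4 \<Longrightarrow> H v = v"
    by (rule etale_chart_unique[OF \<psi> H smooth_euclid_ident[OF V3], OF HV vV e v0V3 e0]) (assumption | rule that)+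
  have V4s: "V4 \<subseteq> V2" using V4(3) V3s by blast
  let ?d = "m + k + n"
  let ?E = "topspace (Euclidean_space ?d)"
  have E: "eopen ?d ?E" by simp
  define A0 where "A0 = {z \<in> ?E. edrop (m + k) z \<in> V4}"
  have A0: "eopen ?d A0" unfolding A0_def by (rule eopen_preimage[OF edrop_smooth[OF E] V4(1)])
  have A0D: "edrop (m + k) z \<in> V4" if "z \<in> A0" for z using that by (simp add: A0_def)
  \<comment> \<open>The argument (w, u - u0 + s v) of \<open>F\<close>. It is (w, s v) for u = u0
    and (w, u) for v = v0; the first case makes \<Phi> the identity on the slice, the second puts
    the section through \<open>u\<close>.\<close>
  define c where "c = (\<lambda>z. ejoin m (etake m (etake (m + k) z))
    (\<lambda>i. edrop m (etake (m + k) z) i - u0 i + s (edrop (m + k) z) i))"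
  have tk: "smooth_euclid ?d A0 (m + k) (etake (m + k))" by (rule etake_smooth[OF A0])
  have Ek: "eopen (m + k) (topspace (Euclidean_space (m + k)))" by simp
  have c1: "smooth_euclid ?d A0 m (\<lambda>z. etake m (etake (m + k) z))"
    by (rule smooth_euclid_compose[OF etake_smooth[OF Ek] tk]) (rule smooth_euclidD(2)[OF tk])
  have c2: "smooth_euclid ?d A0 k (\<lambda>z. edrop m (etake (m + k) z))"
    by (rule smooth_euclid_compose[OF edrop_smooth[OF Ek] tk]) (rule smooth_euclidD(2)[OF tk])
  have c3: "smooth_euclid ?d A0 k (\<lambda>z. s (edrop (m + k) z))"
    by (rule smooth_euclid_compose[OF s(3) edrop_smooth[OF A0]]) (rule subsetD[OF V4s A0D])
  have c: "smooth_euclid ?d A0 (m + k) c" unfolding c_def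
    by (rule ejoin_smooth[OF c1 smooth_euclid_translate[OF c2 c3 u0_E]])
  define A1 where "A1 = {z \<in> A0. c z \<in> A}"
  have A1: "eopen ?d A1" unfolding A1_def by (rule eopen_preimage[OF c A(1)])
  have A1D: "z \<in> A0" "c z \<in> A" if "z \<in> A1" for z using that by (simp_all add: A1_def)
  have A1s: "A1 \<subseteq> A0" using A1D(1) by blast
  define \<Phi> where "\<Phi> = (\<lambda>z. ejoin (m + k) (etake (m + k) z) (F (c z)))"
  have \<Phi>: "smooth_euclid ?d A1 ?d \<Phi>" unfolding \<Phi>_def
    by (rule ejoin_smooth[OF etake_smooth[OF A1] smooth_euclid_compose[OF A(3) smooth_euclid_mono[OF c A1 A1s], OF A1D(2)]])
  have wu: "ejoin m w u \<in> topspace (Euclidean_space (m + k))"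
    if "w \<in> topspace (Euclidean_space m)" "u \<in> topspace (Euclidean_space k)" for w u
    using that by (rule ejoin_Euclid)
  have c_eq: "c z = ejoin m w (\<lambda>i. u i - u0 i + s (edrop (m + k) z) i)"
    if "etake (m + k) z = ejoin m w u" "w \<in> topspace (Euclidean_space m)" for z w u
    unfolding c_def that(1) etake_ejoin[OF that(2)] edrop_ejoin ..
  let ?a = "ejoin (m + k) (ejoin m w0 u0) v0"
  have ta: "etake (m + k) ?a = ejoin m w0 u0" by (rule etake_ejoin[OF wu[OF w0_E u0_E]])
  have ca: "c ?a = ejoin m w0 u0" using c_eq[OF ta w0_E] by (simp add: s(5))
  have aA1: "?a \<in> A1"
    using ejoin_Euclid[OF wu[OF w0_E u0_E] v0_E] V4(2) A(2) by (simp add: A1_def A0_def ca)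
  have par: "\<Phi> z i = z i" if "i < m + k" for z i using that by (simp add: \<Phi>_def ejoin_def etake_def)
  have fixa: "\<Phi> z = z" if z: "z \<in> A1" and za: "\<And>i. i < m + k \<Longrightarrow> z i = ?a i" for z
  proof -
    have "etake (m + k) z = etake (m + k) ?a"
    proof
      fix i
      show "etake (m + k) z i = etake (m + k) ?a i"
      proof (cases "i < m + k")
        case True
        show ?thesis unfolding etake_def if_P[OF True] by (rule za[OF True])
      next
        case False
        show ?thesis unfolding etake_def if_not_P[OF False] ..
      qed
    qed
    then have t: "etake (m + k) z = ejoin m w0 u0" unfolding ta .
    have "F (c z) = H (edrop (m + k) z)" using c_eq[OF t w0_E] by (simp add: H_def)
    also have "\<dots> = edrop (m + k) z" by (rule V4(4)[OF A0D[OF A1D(1)[OF z]]])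
    finally show ?thesis by (simp add: \<Phi>_def)
  qed
  obtain A' B \<Psi> where I: "eopen ?d A'" "?a \<in> A'" "A' \<subseteq> A1" "eopen ?d B"
    "smooth_euclid ?d B ?d \<Psi>" "\<And>x. x \<in> A' \<Longrightarrow> \<Phi> x \<in> B" "\<And>y. y \<in> B \<Longrightarrow> \<Psi> y \<in> A'"
    "\<And>x. x \<in> A' \<Longrightarrow> \<Psi> (\<Phi> x) = x" "\<And>y. y \<in> B \<Longrightarrow> \<Phi> (\<Psi> y) = y"
    by (rule perturbed_identity_local_inverse[OF \<Phi>, OF aA1 le_add1 par fixa]) (assumption | rule that)+
  have aB: "?a \<in> B" using I(6)[OF I(2)] fixa[OF aA1] by simp
  \<comment> \<open>The box in \<open>A'\<close> places the points (w, u, v0) in the domain of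
    \<Phi>; the box in \<open>B\<close> supplies the target neighbourhood \<open>N2\<close> common
    to all parameters.\<close>
  obtain Y1 N1 where Y1: "eopen (m + k) Y1" "ejoin m w0 u0 \<in> Y1" "eopen n N1" "v0 \<in> N1"
    "\<And>y v. y \<in> Y1 \<Longrightarrow> v \<in> N1 \<Longrightarrow> ejoin (m + k) y v \<in> A'"
    by (rule eopen_ejoin_nbhd[OF I(1,2) wu[OF w0_E u0_E] v0_E]) (assumption | rule that)+
  obtain Y2 N2 where Y2: "eopen (m + k) Y2" "ejoin m w0 u0 \<in> Y2" "eopen n N2" "v0 \<in> N2"
    "\<And>y v. y \<in> Y2 \<Longrightarrow> v \<in> N2 \<Longrightarrow> ejoin (m + k) y v \<in> B"
    by (rule eopen_ejoin_nbhd[OF I(4) aB wu[OF w0_E u0_E] v0_E]) (assumption | rule that)+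
  obtain W1 U1 where N: "eopen m W1" "w0 \<in> W1" "eopen k U1" "u0 \<in> U1"
    "\<And>w u. w \<in> W1 \<Longrightarrow> u \<in> U1 \<Longrightarrow> ejoin m w u \<in> Y1 \<inter> Y2"
    by (rule eopen_ejoin_nbhd[OF openin_Int[OF Y1(1) Y2(1)] IntI[OF Y1(2) Y2(2)] w0_E u0_E]) (assumption | rule that)+
  note wE = eopen_subset[OF N(1)] and uE = eopen_subset[OF N(3)]
  \<comment> \<open>\<Psi> solves F(w, u - u0 + s v) = z for \<open>v\<close>; the resulting
    argument of the map at \<open>w\<close> is the value of the section at \<open>z\<close>.\<close>
  define \<sigma> where "\<sigma> = (\<lambda>w u z i. u i - u0 i + s (edrop (m + k) (\<Psi> (ejoin (m + k) (ejoin m w u) z))) i)"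
  have sec: "z \<in> V \<and> \<sigma> w u z \<in> U \<and> p w (\<phi> (\<sigma> w u z)) = \<psi> z"
    if w: "w \<in> W1" and u: "u \<in> U1" and z: "ejoin (m + k) (ejoin m w u) z \<in> B" for w u z
  proof -
    let ?q = "\<Psi> (ejoin (m + k) (ejoin m w u) z)"
    have q: "?q \<in> A1" "\<Phi> ?q = ejoin (m + k) (ejoin m w u) z" using I(7)[OF z] I(3,9) z by blast+
    have "etake (m + k) ?q = etake (m + k) (\<Phi> ?q)" by (simp add: \<Phi>_def)
    then have t: "etake (m + k) ?q = ejoin m w u"
      using q(2) etake_ejoin[OF wu[OF wE[OF w] uE[OF u]]] by simp
    have cq: "c ?q = ejoin m w (\<sigma> w u z)" using c_eq[OF t wE[OF w]] by (simp add: \<sigma>_def)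
    have "F (c ?q) = edrop (m + k) (\<Phi> ?q)" by (simp add: \<Phi>_def)
    then have Fz: "F (c ?q) = z" using q(2) by simp
    show ?thesis
      using A(4)[OF A1D(2)[OF q(1)]] A(7)[OF A1D(2)[OF q(1)]] A(8)[OF A1D(2)[OF q(1)]]
      unfolding Fz by (simp add: cq etake_ejoin[OF wE[OF w]])
  qed
  have b: "ejoin (m + k) (ejoin m w u) v0 \<in> A'" if "w \<in> W1" "u \<in> U1" for w u
    using Y1(5)[OF _ Y1(4)] N(5)[OF that] by blast
  \<comment> \<open>Since \<open>s v0 = u0\<close> the shift cancels. Hence \<Phi> sends (w, u, v0)
    to (w, u, F(w, u)), and the section for (w, u) takes the value \<open>u\<close> at F(w,
    u).\<close>
  have cb: "c (ejoin (m + k) (ejoin m w u) v0) = ejoin m w u" if "w \<in> W1" "u \<in> U1" for w u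
    using c_eq[OF etake_ejoin[OF wu[OF wE[OF that(1)] uE[OF that(2)]]] wE[OF that(1)]] by (simp add: s(5))
  have wuA: "ejoin m w u \<in> A" if "w \<in> W1" "u \<in> U1" for w u
    using A1D(2)[of "ejoin (m + k) (ejoin m w u) v0"] b[OF that] I(3) cb[OF that] by auto
  show ?thesis
  proof (rule that[OF N(1,2) _ N(3,4) _ Y2(3,4)])
    show "W1 \<subseteq> W" using A(6)[OF wuA[OF _ N(4)]] etake_ejoin[OF wE] by auto
    show "U1 \<subseteq> U" using A(7)[OF wuA[OF N(2)]] by auto
    \<comment> \<open>The single section belonging to \<open>u0\<close> already reaches every point
      of \<open>N2\<close>.\<close>
    show "z \<in> V \<and> (\<exists>u\<in>U. p w (\<phi> u) = \<psi> z)" if w: "w \<in> W1" and z: "z \<in> N2" for w z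
      using sec[OF w N(4) Y2(5)[OF _ z]] N(5)[OF w N(4)] by blast
    fix w u assume w: "w \<in> W1" and u: "u \<in> U1"
    define Z where "Z = {z \<in> topspace (Euclidean_space n). ejoin (m + k) (ejoin m w u) z \<in> B}"
    define v where "v = F (ejoin m w u)"
    have En: "eopen n (topspace (Euclidean_space n))" by simp
    have jz: "smooth_euclid n X ?d (\<lambda>z. ejoin (m + k) (ejoin m w u) z)" if "eopen n X" for X
      by (rule ejoin_smooth[OF smooth_euclid_const[OF that wu[OF wE[OF w] uE[OF u]]] smooth_euclid_ident[OF that]])
    have Z: "eopen n Z" unfolding Z_def by (rule eopen_preimage[OF jz[OF En] I(4)])
    have ZD: "ejoin (m + k) (ejoin m w u) z \<in> B" if "z \<in> Z" for z using that by (simp add: Z_def)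
    have s1: "smooth_euclid n Z ?d (\<lambda>z. \<Psi> (ejoin (m + k) (ejoin m w u) z))"
      by (rule smooth_euclid_compose[OF I(5) jz[OF Z], OF ZD])
    have s2: "smooth_euclid n Z n (\<lambda>z. edrop (m + k) (\<Psi> (ejoin (m + k) (ejoin m w u) z)))"
      by (rule smooth_euclid_compose[OF edrop_smooth[OF I(1)] s1, OF I(7)[OF ZD]])
    have s3: "smooth_euclid n Z k (\<lambda>z. s (edrop (m + k) (\<Psi> (ejoin (m + k) (ejoin m w u) z))))"
    proof (rule smooth_euclid_compose[OF s(3) s2])
      fix z assume "z \<in> Z"
      from I(7)[OF ZD[OF this]] show "edrop (m + k) (\<Psi> (ejoin (m + k) (ejoin m w u) z)) \<in> V2"
        using I(3) A1s A0D V4s by blast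
    qed
    have "smooth_euclid n Z k (\<sigma> w u)" unfolding \<sigma>_def
      by (rule smooth_euclid_translate[OF smooth_euclid_const[OF Z uE[OF u]] s3 u0_E])
    moreover have \<Phi>b: "\<Phi> (ejoin (m + k) (ejoin m w u) v0) = ejoin (m + k) (ejoin m w u) v"
      by (simp add: \<Phi>_def v_def cb[OF w u] etake_ejoin[OF wu[OF wE[OF w] uE[OF u]]])
    moreover have "v \<in> Z"
      using I(6)[OF b[OF w u]] eopen_subset[OF V A(4)[OF wuA[OF w u]]] by (simp add: Z_def \<Phi>b v_def[symmetric])
    moreover have "\<sigma> w u v = u"
      using I(8)[OF b[OF w u]] by (simp add: \<sigma>_def \<Phi>b s(5))
    moreover have "\<forall>z\<in>Z. z \<in> V \<and> \<sigma> w u z \<in> U \<and> p w (\<phi> (\<sigma> w u z)) = \<psi> z"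
      using sec[OF w u ZD] by blast
    ultimately show "\<exists>Z \<sigma> v. smooth_euclid n Z k \<sigma> \<and> v \<in> Z \<and> \<sigma> v = u \<and>
       (\<forall>z\<in>Z. z \<in> V \<and> \<sigma> z \<in> U \<and> p w (\<phi> (\<sigma> z)) = \<psi> z)"
      by - (rule exI[of _ Z], rule exI[of _ "\<sigma> w u"], rule exI[of _ v], simp)
  qed
qed

end

section \<open>From charts to D-open neighbourhoods\<close>

context chart_family
begin

text \<open>The D-topology of a product may be finer than the product topology, so joint continuity
  of the family does not by itself give boxes. In charts it does, because the joint domain is
  Euclidean.\<close>

lemma family_continuous:
  assumes N: "openin (D_topology M) N" "p w0 (\<phi> u0) \<in> N"
  obtains W' U' where "eopen m W'" "w0 \<in> W'" "W' \<subseteq> W" "eopen k U'" "u0 \<in> U'" "U' \<subseteq> U"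
    "\<And>w u. w \<in> W' \<Longrightarrow> u \<in> U' \<Longrightarrow> p w (\<phi> u) \<in> N"
proof -
  obtain A F where A: "eopen (m + k) A" "ejoin m w0 u0 \<in> A" "smooth_euclid (m + k) A n F"
    "\<And>z. z \<in> A \<Longrightarrow> F z \<in> V" "F (ejoin m w0 u0) = v0"
    "\<And>z. z \<in> A \<Longrightarrow> etake m z \<in> W" "\<And>z. z \<in> A \<Longrightarrow> edrop m z \<in> U"
    "\<And>z. z \<in> A \<Longrightarrow> \<psi> (F z) = p (etake m z) (\<phi> (edrop m z))"
    by (rule family_lift) (assumption | rule that)+
  define A1 where "A1 = {z \<in> A. F z \<in> {v \<in> V. \<psi> v \<in> N}}"
  have A1: "eopen (m + k) A1" unfolding A1_def
    by (rule eopen_preimage[OF A(3) openin_D_preimage[OF N(1) etale_chart_plot[OF \<psi>]]])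
  have a: "ejoin m w0 u0 \<in> A1" using A(2,5) v0 N(2) base by (simp add: A1_def)
  obtain W' U' where N': "eopen m W'" "w0 \<in> W'" "eopen k U'" "u0 \<in> U'"
    "\<And>w u. w \<in> W' \<Longrightarrow> u \<in> U' \<Longrightarrow> ejoin m w u \<in> A1"
    by (rule eopen_ejoin_nbhd[OF A1 a w0_E u0_E]) (assumption | rule that)+
  have NA: "ejoin m w u \<in> A" "\<psi> (F (ejoin m w u)) \<in> N" if "w \<in> W'" "u \<in> U'" for w u
    using N'(5)[OF that] by (simp_all add: A1_def)
  note wE = eopen_subset[OF N'(1)]
  show ?thesis
  proof (rule that[OF N'(1,2) _ N'(3,4)])
    show "W' \<subseteq> W" using A(6)[OF NA(1)[OF _ N'(4)]] etake_ejoin[OF wE] by auto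
    show "U' \<subseteq> U" using A(7)[OF NA(1)[OF N'(2)]] by auto
    fix w u assume w: "w \<in> W'" and u: "u \<in> U'"
    show "p w (\<phi> u) \<in> N"
      using NA(2)[OF w u] A(8)[OF NA(1)[OF w u]] by (simp add: etake_ejoin[OF wE[OF w]])
  qed
qed

text \<open>On \<open>U'\<close> the map p w after \<phi> equals \<psi> after an \<open>F\<close>
  with left inverse \<open>g\<close>. It is therefore injective once \<psi> is, which etale charts
  need not be; the last conclusion is conditional so that it can be applied with a manifold
  chart.\<close>

lemma retracts_at_stable:
  assumes ret: "retracts_at K M (p w0) (\<phi> u0)"
  obtains W' Q where "eopen m W'" "w0 \<in> W'" "W' \<subseteq> W" "openin (D_topology K) Q" "\<phi> u0 \<in> Q"
    "\<And>w x. w \<in> W' \<Longrightarrow> x \<in> Q \<Longrightarrow> retracts_at K M (p w) x"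
    "\<And>w. w \<in> W' \<Longrightarrow> inj_on \<psi> V \<Longrightarrow> inj_on (p w) Q"
proof -
  obtain W' U' where N: "eopen m W'" "w0 \<in> W'" "W' \<subseteq> W" "eopen k U'" "u0 \<in> U'" "U' \<subseteq> U"
    and st: "\<And>w. w \<in> W' \<Longrightarrow> \<exists>F g V'. smooth_euclid k U' n F \<and> smooth_euclid n V' k g \<and>
       (\<forall>u\<in>U'. F u \<in> V \<and> F u \<in> V' \<and> \<psi> (F u) = p w (\<phi> u) \<and> g (F u) = u) \<and> (\<forall>v\<in>V'. g v \<in> U')"
    by (rule chart_retraction_stable[OF ret]) (assumption | rule that)+
  show ?thesis
  proof (rule that[OF N(1-3) K.openin_etale_chart_image[OF \<phi> N(4,6)] imageI[OF N(5)]])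
    fix w assume w: "w \<in> W'"
    obtain F g V' where F: "smooth_euclid k U' n F" "smooth_euclid n V' k g"
      "\<forall>u\<in>U'. F u \<in> V \<and> F u \<in> V' \<and> \<psi> (F u) = p w (\<phi> u) \<and> g (F u) = u" "\<forall>v\<in>V'. g v \<in> U'"
      using st[OF w] by (elim exE conjE) (rule that; assumption)
    show "retracts_at K M (p w) x" if x: "x \<in> \<phi> ` U'" for x
    proof -
      obtain u where u: "u \<in> U'" "x = \<phi> u" using x by blast
      show ?thesis unfolding u(2)
        by (rule retracts_at_of_chart_retraction[OF K.diffeological_space_axioms M.diffeological_space_axioms
              \<phi> \<psi> N(6) F(1,2)]) (use F(3,4) u(1) in \<open>simp_all\<close>)
    qed
    assume inj: "inj_on \<psi> V"
    show "inj_on (p w) (\<phi> ` U')"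
    proof (rule inj_onI)
      fix x y assume "x \<in> \<phi> ` U'" "y \<in> \<phi> ` U'" and e: "p w x = p w y"
      then obtain u u' where u: "u \<in> U'" "x = \<phi> u" "u' \<in> U'" "y = \<phi> u'" by blast
      have f: "F u \<in> V" "F u' \<in> V" "\<psi> (F u) = p w x" "\<psi> (F u') = p w y" "g (F u) = u" "g (F u') = u'"
        using F(3) u by simp_all
      have e': "\<psi> (F u) = \<psi> (F u')" unfolding f(3,4) by (rule e)
      have "F u = F u'" by (rule inj_onD[OF inj e' f(1,2)])
      then have "u = u'" using f(5,6) by metis
      then show "x = y" unfolding u(2,4) by (rule arg_cong)
    qed
  qed
qed

text \<open>\<open>Q\<close> carries the persistence of lifting. \<open>N\<close>, the chart image
  of the common target neighbourhood, remains in the image of every nearby map and carries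
  surjectivity.\<close>

lemma lifts_at_stable:
  assumes lif: "lifts_at K M (p w0) (\<phi> u0)"
  obtains W' Q N where "eopen m W'" "w0 \<in> W'" "W' \<subseteq> W" "openin (D_topology K) Q" "\<phi> u0 \<in> Q"
    "openin (D_topology M) N" "p w0 (\<phi> u0) \<in> N"
    "\<And>w x. w \<in> W' \<Longrightarrow> x \<in> Q \<Longrightarrow> lifts_at K M (p w) x"
    "\<And>w. w \<in> W' \<Longrightarrow> N \<subseteq> p w ` dspace K"
proof -
  obtain W' U' N where N: "eopen m W'" "w0 \<in> W'" "W' \<subseteq> W" "eopen k U'" "u0 \<in> U'" "U' \<subseteq> U"
    "eopen n N" "v0 \<in> N"
    and st: "\<And>w u. w \<in> W' \<Longrightarrow> u \<in> U' \<Longrightarrow> \<exists>Z \<sigma> v. smooth_euclid n Z k \<sigma> \<and> v \<in> Z \<and> \<sigma> v = u \<and>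
       (\<forall>z\<in>Z. z \<in> V \<and> \<sigma> z \<in> U \<and> p w (\<phi> (\<sigma> z)) = \<psi> z)"
    and im: "\<And>w z. w \<in> W' \<Longrightarrow> z \<in> N \<Longrightarrow> z \<in> V \<and> (\<exists>u\<in>U. p w (\<phi> u) = \<psi> z)"
    by (rule chart_section_stable[OF lif]) (assumption | rule that)+
  have NV: "N \<subseteq> V" using im[OF N(2)] by blast
  show ?thesis
  proof (rule that[OF N(1-3) K.openin_etale_chart_image[OF \<phi> N(4,6)] imageI[OF N(5)]
        M.openin_etale_chart_image[OF \<psi> N(7) NV]])
    show "p w0 (\<phi> u0) \<in> \<psi> ` N" using N(8) base by auto
    fix w assume w: "w \<in> W'"
    show "lifts_at K M (p w) x" if x: "x \<in> \<phi> ` U'" for x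
    proof -
      obtain u where u: "u \<in> U'" "x = \<phi> u" using x by blast
      obtain Z \<sigma> v where Z: "smooth_euclid n Z k \<sigma>" "v \<in> Z" "\<sigma> v = u"
        "\<forall>z\<in>Z. z \<in> V \<and> \<sigma> z \<in> U \<and> p w (\<phi> (\<sigma> z)) = \<psi> z"
        using st[OF w u(1)] by (elim exE conjE) (rule that; assumption)
      show ?thesis unfolding u(2)
        by (rule lifts_at_of_chart_section[OF K.diffeological_space_axioms M.diffeological_space_axioms
              \<phi> \<psi> Z(1-3) bspec[OF Z(4)]])
    qed
    show "\<psi> ` N \<subseteq> p w ` dspace K"
    proof
      fix y assume "y \<in> \<psi> ` N"
      then obtain z where z: "z \<in> N" "y = \<psi> z" by blast
      then obtain u where "u \<in> U" "p w (\<phi> u) = \<psi> z" using im[OF w z(1)] by blast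
      then show "y \<in> p w ` dspace K" using K.etale_chart_into[OF \<phi>] z(2) by (metis imageI)
    qed
  qed
qed

end

section \<open>Usual manifolds\<close>

text \<open>Manifold plots are continuous, so sets open in the manifold topology are D-open and its
  separating sets remain available.\<close>

lemma usual_manifold_Hausdorff:
  assumes M: "diffeological_space M" and us: "usual_manifold M"
  shows "Hausdorff_space (D_topology M)"
proof -
  obtain n T \<A> where T: "topspace T = dspace M" "Hausdorff_space T"
    and pl: "\<And>m U P. plot M m U P \<longleftrightarrow> manifold_plot n T \<A> m U P"
    using us unfolding usual_manifold_def by blast
  have open_T: "openin (D_topology M) S" if S: "openin T S" for S
    unfolding openin_D_topology
  proof (intro conjI allI impI)
    show "S \<subseteq> dspace M" using openin_subset[OF S] T(1) by simp
    fix m U P assume "plot M m U P"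
    then have U: "eopen m U" and c: "continuous_map (subtopology (Euclidean_space m) U) T P"
      by (simp_all add: pl manifold_plot_def)
    have "topspace (subtopology (Euclidean_space m) U) = U"
      using openin_subset[OF U] by (simp add: Int_absorb1)
    then show "eopen m {r \<in> U. P r \<in> S}"
      using openin_trans_full[OF openin_continuous_map_preimage[OF c S] U] by (simp only:)
  qed
  show ?thesis
    unfolding Hausdorff_space_def diffeological_space.topspace_D_topology[OF M]
  proof (intro allI impI)
    fix x y assume "x \<in> dspace M \<and> y \<in> dspace M \<and> x \<noteq> y"
    then obtain A B where "openin T A" "openin T B" "x \<in> A" "y \<in> B" "disjnt A B"
      using T unfolding Hausdorff_space_def by metis
    then show "\<exists>U V. openin (D_topology M) U \<and> openin (D_topology M) V \<and> x \<in> U \<and> y \<in> V \<and> disjnt U V"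
      using open_T by blast
  qed
qed

lemma smooth_atlasD:
  assumes at: "smooth_atlas n T \<A>"
  shows "(W, \<kappa>) \<in> \<A> \<Longrightarrow> openin T W"
    "(W, \<kappa>) \<in> \<A> \<Longrightarrow> eopen n (\<kappa> ` W)"
    "(W, \<kappa>) \<in> \<A> \<Longrightarrow> homeomorphic_map (subtopology T W) (subtopology (Euclidean_space n) (\<kappa> ` W)) \<kappa>"
    "(\<Union>(W, \<kappa>)\<in>\<A>. W) = topspace T"
    "(W, \<kappa>) \<in> \<A> \<Longrightarrow> (W', \<kappa>') \<in> \<A> \<Longrightarrow> smooth_euclid n (\<kappa> ` (W \<inter> W')) n (\<kappa>' \<circ> inv_into W \<kappa>)"
proof -
  note a = conjunct1[OF at[unfolded smooth_atlas_def]]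
  note b = conjunct2[OF conjunct2[OF at[unfolded smooth_atlas_def]]]
  show "(\<Union>(W, \<kappa>)\<in>\<A>. W) = topspace T"
    by (rule conjunct1[OF conjunct2[OF at[unfolded smooth_atlas_def]]])
  assume W: "(W, \<kappa>) \<in> \<A>"
  note a' = bspec[OF a W, unfolded prod.case]
  show "openin T W" by (rule conjunct1[OF a'])
  show "eopen n (\<kappa> ` W)" by (rule conjunct1[OF conjunct2[OF a']])
  show "homeomorphic_map (subtopology T W) (subtopology (Euclidean_space n) (\<kappa> ` W)) \<kappa>"
    by (rule conjunct2[OF conjunct2[OF a']])
  assume W': "(W', \<kappa>') \<in> \<A>"
  note b' = bspec[OF b W, unfolded prod.case]
  show "smooth_euclid n (\<kappa> ` (W \<inter> W')) n (\<kappa>' \<circ> inv_into W \<kappa>)"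
    by (rule bspec[OF b' W', unfolded prod.case])
qed
text \<open>The chart is the inverse \<psi> of a coordinate map \<kappa>. Its being a plot amounts
  to continuity and smooth transition maps; a plot \<open>P\<close> lifts as \<kappa> after
  \<open>P\<close> on the preimage of \<open>W\<close>, uniquely because \<kappa> undoes
  \<psi>.\<close>

lemma usual_manifold_chart:
  assumes us: "usual_manifold M" and y: "y \<in> dspace M"
  obtains n V \<psi> v where "etale_chart M n V \<psi>" "inj_on \<psi> V" "v \<in> V" "\<psi> v = y"
proof -
  obtain n T \<A> where T: "topspace T = dspace M" and at: "smooth_atlas n T \<A>"
    and pl: "\<And>m U P. plot M m U P \<longleftrightarrow> manifold_plot n T \<A> m U P"
    using us unfolding usual_manifold_def by blast
  have at1: "openin T W \<and> eopen n (\<kappa> ` W) \<and>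
      homeomorphic_map (subtopology T W) (subtopology (Euclidean_space n) (\<kappa> ` W)) \<kappa>" if "(W, \<kappa>) \<in> \<A>" for W \<kappa>
    using smooth_atlasD(1-3)[OF at that] by (intro conjI)
  have "y \<in> (\<Union>(W, \<kappa>)\<in>\<A>. W)" unfolding smooth_atlasD(4)[OF at] using y T by simp
  then obtain W \<kappa> where W: "(W, \<kappa>) \<in> \<A>" "y \<in> W" by auto
  note oW = at1[OF W(1)]
  define V where "V = \<kappa> ` W"
  define \<psi> where "\<psi> = inv_into W \<kappa>"
  have V: "eopen n V" using oW by (simp add: V_def)
  have WT: "W \<subseteq> topspace T" using oW openin_subset by blast
  have tW: "topspace (subtopology T W) = W" using WT by (simp add: Int_absorb1)
  have tV: "topspace (subtopology (Euclidean_space n) V) = V" using openin_subset[OF V] by (simp add: Int_absorb1)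
  have inj: "inj_on \<kappa> W"
    using homeomorphic_imp_injective_map[of _ _ \<kappa>] oW tW by metis
  have \<kappa>\<psi>: "\<kappa> (\<psi> v) = v" "\<psi> v \<in> W" if "v \<in> V" for v
    using that by (simp_all add: V_def \<psi>_def f_inv_into_f inv_into_into)
  have \<psi>\<kappa>: "\<psi> (\<kappa> x) = x" if "x \<in> W" for x using that inj by (simp add: \<psi>_def)
  have cont: "continuous_map (subtopology (Euclidean_space n) V) T \<psi>"
  proof -
    have "homeomorphic_map (subtopology T W) (subtopology (Euclidean_space n) V) \<kappa>" using oW by (simp add: V_def)
    then obtain g where g: "homeomorphic_maps (subtopology T W) (subtopology (Euclidean_space n) V) \<kappa> g"
      unfolding homeomorphic_map_maps by blast
    have gc: "continuous_map (subtopology (Euclidean_space n) V) (subtopology T W) g"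
      using g by (simp add: homeomorphic_maps_def)
    have "g v = \<psi> v" if "v \<in> V" for v
    proof -
      have "g v \<in> W" using continuous_map_image_subset_topspace[OF gc] that tV tW by auto
      moreover have "\<kappa> (g v) = v" using g that tV unfolding homeomorphic_maps_def by blast
      ultimately show ?thesis using \<psi>\<kappa>[of "g v"] by simp
    qed
    then have "continuous_map (subtopology (Euclidean_space n) V) (subtopology T W) \<psi>"
      using continuous_map_eq[OF gc, of \<psi>] tV by blast
    then show ?thesis by (simp add: continuous_map_in_subtopology)
  qed
  have "etale_chart M n V \<psi>"
    unfolding etale_chart_def
  proof (intro conjI allI impI)
    show "plot M n V \<psi>"
      unfolding pl manifold_plot_def
    proof (intro conjI V cont ballI)
      fix c assume c: "c \<in> \<A>"
      obtain W' \<kappa>' where c': "c = (W', \<kappa>')" by (cases c)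
      have "{r \<in> V. \<psi> r \<in> W'} = \<kappa> ` (W \<inter> W')"
      proof
        show "{r \<in> V. \<psi> r \<in> W'} \<subseteq> \<kappa> ` (W \<inter> W')"
        proof
          fix r assume r: "r \<in> {r \<in> V. \<psi> r \<in> W'}"
          then show "r \<in> \<kappa> ` (W \<inter> W')"
            using \<kappa>\<psi>[of r] by (intro image_eqI[of r \<kappa> "\<psi> r"]) simp_all
        qed
        show "\<kappa> ` (W \<inter> W') \<subseteq> {r \<in> V. \<psi> r \<in> W'}" using \<psi>\<kappa> by (auto simp: V_def)
      qed
      then show "case c of (W, \<phi>) \<Rightarrow> smooth_euclid n {r \<in> V. \<psi> r \<in> W} n (\<phi> \<circ> \<psi>)"
        using smooth_atlasD(5)[OF at W(1) c[unfolded c']] by (simp add: c' \<psi>_def)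
    qed
  next
    fix m X P r0 v0
    assume P: "plot M m X P" "r0 \<in> X" "v0 \<in> V" "P r0 = \<psi> v0"
    define X' where "X' = {r \<in> X. P r \<in> W}"
    have "smooth_euclid m X' n (\<kappa> \<circ> P)"
      using P(1) W(1) unfolding pl manifold_plot_def X'_def by fast
    then have "smooth_euclid m X' n (\<lambda>r. \<kappa> (P r))" by (simp add: o_def)
    moreover have "r0 \<in> X'" using P(2,4) \<kappa>\<psi>(2)[OF P(3)] by (simp add: X'_def)
    moreover have "\<kappa> (P r0) = v0" using P(4) \<kappa>\<psi>(1)[OF P(3)] by simp
    moreover have "(\<lambda>r. \<kappa> (P r)) \<in> X' \<rightarrow> V" "\<forall>r\<in>X'. \<psi> (\<kappa> (P r)) = P r" "X' \<subseteq> X"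
      using \<psi>\<kappa> by (auto simp: X'_def V_def)
    ultimately show "\<exists>V' L. r0 \<in> V' \<and> V' \<subseteq> X \<and> smooth_euclid m V' n L \<and> L \<in> V' \<rightarrow> V \<and> L r0 = v0 \<and>
        (\<forall>r\<in>V'. \<psi> (L r) = P r)"
      by - (rule exI[of _ X'], rule exI[of _ "\<lambda>r. \<kappa> (P r)"], simp)
  next
    fix m X L L' r0
    assume L: "smooth_euclid m X n L" "L \<in> X \<rightarrow> V" "L' \<in> X \<rightarrow> V" "\<forall>r\<in>X. \<psi> (L r) = \<psi> (L' r)" "r0 \<in> X"
    have "L r = L' r" if "r \<in> X" for r
      using \<kappa>\<psi>(1)[of "L r"] \<kappa>\<psi>(1)[of "L' r"] funcset_mem[OF L(2) that] funcset_mem[OF L(3) that]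
        bspec[OF L(4) that] by metis
    then show "\<exists>V'. eopen m V' \<and> r0 \<in> V' \<and> V' \<subseteq> X \<and> (\<forall>r\<in>V'. L r = L' r)"
      using smooth_euclidD(1)[OF L(1)] L(5) by (intro exI[of _ X] conjI ballI) (assumption | rule order_refl)+
  qed
  moreover have "inj_on \<psi> V" using inj_on_inverseI[of V \<kappa> \<psi>] \<kappa>\<psi>(1) by blast
  moreover have "\<kappa> y \<in> V" "\<psi> (\<kappa> y) = y" using W(2) \<psi>\<kappa> by (simp_all add: V_def)
  ultimately show ?thesis by (rule that)
qed

section \<open>Openness in the space of smooth maps\<close>

text \<open>The tube lemma with a parameter: finitely many \<open>Q x\<close> cover the compact
  space, and the corresponding neighbourhoods of \<open>w0\<close> are intersected.\<close>

lemma compact_uniform_nbhd: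
  assumes T: "compact_space T" and W: "eopen m W" "w0 \<in> W"
    and loc: "\<And>x. x \<in> topspace T \<Longrightarrow> \<exists>W' Q. eopen m W' \<and> w0 \<in> W' \<and> openin T Q \<and> x \<in> Q \<and> (\<forall>w\<in>W'. \<forall>y\<in>Q. R w y)"
  obtains W' where "eopen m W'" "w0 \<in> W'" "W' \<subseteq> W" "\<And>w y. w \<in> W' \<Longrightarrow> y \<in> topspace T \<Longrightarrow> R w y"
proof -
  obtain N Q where NQ: "\<And>x. x \<in> topspace T \<Longrightarrow> eopen m (N x) \<and> w0 \<in> N x \<and> openin T (Q x) \<and> x \<in> Q x \<and>
      (\<forall>w\<in>N x. \<forall>y\<in>Q x. R w y)"
    using loc by metis
  have "\<exists>\<F>. finite \<F> \<and> \<F> \<subseteq> Q ` topspace T \<and> topspace T \<subseteq> \<Union>\<F>"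
  proof (rule compactinD[OF T[unfolded compact_space_def]])
    show "openin T U" if "U \<in> Q ` topspace T" for U using that NQ by blast
    show "topspace T \<subseteq> \<Union>(Q ` topspace T)" using NQ by blast
  qed
  then obtain \<F> where F: "finite \<F>" "\<F> \<subseteq> Q ` topspace T" "topspace T \<subseteq> \<Union>\<F>" by blast
  obtain C where C: "C \<subseteq> topspace T" "finite C" "\<F> = Q ` C" using finite_subset_image[OF F(1,2)] by blast
  \<comment> \<open>The factor \<open>W\<close> also settles the empty index set, which occurs when
    the space is empty.\<close>
  have "eopen m (W \<inter> (\<Inter>x\<in>C. N x))"
    using C(1,2) NQ W(1) by (cases "C = {}") (auto intro!: openin_Int openin_Inter)
  moreover have "R w y" if w: "w \<in> W \<inter> (\<Inter>x\<in>C. N x)" and y: "y \<in> topspace T" for w y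
  proof -
    obtain x where x: "x \<in> C" "y \<in> Q x" using y F(3) C(3) by blast
    then have "w \<in> N x" "x \<in> topspace T" using w C(1) by blast+
    then show ?thesis using NQ x(2) by blast
  qed
  moreover have "w0 \<in> W \<inter> (\<Inter>x\<in>C. N x)" using W(2) NQ C(1) by blast
  ultimately show ?thesis using that by blast
qed

lemma openin_functional_dflI:
  assumes "\<And>m W p w0. plot (functional_dfl K M) m W p \<Longrightarrow> w0 \<in> W \<Longrightarrow> (\<And>w. w \<in> W \<Longrightarrow> p w \<in> smooth_maps K M) \<Longrightarrow>
      R (p w0) \<Longrightarrow> \<exists>W'. eopen m W' \<and> w0 \<in> W' \<and> W' \<subseteq> W \<and> (\<forall>w\<in>W'. R (p w))"
  shows "openin (D_topology (functional_dfl K M)) {f \<in> smooth_maps K M. R f}"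
proof (rule openin_DI)
  show "{f \<in> smooth_maps K M. R f} \<subseteq> dspace (functional_dfl K M)" by (auto simp: functional_dfl_def)
  fix m W p w0 assume p: "plot (functional_dfl K M) m W p" "w0 \<in> W" "p w0 \<in> {f \<in> smooth_maps K M. R f}"
  have sm: "p w \<in> smooth_maps K M" if "w \<in> W" for w
    using p(1) that by (auto simp: functional_dfl_def)
  obtain W' where W': "eopen m W'" "w0 \<in> W'" "W' \<subseteq> W" "\<forall>w\<in>W'. R (p w)"
    using assms[OF p(1,2) sm] p(3) by blast
  show "\<exists>W'. eopen m W' \<and> w0 \<in> W' \<and> W' \<subseteq> W \<and> (\<forall>w\<in>W'. p w \<in> {f \<in> smooth_maps K M. R f})"
    using W' sm by (intro exI[of _ W']) auto
qed

text \<open>Every plot of the subspace is a plot of \<open>X\<close>, so traces of D-open sets are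
  D-open. The D-topology of a subspace can be strictly finer than the trace topology, hence one
  direction only.\<close>

lemma openin_sub_dfl:
  assumes "openin (D_topology X) A"
  shows "openin (D_topology (sub_dfl X S)) (A \<inter> S)"
  unfolding openin_D_topology
proof (intro conjI allI impI)
  show "A \<inter> S \<subseteq> dspace (sub_dfl X S)" using assms by (auto simp: openin_D_topology)
  fix n U P assume "plot (sub_dfl X S) n U P"
  then have P: "plot X n U P" "P \<in> U \<rightarrow> S" by simp_all
  have "{r \<in> U. P r \<in> A \<inter> S} = {r \<in> U. P r \<in> A}" using P(2) by auto
  then show "eopen n {r \<in> U. P r \<in> A \<inter> S}" using openin_D_preimage[OF assms P(1)] by simp
qed

lemma (in diffeological_space) smooth_continuous_map:
  assumes Y: "diffeological_space Y" and f: "smooth X Y f"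
  shows "continuous_map (D_topology X) (D_topology Y) f"
  unfolding continuous_map_def topspace_D_topology diffeological_space.topspace_D_topology[OF Y]
  using openin_D_preimage_smooth[OF f] f by (simp add: smooth_def)

text \<open>A continuous map from a compact space to a Hausdorff space is closed, and an injective
  closed continuous map is a topological embedding; the topological half of an embedding thus
  reduces to injectivity.\<close>

lemma (in diffeological_space) diffeological_embedding_iff:
  assumes Y: "diffeological_space Y" and X: "compact_space (D_topology X)" and H: "Hausdorff_space (D_topology Y)"
  shows "diffeological_embedding X Y f \<longleftrightarrow> inj_on f (dspace X) \<and> diffeological_immersion X Y f"
proof
  assume "diffeological_embedding X Y f"
  then have "diffeological_immersion X Y f" "embedding_map (D_topology X) (D_topology Y) f"
    by (simp_all add: diffeological_embedding_def)
  moreover have "inj_on f (topspace (D_topology X))"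
    using calculation(2) unfolding embedding_map_def by (rule homeomorphic_imp_injective_map)
  ultimately show "inj_on f (dspace X) \<and> diffeological_immersion X Y f" by (simp add: topspace_D_topology)
next
  assume f: "inj_on f (dspace X) \<and> diffeological_immersion X Y f"
  then have "continuous_map (D_topology X) (D_topology Y) f"
    by (intro smooth_continuous_map Y) (simp add: diffeological_immersion_def)
  then have "embedding_map (D_topology X) (D_topology Y) f"
    using continuous_imp_closed_map_gen[OF X Hausdorff_imp_kc_space[OF H]] f
    by (intro injective_closed_imp_embedding_map) (simp_all add: topspace_D_topology)
  then show "diffeological_embedding X Y f" using f by (simp add: diffeological_embedding_def)
qed

section \<open>Openness of the individual classes\<close>

locale etale_manifold_pair = K: diffeological_space K + M: diffeological_space M
  for K :: "'a diffeology" and M :: "'b diffeology" +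
  fixes k n
  assumes manK: "diffeological_etale_n_manifold k K" and manM: "diffeological_etale_n_manifold n M"
    and compK: "compact_space (D_topology K)"
begin

lemma smooth_mapsD:
  assumes "f \<in> smooth_maps K M"
  shows "smooth K M f" "x \<in> dspace K \<Longrightarrow> f x \<in> dspace M"
  using assms by (auto simp: smooth_maps_def smooth_def)

lemma chart_familyI:
  assumes "plot (functional_dfl K M) m W p" "w0 \<in> W" "etale_chart K k U \<phi>" "u0 \<in> U"
    "etale_chart M l V \<psi>" "v0 \<in> V" "p w0 (\<phi> u0) = \<psi> v0"
  shows "chart_family K M m W p k U \<phi> l V \<psi> w0 u0 v0"
  by (unfold_locales) (use assms in auto)

lemma openin_lifts:
  "openin (D_topology (functional_dfl K M)) {f \<in> smooth_maps K M. \<forall>x\<in>dspace K. lifts_at K M f x}"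
  "openin (D_topology (functional_dfl K M)) {f \<in> smooth_maps K M. f ` dspace K = dspace M \<and> (\<forall>x\<in>dspace K. lifts_at K M f x)}"
proof -
  \<comment> \<open>The second conjunct keeps the image of \<open>p w0\<close> inside the image of
    \<open>p w\<close>, so surjectivity passes to \<open>p w\<close>. Indexing the target points as
    \<open>p w0 x\<close> lets compactness of \<open>K\<close> control the target.\<close>
  have main: "\<exists>W'. eopen m W' \<and> w0 \<in> W' \<and> W' \<subseteq> W \<and> (\<forall>w\<in>W'. \<forall>x\<in>dspace K. lifts_at K M (p w) x \<and> p w0 x \<in> p w ` dspace K)"
    if p: "plot (functional_dfl K M) m W p" "w0 \<in> W" "\<And>w. w \<in> W \<Longrightarrow> p w \<in> smooth_maps K M"
      and R: "\<forall>x\<in>dspace K. lifts_at K M (p w0) x" for m W p w0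
  proof -
    note sm = smooth_mapsD[OF p(3)[OF p(2)]]
    have Wo: "eopen m W" using p(1) by (simp add: functional_dfl_def)
    obtain W' where W': "eopen m W'" "w0 \<in> W'" "W' \<subseteq> W"
      "\<And>w x. w \<in> W' \<Longrightarrow> x \<in> topspace (D_topology K) \<Longrightarrow> lifts_at K M (p w) x \<and> p w0 x \<in> p w ` dspace K"
    proof (rule compact_uniform_nbhd[OF compK Wo p(2), where R = "\<lambda>w x. lifts_at K M (p w) x \<and> p w0 x \<in> p w ` dspace K"])
      fix x assume "x \<in> topspace (D_topology K)"
      then have x: "x \<in> dspace K" by (simp add: K.topspace_D_topology)
      obtain U \<phi> u0 where c: "etale_chart K k U \<phi>" "u0 \<in> U" "\<phi> u0 = x" using etale_manifold_chart[OF manK x] by metis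
      obtain V \<psi> v0 where d: "etale_chart M n V \<psi>" "v0 \<in> V" "\<psi> v0 = p w0 x"
        using etale_manifold_chart[OF manM sm(2)[OF x]] by metis
      interpret chart_family K M m W p k U \<phi> n V \<psi> w0 u0 v0
        by (rule chart_familyI) (use p c d in simp_all)
      have l: "lifts_at K M (p w0) (\<phi> u0)" using R x c(3) by simp
      obtain W' Q N where Q: "eopen m W'" "w0 \<in> W'" "W' \<subseteq> W" "openin (D_topology K) Q" "\<phi> u0 \<in> Q"
        "openin (D_topology M) N" "p w0 (\<phi> u0) \<in> N"
        "\<And>w x. w \<in> W' \<Longrightarrow> x \<in> Q \<Longrightarrow> lifts_at K M (p w) x"
        "\<And>w. w \<in> W' \<Longrightarrow> N \<subseteq> p w ` dspace K"
        by (rule lifts_at_stable[OF l]) (assumption | rule that)+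
      \<comment> \<open>\<open>Q\<close> controls lifting at \<open>y\<close>; the preimage of
        \<open>N\<close> under \<open>p w0\<close> controls the target point
        \<open>p w0 y\<close>.\<close>
      have "openin (D_topology K) (Q \<inter> {y \<in> dspace K. p w0 y \<in> N})"
        by (rule openin_Int[OF Q(4) K.openin_D_preimage_smooth[OF sm(1) Q(6)]])
      moreover have "\<forall>w\<in>W'. \<forall>y\<in>Q \<inter> {y \<in> dspace K. p w0 y \<in> N}. lifts_at K M (p w) y \<and> p w0 y \<in> p w ` dspace K"
        using Q(8,9) by blast
      ultimately show "\<exists>W' Q. eopen m W' \<and> w0 \<in> W' \<and> openin (D_topology K) Q \<and> x \<in> Q \<and>
          (\<forall>w\<in>W'. \<forall>y\<in>Q. lifts_at K M (p w) y \<and> p w0 y \<in> p w ` dspace K)"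
        using Q(1,2,5,7) c(3) x by (intro exI[of _ W'] exI[of _ "Q \<inter> {y \<in> dspace K. p w0 y \<in> N}"]) simp
    qed (assumption | rule that)+
    then show ?thesis unfolding K.topspace_D_topology by (intro exI[of _ W']) simp
  qed
  show "openin (D_topology (functional_dfl K M)) {f \<in> smooth_maps K M. \<forall>x\<in>dspace K. lifts_at K M f x}"
  proof (rule openin_functional_dflI)
    fix m W p w0
    assume p: "plot (functional_dfl K M) m W p" "w0 \<in> W" "\<And>w. w \<in> W \<Longrightarrow> p w \<in> smooth_maps K M"
      and R: "\<forall>x\<in>dspace K. lifts_at K M (p w0) x"
    show "\<exists>W'. eopen m W' \<and> w0 \<in> W' \<and> W' \<subseteq> W \<and> (\<forall>w\<in>W'. \<forall>x\<in>dspace K. lifts_at K M (p w) x)"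
      using main[OF p R] by blast
  qed
  show "openin (D_topology (functional_dfl K M)) {f \<in> smooth_maps K M. f ` dspace K = dspace M \<and> (\<forall>x\<in>dspace K. lifts_at K M f x)}"
  proof (rule openin_functional_dflI)
    fix m W p w0
    assume p: "plot (functional_dfl K M) m W p" "w0 \<in> W" "\<And>w. w \<in> W \<Longrightarrow> p w \<in> smooth_maps K M"
      and R: "p w0 ` dspace K = dspace M \<and> (\<forall>x\<in>dspace K. lifts_at K M (p w0) x)"
    obtain W' where W': "eopen m W'" "w0 \<in> W'" "W' \<subseteq> W"
      "\<forall>w\<in>W'. \<forall>x\<in>dspace K. lifts_at K M (p w) x \<and> p w0 x \<in> p w ` dspace K"
      using main[OF p conjunct2[OF R]] by blast
    have "p w ` dspace K = dspace M" if w: "w \<in> W'" for w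
    proof
      show "p w ` dspace K \<subseteq> dspace M" using smooth_mapsD(2)[OF p(3)] W'(3) w by blast
      have "p w0 ` dspace K \<subseteq> p w ` dspace K" using W'(4) w by blast
      then show "dspace M \<subseteq> p w ` dspace K" using R by simp
    qed
    then show "\<exists>W'. eopen m W' \<and> w0 \<in> W' \<and> W' \<subseteq> W \<and>
        (\<forall>w\<in>W'. p w ` dspace K = dspace M \<and> (\<forall>x\<in>dspace K. lifts_at K M (p w) x))"
      using W' by (intro exI[of _ W']) simp
  qed
qed

lemma retracts_nbhd:
  assumes p: "plot (functional_dfl K M) m W p" "w0 \<in> W" "\<And>w. w \<in> W \<Longrightarrow> p w \<in> smooth_maps K M"
    and R: "\<forall>x\<in>dspace K. retracts_at K M (p w0) x"
  obtains W' where "eopen m W'" "w0 \<in> W'" "W' \<subseteq> W" "\<And>w x. w \<in> W' \<Longrightarrow> x \<in> dspace K \<Longrightarrow> retracts_at K M (p w) x"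
proof -
  note sm = smooth_mapsD[OF p(3)[OF p(2)]]
  have Wo: "eopen m W" using p(1) by (simp add: functional_dfl_def)
  obtain W' where W': "eopen m W'" "w0 \<in> W'" "W' \<subseteq> W"
    "\<And>w x. w \<in> W' \<Longrightarrow> x \<in> topspace (D_topology K) \<Longrightarrow> retracts_at K M (p w) x"
  proof (rule compact_uniform_nbhd[OF compK Wo p(2), where R = "\<lambda>w x. retracts_at K M (p w) x"])
    fix x assume "x \<in> topspace (D_topology K)"
    then have x: "x \<in> dspace K" by (simp add: K.topspace_D_topology)
    obtain U \<phi> u0 where c: "etale_chart K k U \<phi>" "u0 \<in> U" "\<phi> u0 = x" using etale_manifold_chart[OF manK x] by metis
    obtain V \<psi> v0 where d: "etale_chart M n V \<psi>" "v0 \<in> V" "\<psi> v0 = p w0 x"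
      using etale_manifold_chart[OF manM sm(2)[OF x]] by metis
    interpret chart_family K M m W p k U \<phi> n V \<psi> w0 u0 v0
      by (rule chart_familyI) (use p c d in simp_all)
    have l: "retracts_at K M (p w0) (\<phi> u0)" using R x c(3) by simp
    obtain W' Q where Q: "eopen m W'" "w0 \<in> W'" "W' \<subseteq> W" "openin (D_topology K) Q" "\<phi> u0 \<in> Q"
      "\<And>w x. w \<in> W' \<Longrightarrow> x \<in> Q \<Longrightarrow> retracts_at K M (p w) x"
      "\<And>w. w \<in> W' \<Longrightarrow> inj_on \<psi> V \<Longrightarrow> inj_on (p w) Q"
      by (rule retracts_at_stable[OF l]) (assumption | rule that)+
    then show "\<exists>W' Q. eopen m W' \<and> w0 \<in> W' \<and> openin (D_topology K) Q \<and> x \<in> Q \<and>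
        (\<forall>w\<in>W'. \<forall>y\<in>Q. retracts_at K M (p w) y)"
      using c(3) by (intro exI[of _ W'] exI[of _ Q]) simp
  qed (assumption | rule that)+
  show ?thesis by (rule that[OF W'(1-3)]) (simp add: W'(4) K.topspace_D_topology)
qed

lemma openin_immersions:
  "openin (D_topology (functional_dfl K M)) {f \<in> smooth_maps K M. diffeological_immersion K M f}"
proof (rule openin_functional_dflI)
  fix m W p w0
  assume p: "plot (functional_dfl K M) m W p" "w0 \<in> W" "\<And>w. w \<in> W \<Longrightarrow> p w \<in> smooth_maps K M"
    and "diffeological_immersion K M (p w0)"
  then have R: "\<forall>x\<in>dspace K. retracts_at K M (p w0) x" by (simp add: diffeological_immersion_iff)
  obtain W' where W': "eopen m W'" "w0 \<in> W'" "W' \<subseteq> W" "\<And>w x. w \<in> W' \<Longrightarrow> x \<in> dspace K \<Longrightarrow> retracts_at K M (p w) x"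
    by (rule retracts_nbhd[OF p R]) (assumption | rule that)+
  have "diffeological_immersion K M (p w)" if "w \<in> W'" for w
    using W'(3,4) that smooth_mapsD(1)[OF p(3)] by (auto simp: diffeological_immersion_iff)
  then show "\<exists>W'. eopen m W' \<and> w0 \<in> W' \<and> W' \<subseteq> W \<and> (\<forall>w\<in>W'. diffeological_immersion K M (p w))"
    using W' by (intro exI[of _ W']) simp
qed

text \<open>Injectivity is treated as a condition on pairs: equal entries or distinct images. Near
  the diagonal it is local injectivity, uniform in \<open>w\<close>. Near a pair with distinct
  entries, the images under \<open>p w0\<close> have disjoint D-open neighbourhoods, and joint
  continuity keeps the nearby images inside them.\<close>

lemma openin_injective_immersions:
  assumes us: "usual_manifold M"
  shows "openin (D_topology (functional_dfl K M))
    {f \<in> smooth_maps K M. inj_on f (dspace K) \<and> diffeological_immersion K M f}"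
proof (rule openin_functional_dflI)
  fix m W p w0
  assume p: "plot (functional_dfl K M) m W p" "w0 \<in> W" "\<And>w. w \<in> W \<Longrightarrow> p w \<in> smooth_maps K M"
    and f: "inj_on (p w0) (dspace K) \<and> diffeological_immersion K M (p w0)"
  note sm = smooth_mapsD[OF p(3)[OF p(2)]]
  have Wo: "eopen m W" using p(1) by (simp add: functional_dfl_def)
  have R: "\<forall>x\<in>dspace K. retracts_at K M (p w0) x" using f by (simp add: diffeological_immersion_iff)
  obtain W1 where W1: "eopen m W1" "w0 \<in> W1" "W1 \<subseteq> W" "\<And>w x. w \<in> W1 \<Longrightarrow> x \<in> dspace K \<Longrightarrow> retracts_at K M (p w) x"
    by (rule retracts_nbhd[OF p R]) (assumption | rule that)+
  have H: "Hausdorff_space (D_topology M)" by (rule usual_manifold_Hausdorff[OF M.diffeological_space_axioms us])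
  let ?T = "prod_topology (D_topology K) (D_topology K)"
  have T: "compact_space ?T" using compK by (simp add: compact_space_prod_topology)
  have cont: "\<exists>W' Q. eopen m W' \<and> w0 \<in> W' \<and> openin (D_topology K) Q \<and> x \<in> Q \<and> (\<forall>w\<in>W'. \<forall>y\<in>Q. p w y \<in> N)"
    if x: "x \<in> dspace K" and N: "openin (D_topology M) N" "p w0 x \<in> N" for x N
  proof -
    obtain U \<phi> u0 where c: "etale_chart K k U \<phi>" "u0 \<in> U" "\<phi> u0 = x" using etale_manifold_chart[OF manK x] by metis
    obtain V \<psi> v0 where d: "etale_chart M n V \<psi>" "v0 \<in> V" "\<psi> v0 = p w0 x"
      using etale_manifold_chart[OF manM sm(2)[OF x]] by metis
    interpret chart_family K M m W p k U \<phi> n V \<psi> w0 u0 v0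
      by (rule chart_familyI) (use p c d in simp_all)
    have N2: "p w0 (\<phi> u0) \<in> N" using N(2) c(3) by simp
    obtain W' U' where Q: "eopen m W'" "w0 \<in> W'" "W' \<subseteq> W" "eopen k U'" "u0 \<in> U'" "U' \<subseteq> U"
      "\<And>w u. w \<in> W' \<Longrightarrow> u \<in> U' \<Longrightarrow> p w (\<phi> u) \<in> N"
      by (rule family_continuous[OF N(1) N2]) (assumption | rule that)+
    show ?thesis
      using Q(1,2,5,7) K.openin_etale_chart_image[OF c(1) Q(4,6)] c(3)
      by (intro exI[of _ W'] exI[of _ "\<phi> ` U'"]) auto
  qed
  have near: "\<exists>W' S. eopen m W' \<and> w0 \<in> W' \<and> openin ?T S \<and> (x, y) \<in> S \<and>
      (\<forall>w\<in>W'. \<forall>q\<in>S. fst q = snd q \<or> p w (fst q) \<noteq> p w (snd q))"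
    if xy: "x \<in> dspace K" "y \<in> dspace K" for x y
  proof (cases "x = y")
    case True
    obtain U \<phi> u0 where c: "etale_chart K k U \<phi>" "u0 \<in> U" "\<phi> u0 = x" using etale_manifold_chart[OF manK xy(1)] by metis
    \<comment> \<open>The injective target chart comes from the atlas; its dimension
      \<open>l\<close> is not compared with \<open>n\<close>.\<close>
    obtain l V \<psi> v0 where d: "etale_chart M l V \<psi>" "inj_on \<psi> V" "v0 \<in> V" "\<psi> v0 = p w0 x"
      using usual_manifold_chart[OF us sm(2)[OF xy(1)]] by metis
    interpret chart_family K M m W p k U \<phi> l V \<psi> w0 u0 v0
      by (rule chart_familyI) (use p c d in simp_all)
    have r: "retracts_at K M (p w0) (\<phi> u0)" using R xy(1) c(3) by simp
    obtain W' Q where Q: "eopen m W'" "w0 \<in> W'" "W' \<subseteq> W" "openin (D_topology K) Q" "\<phi> u0 \<in> Q"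
      "\<And>w x. w \<in> W' \<Longrightarrow> x \<in> Q \<Longrightarrow> retracts_at K M (p w) x"
      "\<And>w. w \<in> W' \<Longrightarrow> inj_on \<psi> V \<Longrightarrow> inj_on (p w) Q"
      by (rule retracts_at_stable[OF r]) (assumption | rule that)+
    have "openin ?T (Q \<times> Q)" using Q(4) by (simp add: openin_prod_Times_iff)
    moreover have "(x, y) \<in> Q \<times> Q" using Q(5) c(3) True by simp
    moreover have "\<forall>w\<in>W'. \<forall>q\<in>Q \<times> Q. fst q = snd q \<or> p w (fst q) \<noteq> p w (snd q)"
      using inj_onD[OF Q(7)[OF _ d(2)]] by fastforce
    ultimately show ?thesis using Q(1,2) by blast
  next
    case False
    then have "p w0 x \<noteq> p w0 y" using f xy by (auto dest: inj_onD)
    then obtain N1 N2 where N: "openin (D_topology M) N1" "openin (D_topology M) N2" "p w0 x \<in> N1" "p w0 y \<in> N2" "disjnt N1 N2"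
      using H sm(2) xy unfolding Hausdorff_space_def M.topspace_D_topology by metis
    obtain W2 Q1 where 1: "eopen m W2" "w0 \<in> W2" "openin (D_topology K) Q1" "x \<in> Q1" "\<forall>w\<in>W2. \<forall>y\<in>Q1. p w y \<in> N1"
      using cont[OF xy(1) N(1,3)] by (elim exE conjE) (rule that; assumption)
    obtain W3 Q2 where 2: "eopen m W3" "w0 \<in> W3" "openin (D_topology K) Q2" "y \<in> Q2" "\<forall>w\<in>W3. \<forall>y\<in>Q2. p w y \<in> N2"
      using cont[OF xy(2) N(2,4)] by (elim exE conjE) (rule that; assumption)
    have "openin ?T (Q1 \<times> Q2)" using 1(3) 2(3) by (simp add: openin_prod_Times_iff)
    moreover have "p w (fst q) \<noteq> p w (snd q)" if "w \<in> W2 \<inter> W3" "q \<in> Q1 \<times> Q2" for w q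
    proof -
      have "p w (fst q) \<in> N1" "p w (snd q) \<in> N2" using that 1(5) 2(5) by auto
      then show ?thesis using N(5) by (auto simp: disjnt_iff)
    qed
    moreover have "eopen m (W2 \<inter> W3)" using 1(1) 2(1) by (rule openin_Int)
    ultimately show ?thesis
      using 1(2,4) 2(2,4) by (intro exI[of _ "W2 \<inter> W3"] exI[of _ "Q1 \<times> Q2"]) auto
  qed
  obtain W' where W': "eopen m W'" "w0 \<in> W'" "W' \<subseteq> W1"
    "\<And>w q. w \<in> W' \<Longrightarrow> q \<in> topspace ?T \<Longrightarrow> fst q = snd q \<or> p w (fst q) \<noteq> p w (snd q)"
  proof (rule compact_uniform_nbhd[OF T W1(1,2), where R = "\<lambda>w q. fst q = snd q \<or> p w (fst q) \<noteq> p w (snd q)"])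
    fix q assume "q \<in> topspace ?T"
    then have "fst q \<in> dspace K" "snd q \<in> dspace K" by (auto simp: K.topspace_D_topology)
    from near[OF this] show "\<exists>W' S. eopen m W' \<and> w0 \<in> W' \<and> openin ?T S \<and> q \<in> S \<and>
      (\<forall>w\<in>W'. \<forall>q\<in>S. fst q = snd q \<or> p w (fst q) \<noteq> p w (snd q))" by simp
  qed (assumption | rule that)+
  have "inj_on (p w) (dspace K) \<and> diffeological_immersion K M (p w)" if w: "w \<in> W'" for w
  proof
    show "inj_on (p w) (dspace K)"
    proof (rule inj_onI)
      fix x y assume "x \<in> dspace K" "y \<in> dspace K" "p w x = p w y"
      then show "x = y" using W'(4)[OF w, of "(x, y)"] by (simp add: K.topspace_D_topology)
    qed
    have "w \<in> W1" "w \<in> W" using w W'(3) W1(3) by blast+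
    then show "diffeological_immersion K M (p w)"
      using W1(4) smooth_mapsD(1)[OF p(3)] by (simp add: diffeological_immersion_iff)
  qed
  then show "\<exists>W'. eopen m W' \<and> w0 \<in> W' \<and> W' \<subseteq> W \<and>
      (\<forall>w\<in>W'. inj_on (p w) (dspace K) \<and> diffeological_immersion K M (p w))"
    using W'(1-3) W1(3) by (intro exI[of _ W']) auto
qed

lemma openin_submersions:
  "openin (D_topology (functional_dfl K M)) {f \<in> smooth_maps K M. diffeological_submersion K M f}"
proof -
  have "{f \<in> smooth_maps K M. diffeological_submersion K M f} = {f \<in> smooth_maps K M. \<forall>x\<in>dspace K. lifts_at K M f x}"
    using smooth_mapsD(1) by (auto simp: K.diffeological_submersion_iff[OF M.diffeological_space_axioms])
  then show ?thesis using openin_lifts(1) by simp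
qed

lemma openin_local_subductions:
  "openin (D_topology (functional_dfl K M)) {f \<in> smooth_maps K M. local_subduction K M f}"
proof -
  have "{f \<in> smooth_maps K M. local_subduction K M f} =
      {f \<in> smooth_maps K M. f ` dspace K = dspace M \<and> (\<forall>x\<in>dspace K. lifts_at K M f x)}"
    using smooth_mapsD(1) by (auto simp: local_subduction_iff)
  then show ?thesis using openin_lifts(2) by simp
qed

lemma openin_etale:
  "openin (D_topology (functional_dfl K M)) {f \<in> smooth_maps K M. diffeological_etale K M f}"
proof -
  have "{f \<in> smooth_maps K M. diffeological_etale K M f} =
      {f \<in> smooth_maps K M. diffeological_submersion K M f} \<inter> {f \<in> smooth_maps K M. diffeological_immersion K M f}"
    by (auto simp: K.diffeological_etale_iff[OF M.diffeological_space_axioms])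
  then show ?thesis using openin_Int[OF openin_submersions openin_immersions] by simp
qed

end

theorem theorem1p12:
  fixes K :: "'a diffeology" and M :: "'b diffeology"
  assumes "diffeological_etale_manifold K"
    and "diffeological_etale_manifold M"
    and "compact_space (D_topology K)"
  defines "C \<equiv> functional_dfl K M"
  defines "Inj \<equiv> sub_dfl C {f \<in> smooth_maps K M. inj_on f (dspace K)}"
  shows
    "openin (D_topology C) {f \<in> smooth_maps K M. diffeological_submersion K M f} \<and>
     openin (D_topology C) {f \<in> smooth_maps K M. diffeological_immersion K M f} \<and>
     openin (D_topology C) {f \<in> smooth_maps K M. diffeological_etale K M f} \<and>
     (Hausdorff_space (D_topology M) \<longrightarrow>
        openin (D_topology C) {f \<in> smooth_maps K M. local_subduction K M f}) \<and>
     (usual_manifold M \<longrightarrow>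
        openin (D_topology C)
          {f \<in> smooth_maps K M. inj_on f (dspace K) \<and> diffeological_immersion K M f} \<and>
        openin (D_topology C) {f \<in> smooth_maps K M. diffeological_embedding K M f} \<and>
        openin (D_topology C) {f \<in> smooth_maps K M. diffeomorphism K M f}) \<and>
     (Hausdorff_space (D_topology M) \<longrightarrow>
        openin (D_topology Inj) {f \<in> smooth_maps K M. diffeological_embedding K M f} \<and>
        openin (D_topology Inj) {f \<in> smooth_maps K M. diffeomorphism K M f})"
proof -
  obtain k n where man: "diffeological_etale_n_manifold k K" "diffeological_etale_n_manifold n M"
    using assms(1,2) by (auto simp: diffeological_etale_manifold_def)
  have sp: "diffeological_space K" "diffeological_space M"
    using man unfolding diffeological_etale_n_manifold_def by (simp_all only:)
  interpret etale_manifold_pair K M k n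
    by (rule etale_manifold_pair.intro[OF sp etale_manifold_pair_axioms.intro[OF man assms(3)]])
  let ?S = "{f \<in> smooth_maps K M. inj_on f (dspace K)}"
  have diffeo: "diffeomorphism K M f \<longleftrightarrow> inj_on f (dspace K) \<and> local_subduction K M f" for f
    by (rule K.diffeomorphism_iff[OF sp(2)])
  have emb: "diffeological_embedding K M f \<longleftrightarrow> inj_on f (dspace K) \<and> diffeological_immersion K M f"
    if "Hausdorff_space (D_topology M)" for f
    by (rule K.diffeological_embedding_iff[OF sp(2) compK that])
  have usual: "openin (D_topology C) {f \<in> smooth_maps K M. inj_on f (dspace K) \<and> diffeological_immersion K M f} \<and>
        openin (D_topology C) {f \<in> smooth_maps K M. diffeological_embedding K M f} \<and>
        openin (D_topology C) {f \<in> smooth_maps K M. diffeomorphism K M f}" if us: "usual_manifold M"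
  proof (intro conjI)
    let ?I = "{f \<in> smooth_maps K M. inj_on f (dspace K) \<and> diffeological_immersion K M f}"
    show I: "openin (D_topology C) ?I" unfolding C_def by (rule openin_injective_immersions[OF us])
    then show "openin (D_topology C) {f \<in> smooth_maps K M. diffeological_embedding K M f}"
      unfolding emb[OF usual_manifold_Hausdorff[OF sp(2) us]] .
    \<comment> \<open>Injectivity has been shown to persist only together with the immersion
      property, so diffeomorphisms are described as the injective immersions that are local
      subductions.\<close>
    have "{f \<in> smooth_maps K M. diffeomorphism K M f} = ?I \<inter> {f \<in> smooth_maps K M. local_subduction K M f}"
      using K.diffeomorphism_imp_immersion[OF sp(2)] diffeo by blast
    then show "openin (D_topology C) {f \<in> smooth_maps K M. diffeomorphism K M f}"
      using openin_Int[OF I openin_local_subductions[folded C_def]] by simp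
  qed
  have inj1: "openin (D_topology Inj) {f \<in> smooth_maps K M. diffeological_embedding K M f}"
    if H: "Hausdorff_space (D_topology M)"
  proof -
    \<comment> \<open>Injectivity now belongs to the ambient subspace, so it is enough to take the
      trace of an open set of smooth maps.\<close>
    have "{f \<in> smooth_maps K M. diffeological_embedding K M f} = {f \<in> smooth_maps K M. diffeological_immersion K M f} \<inter> ?S"
      unfolding emb[OF H] by blast
    then show ?thesis unfolding Inj_def C_def using openin_sub_dfl[OF openin_immersions] by simp
  qed
  have inj2: "openin (D_topology Inj) {f \<in> smooth_maps K M. diffeomorphism K M f}"
  proof -
    have "{f \<in> smooth_maps K M. diffeomorphism K M f} = {f \<in> smooth_maps K M. local_subduction K M f} \<inter> ?S"
      unfolding diffeo by blast
    then show ?thesis unfolding Inj_def C_def using openin_sub_dfl[OF openin_local_subductions] by simp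
  qed
  show ?thesis
    using openin_submersions openin_immersions openin_etale openin_local_subductions usual inj1 inj2
    unfolding C_def[symmetric] by blast
qed

end
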